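(* Let $n\ge 3$ and put $c:=\binom{n-1}{2}+1$. If $\mathcal O_{\mathfrak q}=\mathcal O_{\mathfrak q}(\mathbb F^n)$ is a quantum affine space over a field $\mathbb F$ whose $\lambda$-group is torsion-free and has rank no smaller than $c$, then $$\mathrm{Aut}_{\mathbb F}(\mathcal O_{\mathfrak q})=(\mathbb F^\ast)^n.$$ Moreover, $c$ is minimal with respect to this property, and for each $n\ge 3$ and each non-negative integer $r<\binom{n-1}{2}+1$ there exists a quantum affine space $\mathcal O_{\mathfrak q}=\mathcal O_{\mathfrak q}(\mathbb F^n)$ (over some field $\mathbb F$) whose $\lambda$-group is isomorphic to $\mathbb Z^r$ but whose automorphism group $\mathrm{Aut}_{\mathbb F}(\mathcal O_{\mathfrak q})$ contains a subgroup isomorphic to $(\mathbb F^\ast)^n\rtimes\mathbb F^+$.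
   Context: Let $\mathbb F$ be a field and $\mathfrak q=(q_{ij})$ an $n\times n$ matrix with entries in $\mathbb F^\ast$ that is multiplicatively antisymmetric: $q_{ii}=1$, $q_{ji}=q_{ij}^{-1}$. The quantum affine space $\mathcal O_{\mathfrak q}=\mathcal O_{\mathfrak q}(\mathbb F^n)$ is the quotient of the free associative $\mathbb F$-algebra on $X_1,\dots,X_n$ by the ideal generated by $X_iX_j-q_{ij}X_jX_i$, $1\le i<j\le n$. Its $\lambda$-group is the subgroup $\Lambda$ of $\mathbb F^\ast$ generated by all the $q_{ij}$. The rank of an abelian group $A$ is its torsion-free rank $\dim_{\mathbb Q}(A\otimes_{\mathbb Z}\mathbb Q)$. $\mathrm{Aut}_{\mathbb F}(\mathcal O_{\mathfrak q})$ is the group of $\mathbb F$-algebra automorphisms; $(\mathbb F^\ast)^n$ is identified with the subgroup of scalar automorphisms $X_i\mapsto t_iX_i$ ($t_i\in\mathbb F^\ast$), so the equality $\mathrm{Aut}_{\mathbb F}(\mathcal O_{\mathfrak q})=(\mathbb F^\ast)^n$ means every automorphism is of this form. $\mathbb F^+$ is the additive group of $\mathbb F$. In $(\mathbb F^\ast)^n\rtimes\mathbb F^+$ the normal factor is $\mathbb F^+$, and for some index $k$ the element $(t_1,\dots,t_n)\in(\mathbb F^\ast)^n$ acts on $\mathbb F^+$ by $b\mapsto t_kb$ (up to isomorphism the resulting group does not depend on $k$, nor on replacing $t_k$ by $t_k^{-1}$). *)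

theory Defs
  imports
    "HOL-Algebra.QuotRing"
    "HOL-Algebra.Bij"
    "HOL-Algebra.Product_Groups"
    "HOL-Algebra.Free_Abelian_Groups"
    "Jordan_Normal_Form.VS_Connect"
    Complex_Main
begin

text \<open>
  Fields are \<open>HOL-Algebra\<close> records \<open>F\<close>, so that a statement may assert the existence of a field:
  \<open>\<exists>F :: complex ring. field F \<and> \<dots>\<close> ranges over all field structures on all subsets of the type
  \<^typ>\<open>complex\<close>, hence, up to isomorphism, over all fields of at most continuum cardinality.
  Variables are indexed by \<open>{1..n}\<close>; a matrix is a function \<open>nat \<Rightarrow> nat \<Rightarrow> 'a\<close>
  of which only the entries with both indices in \<open>{1..n}\<close> are ever used.
\<close>

section \<open>Quantum affine spaces\<close>

definition mult_antisymmetric :: "('a, 'b) ring_scheme \<Rightarrow> nat \<Rightarrow> (nat \<Rightarrow> nat \<Rightarrow> 'a) \<Rightarrow> bool"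
  where "mult_antisymmetric F n q \<longleftrightarrow>
    (\<forall>i\<in>{1..n}. \<forall>j\<in>{1..n}.
       q i j \<in> Units F \<and> q i i = \<one>\<^bsub>F\<^esub> \<and> q j i = inv\<^bsub>F\<^esub> (q i j))"

text \<open>
  The free associative algebra has the words over \<open>{1..n}\<close> as a basis; an element is its
  finitely supported coefficient function, and multiplication extends concatenation of words.
\<close>

definition free_algebra :: "('a, 'b) ring_scheme \<Rightarrow> nat \<Rightarrow> ('a, nat list \<Rightarrow> 'a) module"
  where "free_algebra F n =
    \<lparr>carrier = {f. (\<forall>w. f w \<in> carrier F) \<and> finite {w. f w \<noteq> \<zero>\<^bsub>F\<^esub>}
                    \<and> (\<forall>w. f w \<noteq> \<zero>\<^bsub>F\<^esub> \<longrightarrow> set w \<subseteq> {1..n})},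
     monoid.mult = (\<lambda>f g w. \<Oplus>\<^bsub>F\<^esub>k\<in>{..length w}. f (take k w) \<otimes>\<^bsub>F\<^esub> g (drop k w)),
     monoid.one = (\<lambda>w. if w = [] then \<one>\<^bsub>F\<^esub> else \<zero>\<^bsub>F\<^esub>),
     ring.zero = (\<lambda>w. \<zero>\<^bsub>F\<^esub>),
     ring.add = (\<lambda>f g w. f w \<oplus>\<^bsub>F\<^esub> g w),
     module.smult = (\<lambda>a f w. a \<otimes>\<^bsub>F\<^esub> f w)\<rparr>"

definition free_var :: "('a, 'b) ring_scheme \<Rightarrow> nat \<Rightarrow> nat list \<Rightarrow> 'a"
  where "free_var F i = (\<lambda>w. if w = [i] then \<one>\<^bsub>F\<^esub> else \<zero>\<^bsub>F\<^esub>)"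

definition quantum_ideal ::
    "('a, 'b) ring_scheme \<Rightarrow> nat \<Rightarrow> (nat \<Rightarrow> nat \<Rightarrow> 'a) \<Rightarrow> (nat list \<Rightarrow> 'a) set"
  where "quantum_ideal F n q = (let A = free_algebra F n; X = free_var F in
    Idl\<^bsub>A\<^esub> {X i \<otimes>\<^bsub>A\<^esub> X j \<ominus>\<^bsub>A\<^esub> q i j \<odot>\<^bsub>A\<^esub> (X j \<otimes>\<^bsub>A\<^esub> X i) | i j. 1 \<le> i \<and> i < j \<and> j \<le> n})"

text \<open>
  \<^const>\<open>FactRing\<close> forgets the scalar multiplication, which is put back here on cosets.
\<close>

definition quantum_affine ::
    "('a, 'b) ring_scheme \<Rightarrow> nat \<Rightarrow> (nat \<Rightarrow> nat \<Rightarrow> 'a) \<Rightarrow> ('a, (nat list \<Rightarrow> 'a) set) module"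
  where "quantum_affine F n q = (let A = free_algebra F n; I = quantum_ideal F n q in
    ring.extend (A Quot I) (module.fields (\<lambda>a C. \<Union>x\<in>C. I +>\<^bsub>A\<^esub> (a \<odot>\<^bsub>A\<^esub> x))))"

definition quantum_var ::
    "('a, 'b) ring_scheme \<Rightarrow> nat \<Rightarrow> (nat \<Rightarrow> nat \<Rightarrow> 'a) \<Rightarrow> nat \<Rightarrow> (nat list \<Rightarrow> 'a) set"
  where "quantum_var F n q i = quantum_ideal F n q +>\<^bsub>free_algebra F n\<^esub> free_var F i"

section \<open>Automorphisms\<close>

definition algebra_auto ::
    "('a, 'b) ring_scheme \<Rightarrow> ('a, 'c, 'd) module_scheme \<Rightarrow> ('c \<Rightarrow> 'c) set"
  where "algebra_auto F A = {h \<in> Ring.ring_hom A A \<inter> Bij (carrier A).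
    \<forall>a\<in>carrier F. \<forall>x\<in>carrier A. h (a \<odot>\<^bsub>A\<^esub> x) = a \<odot>\<^bsub>A\<^esub> h x}"

definition AlgAutGroup ::
    "('a, 'b) ring_scheme \<Rightarrow> ('a, 'c, 'd) module_scheme \<Rightarrow> ('c \<Rightarrow> 'c) monoid"
  where "AlgAutGroup F A = BijGroup (carrier A) \<lparr>carrier := algebra_auto F A\<rparr>"

abbreviation quantum_Aut ::
    "('a, 'b) ring_scheme \<Rightarrow> nat \<Rightarrow> (nat \<Rightarrow> nat \<Rightarrow> 'a)
      \<Rightarrow> ((nat list \<Rightarrow> 'a) set \<Rightarrow> (nat list \<Rightarrow> 'a) set) monoid"
  where "quantum_Aut F n q \<equiv> AlgAutGroup F (quantum_affine F n q)"

definition torus :: "('a, 'b) ring_scheme \<Rightarrow> nat \<Rightarrow> (nat \<Rightarrow> 'a) monoid"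
  where "torus F n = product_group {1..n} (\<lambda>_. units_of F)"

text \<open>
  The copy of \<^const>\<open>torus\<close> inside the automorphism group. An automorphism is determined by its
  values on the variables, so \<open>h\<close> and \<open>t\<close> determine each other.
\<close>

definition scalar_automorphisms ::
    "('a, 'b) ring_scheme \<Rightarrow> nat \<Rightarrow> (nat \<Rightarrow> nat \<Rightarrow> 'a)
      \<Rightarrow> ((nat list \<Rightarrow> 'a) set \<Rightarrow> (nat list \<Rightarrow> 'a) set) set"
  where "scalar_automorphisms F n q = {h \<in> carrier (quantum_Aut F n q).
    \<exists>t\<in>carrier (torus F n). \<forall>i\<in>{1..n}.
      h (quantum_var F n q i) = t i \<odot>\<^bsub>quantum_affine F n q\<^esub> quantum_var F n q i}"

definition semidirect_product ::
    "('a, 'b) monoid_scheme \<Rightarrow> ('c, 'd) monoid_scheme \<Rightarrow> ('c \<Rightarrow> 'a \<Rightarrow> 'a) \<Rightarrow> ('a \<times> 'c) monoid"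
  where "semidirect_product N H \<phi> =
    \<lparr>carrier = carrier N \<times> carrier H,
     monoid.mult = (\<lambda>(a, g) (b, h). (a \<otimes>\<^bsub>N\<^esub> \<phi> g b, g \<otimes>\<^bsub>H\<^esub> h)),
     monoid.one = (\<one>\<^bsub>N\<^esub>, \<one>\<^bsub>H\<^esub>)\<rparr>"

section \<open>The \<open>\<lambda>\<close>-group and its rank\<close>

definition lambda_group ::
    "('a, 'b) ring_scheme \<Rightarrow> nat \<Rightarrow> (nat \<Rightarrow> nat \<Rightarrow> 'a) \<Rightarrow> 'a monoid"
  where "lambda_group F n q =
    subgroup_generated (units_of F) {q i j | i j. i \<in> {1..n} \<and> j \<in> {1..n}}"

definition torsion_free :: "('a, 'b) monoid_scheme \<Rightarrow> bool"
  where "torsion_free G \<longleftrightarrow>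
    (\<forall>x\<in>carrier G. \<forall>m::nat. 0 < m \<and> x [^]\<^bsub>G\<^esub> m = \<one>\<^bsub>G\<^esub> \<longrightarrow> x = \<one>\<^bsub>G\<^esub>)"

text \<open>
  The rational vector space \<open>G \<otimes> \<rat>\<close> (tensor product over the integers) of an abelian group \<open>G\<close>,
  written multiplicatively: the free abelian group on the pairs \<open>(x, s)\<close> modulo the
  biadditivity relations, with \<open>r (x \<otimes> s) = x \<otimes> (r s)\<close>. The fields \<^const>\<open>monoid.mult\<close> and
  \<^const>\<open>one\<close> of a module record play no role for modules.
\<close>

definition tensor_relations :: "('a, 'b) monoid_scheme \<Rightarrow> ('a \<times> rat \<Rightarrow>\<^sub>0 int) set"
  where "tensor_relations G =
    {frag_of (x \<otimes>\<^bsub>G\<^esub> y, s) - (frag_of (x, s) + frag_of (y, s)) | x y s.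
       x \<in> carrier G \<and> y \<in> carrier G} \<union>
    {frag_of (x, s + t) - (frag_of (x, s) + frag_of (x, t)) | x s t. x \<in> carrier G}"

definition rational_tensor ::
    "('a, 'b) monoid_scheme \<Rightarrow> (rat, ('a \<times> rat \<Rightarrow>\<^sub>0 int) set) module"
  where "rational_tensor G =
    (let A = free_Abelian_group (carrier G \<times> UNIV); N = generate A (tensor_relations G) in
    \<lparr>carrier = carrier (A Mod N),
     monoid.mult = (\<lambda>C D. \<one>\<^bsub>A Mod N\<^esub>),
     monoid.one = \<one>\<^bsub>A Mod N\<^esub>,
     ring.zero = \<one>\<^bsub>A Mod N\<^esub>,
     ring.add = (\<lambda>C D. C \<otimes>\<^bsub>A Mod N\<^esub> D),
     module.smult = (\<lambda>r C. \<Union>c\<in>C. N #>\<^bsub>A\<^esub> frag_extend (\<lambda>(x, s). frag_of (x, r * s)) c)\<rparr>)"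

text \<open>
  \<^const>\<open>vectorspace.dim\<close> is a natural number and only meaningful in finite dimension. This suffices
  for \<^const>\<open>lambda_group\<close>, which is finitely generated.
\<close>

definition torsion_free_rank :: "('a, 'b) monoid_scheme \<Rightarrow> nat"
  where "torsion_free_rank G = vectorspace.dim (class_ring :: rat ring) (rational_tensor G)"

end

theory Submission
  imports Defs "HOL-Library.Multiset_Order" "HOL-Computational_Algebra.Primes"
begin

text \<open>
  Write \<open>X\<^sub>i X\<^sub>j = q\<^sub>i\<^sub>j X\<^sub>j X\<^sub>i\<close> and let \<open>\<Lambda>\<close> be the group generated by the entries. If there
  is an index \<open>k\<close> such that every \<open>q\<^sub>k\<^sub>j\<close> has a positive power in the group generated by the entries that
  avoid \<open>k\<close>, then \<open>\<Lambda>\<close> has, up to torsion, only the \<open>(n - 1) choose 2\<close> generators \<open>q\<^sub>i\<^sub>j\<close> with \<open>i < j\<close> and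
  \<open>i, j \<noteq> k\<close>, so its rank is too small (\<open>lambda_rank_dependent\<close>). Call the matrix dependent at \<open>k\<close> in
  that case. Under the rank hypothesis no such \<open>k\<close> exists, and this is used twice.

  First, sorting words shows that the ordered monomials form a basis of the quantum affine space, and that
  its product is that of a polynomial ring twisted by a nowhere vanishing cocycle
  (\<open>coeff_mult\<close>, \<open>coeff_inject\<close>). Let \<open>u \<noteq> 0\<close> be such that for every \<open>j\<close> there is \<open>f\<close> with
  \<open>u X\<^sub>j = f u\<close>. Comparing largest and smallest monomials, \<open>f\<close> must be a scalar multiple of
  \<open>X\<^sub>j\<close> (\<open>normal_twist_monomial\<close>), so that all monomials of \<open>u\<close> commute with \<open>X\<^sub>j\<close> up to the same
  scalar. Two different monomials in \<open>u\<close> would therefore give, for an index \<open>k\<close> at which their exponents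
  differ, the dependence that was excluded: \<open>u\<close> is a scalar multiple of a monomial
  (\<open>normal_support_single\<close>). The image of a variable under an automorphism is of this kind, and so is
  its image under the inverse automorphism; hence an automorphism permutes the variables up to scalars.

  Secondly, a permutation \<open>\<tau>\<close> of the variables that extends to an automorphism satisfies
  \<open>q\<^bsub>\<tau> i, \<tau> j\<^esub> = q\<^sub>i\<^sub>j\<close>, and if \<open>\<tau> k \<noteq> k\<close> then each \<open>q\<^sub>k\<^sub>j\<close> either agrees up to inversion with an entry
  that avoids \<open>k\<close> or squares to \<open>1\<close>; again the matrix is dependent at \<open>k\<close>
  (\<open>dependent_at_permutation\<close>). So \<open>\<tau>\<close> is the identity and the automorphism is scalar.

  For sharpness work over the complex numbers and take \<open>X\<^sub>1\<close> central. Of the remaining \<open>(n - 1) choose 2\<close>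
  entries above the diagonal let \<open>r\<close> be different primes and all others \<open>1\<close>. Unique factorisation
  makes \<open>\<Lambda>\<close> free of rank \<open>r\<close>, and the substitutions \<open>X\<^sub>1 \<mapsto> t\<^sub>1\<inverse> (X\<^sub>1 + b)\<close>, \<open>X\<^sub>i \<mapsto> t\<^sub>i\<inverse> X\<^sub>i\<close> form the required semidirect product
  (\<open>affine_subgroup\<close>).
\<close>

section \<open>Unital associative algebras and their automorphism groups\<close>

text \<open>
  The locale \<^locale>\<open>algebra\<close> asks for a commutative multiplication, so noncommutative algebras need
  a locale of their own.
\<close>

locale unital_algebra = Module.module R B + ring B for R (structure) and B (structure) +
  assumes smult_mult_left: "\<lbrakk>a \<in> carrier R; x \<in> carrier B; y \<in> carrier B\<rbrakk>
      \<Longrightarrow> (a \<odot>\<^bsub>B\<^esub> x) \<otimes>\<^bsub>B\<^esub> y = a \<odot>\<^bsub>B\<^esub> (x \<otimes>\<^bsub>B\<^esub> y)"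
    and smult_mult_right: "\<lbrakk>a \<in> carrier R; x \<in> carrier B; y \<in> carrier B\<rbrakk>
      \<Longrightarrow> x \<otimes>\<^bsub>B\<^esub> (a \<odot>\<^bsub>B\<^esub> y) = a \<odot>\<^bsub>B\<^esub> (x \<otimes>\<^bsub>B\<^esub> y)"

definition algebra_hom ::
    "('a, 'b) ring_scheme \<Rightarrow> ('a, 'c, 'd) module_scheme \<Rightarrow> ('a, 'e, 'f) module_scheme \<Rightarrow> ('c \<Rightarrow> 'e) set"
  where "algebra_hom R A B = {h \<in> Ring.ring_hom A B.
    \<forall>a\<in>carrier R. \<forall>x\<in>carrier A. h (a \<odot>\<^bsub>A\<^esub> x) = a \<odot>\<^bsub>B\<^esub> h x}"

lemma algebra_homD:
  assumes "h \<in> algebra_hom R A B"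
  shows "x \<in> carrier A \<Longrightarrow> h x \<in> carrier B"
    and "\<lbrakk>x \<in> carrier A; y \<in> carrier A\<rbrakk> \<Longrightarrow> h (x \<oplus>\<^bsub>A\<^esub> y) = h x \<oplus>\<^bsub>B\<^esub> h y"
    and "\<lbrakk>x \<in> carrier A; y \<in> carrier A\<rbrakk> \<Longrightarrow> h (x \<otimes>\<^bsub>A\<^esub> y) = h x \<otimes>\<^bsub>B\<^esub> h y"
    and "h \<one>\<^bsub>A\<^esub> = \<one>\<^bsub>B\<^esub>"
    and "\<lbrakk>a \<in> carrier R; x \<in> carrier A\<rbrakk> \<Longrightarrow> h (a \<odot>\<^bsub>A\<^esub> x) = a \<odot>\<^bsub>B\<^esub> h x"
  using assms by (auto simp: algebra_hom_def Ring.ring_hom_def)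

lemma algebra_homI:
  assumes "\<And>x. x \<in> carrier A \<Longrightarrow> h x \<in> carrier B"
    and "\<And>x y. \<lbrakk>x \<in> carrier A; y \<in> carrier A\<rbrakk> \<Longrightarrow> h (x \<oplus>\<^bsub>A\<^esub> y) = h x \<oplus>\<^bsub>B\<^esub> h y"
    and "\<And>x y. \<lbrakk>x \<in> carrier A; y \<in> carrier A\<rbrakk> \<Longrightarrow> h (x \<otimes>\<^bsub>A\<^esub> y) = h x \<otimes>\<^bsub>B\<^esub> h y"
    and "h \<one>\<^bsub>A\<^esub> = \<one>\<^bsub>B\<^esub>"
    and "\<And>a x. \<lbrakk>a \<in> carrier R; x \<in> carrier A\<rbrakk> \<Longrightarrow> h (a \<odot>\<^bsub>A\<^esub> x) = a \<odot>\<^bsub>B\<^esub> h x"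
  shows "h \<in> algebra_hom R A B"
  using assms by (auto simp: algebra_hom_def Ring.ring_hom_def)

lemma algebra_auto_eq: "algebra_auto R B = algebra_hom R B B \<inter> Bij (carrier B)"
  by (auto simp: algebra_auto_def algebra_hom_def)

context unital_algebra
begin

lemma compose_algebra_hom:
  assumes "g \<in> algebra_hom R B B" "h \<in> algebra_hom R B B"
  shows "compose (carrier B) g h \<in> algebra_hom R B B"
  by (rule algebra_homI) (auto simp: compose_eq algebra_homD[OF assms(1)] algebra_homD[OF assms(2)])

lemma restrict_algebra_hom:
  assumes "h \<in> algebra_hom R B B"
  shows "restrict h (carrier B) \<in> algebra_hom R B B"
  by (rule algebra_homI) (auto simp: algebra_homD[OF assms])

lemma algebra_hom_zero:
  assumes "h \<in> algebra_hom R B C" "abelian_group C"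
  shows "h \<zero>\<^bsub>B\<^esub> = \<zero>\<^bsub>C\<^esub>"
proof -
  interpret C: abelian_group C by fact
  have "h \<zero>\<^bsub>B\<^esub> \<oplus>\<^bsub>C\<^esub> h \<zero>\<^bsub>B\<^esub> = h \<zero>\<^bsub>B\<^esub> \<oplus>\<^bsub>C\<^esub> \<zero>\<^bsub>C\<^esub>"
    using algebra_homD(2)[OF assms(1), of "\<zero>\<^bsub>B\<^esub>" "\<zero>\<^bsub>B\<^esub>"] algebra_homD(1)[OF assms(1), of "\<zero>\<^bsub>B\<^esub>"]
    by simp
  then show ?thesis
    using C.add.l_cancel_one[of "h \<zero>\<^bsub>B\<^esub>" "h \<zero>\<^bsub>B\<^esub>"] algebra_homD(1)[OF assms(1), of "\<zero>\<^bsub>B\<^esub>"] by simp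
qed

lemma inverse_algebra_auto:
  assumes "h \<in> algebra_auto R B"
  shows "restrict (inv_into (carrier B) h) (carrier B) \<in> algebra_auto R B"
proof -
  let ?g = "restrict (inv_into (carrier B) h) (carrier B)"
  have h: "h \<in> algebra_hom R B B" and bij: "h \<in> Bij (carrier B)"
    using assms by (auto simp: algebra_auto_eq)
  have bb: "bij_betw h (carrier B) (carrier B)" using bij by (simp add: Bij_def)
  have c: "inv_into (carrier B) h x \<in> carrier B" if "x \<in> carrier B" for x
    using bij that by (rule Bij_inv_into_mem)
  have hi: "h (inv_into (carrier B) h x) = x" if "x \<in> carrier B" for x
    using bb that by (rule bij_betw_inv_into_right)
  have eq: "inv_into (carrier B) h x = y" if "y \<in> carrier B" "h y = x" for x y
    using bb that bij_betw_inv_into_left by fastforce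
  have "?g \<in> algebra_hom R B B"
    by (rule algebra_homI) (auto simp: c hi algebra_homD[OF h] intro!: eq)
  then show ?thesis
    using restrict_inv_into_Bij[OF bij] by (simp add: algebra_auto_eq)
qed

lemma AlgAutGroup_simps [simp]:
  "carrier (AlgAutGroup R B) = algebra_auto R B"
  "\<one>\<^bsub>AlgAutGroup R B\<^esub> = (\<lambda>x\<in>carrier B. x)"
  "\<lbrakk>g \<in> algebra_auto R B; h \<in> algebra_auto R B\<rbrakk> \<Longrightarrow>
    g \<otimes>\<^bsub>AlgAutGroup R B\<^esub> h = compose (carrier B) g h"
  by (auto simp: AlgAutGroup_def BijGroup_def algebra_auto_eq)

lemma group_AlgAutGroup: "group (AlgAutGroup R B)"
proof (rule groupI, goal_cases)
  case (1 x y)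
  then show ?case
    by (auto simp: algebra_auto_eq compose_algebra_hom compose_Bij)
next
  case 2
  have "(\<lambda>x\<in>carrier B. x) \<in> algebra_hom R B B"
    by (rule algebra_homI) auto
  then show ?case by (simp add: algebra_auto_eq id_Bij)
next
  case (3 x y z)
  have cc: "compose (carrier B) u v \<in> algebra_auto R B"
    if "u \<in> algebra_auto R B" "v \<in> algebra_auto R B" for u v
    using that by (auto simp: algebra_auto_eq compose_algebra_hom compose_Bij)
  have "z \<in> carrier B \<rightarrow> carrier B"
    using 3 by (auto simp: algebra_auto_eq Bij_imp_funcset)
  with 3 show ?case
    by (simp add: cc) (rule compose_assoc[symmetric])
next
  case (4 x)
  have "(\<lambda>x\<in>carrier B. x) \<in> algebra_hom R B B"
    by (rule algebra_homI) auto
  with 4 show ?case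
    by (auto simp: algebra_auto_eq id_Bij Bij_imp_funcset Bij_imp_extensional)
next
  case (5 x)
  then have "x \<in> Bij (carrier B)" by (simp add: algebra_auto_eq)
  with 5 show ?case
    by (intro bexI[of _ "restrict (inv_into (carrier B) x) (carrier B)"])
       (auto simp: inverse_algebra_auto Bij_compose_restrict_eq)
qed

end

section \<open>The free algebra\<close>

definition word_monomial :: "('a, 'b) ring_scheme \<Rightarrow> 'a \<Rightarrow> nat list \<Rightarrow> nat list \<Rightarrow> 'a"
  where "word_monomial R a w = (\<lambda>v. if v = w then a else \<zero>\<^bsub>R\<^esub>)"

context cring
begin

abbreviation FA :: "nat \<Rightarrow> ('a, nat list \<Rightarrow> 'a) module"
  where "FA n \<equiv> free_algebra R n"

lemma free_algebra_simps [simp]: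
  "f \<otimes>\<^bsub>FA n\<^esub> g = (\<lambda>w. \<Oplus>k\<in>{..length w}. f (take k w) \<otimes> g (drop k w))"
  "\<one>\<^bsub>FA n\<^esub> = word_monomial R \<one> []"
  "\<zero>\<^bsub>FA n\<^esub> = (\<lambda>w. \<zero>)"
  "f \<oplus>\<^bsub>FA n\<^esub> g = (\<lambda>w. f w \<oplus> g w)"
  "a \<odot>\<^bsub>FA n\<^esub> f = (\<lambda>w. a \<otimes> f w)"
  by (simp_all add: free_algebra_def word_monomial_def)

lemma free_algebra_carrier:
  "f \<in> carrier (FA n) \<longleftrightarrow> (\<forall>w. f w \<in> carrier R) \<and> finite {w. f w \<noteq> \<zero>}
     \<and> (\<forall>w. f w \<noteq> \<zero> \<longrightarrow> set w \<subseteq> {1..n})"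
  by (simp add: free_algebra_def)

lemma free_algebra_coeff_closed [simp, intro]: "f \<in> carrier (FA n) \<Longrightarrow> f w \<in> carrier R"
  by (simp add: free_algebra_carrier)

lemma word_monomial_closed [simp, intro]:
  "\<lbrakk>a \<in> carrier R; set w \<subseteq> {1..n}\<rbrakk> \<Longrightarrow> word_monomial R a w \<in> carrier (FA n)"
  unfolding free_algebra_carrier
  by (auto simp: word_monomial_def intro: finite_subset[of _ "{w}"])

lemma free_algebra_add_closed:
  assumes "f \<in> carrier (FA n)" "g \<in> carrier (FA n)"
  shows "(\<lambda>w. f w \<oplus> g w) \<in> carrier (FA n)"
proof -
  have sub: "{w. f w \<oplus> g w \<noteq> \<zero>} \<subseteq> {w. f w \<noteq> \<zero>} \<union> {w. g w \<noteq> \<zero>}" by auto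
  then have "finite {w. f w \<oplus> g w \<noteq> \<zero>}"
    by (rule finite_subset) (use assms in \<open>simp add: free_algebra_carrier\<close>)
  moreover have "set w \<subseteq> {1..n}" if "f w \<oplus> g w \<noteq> \<zero>" for w
    using sub that assms unfolding free_algebra_carrier by blast
  ultimately show ?thesis using assms unfolding free_algebra_carrier by auto
qed

lemma free_algebra_smult_closed:
  assumes "a \<in> carrier R" "f \<in> carrier (FA n)"
  shows "(\<lambda>w. a \<otimes> f w) \<in> carrier (FA n)"
proof -
  have sub: "{w. a \<otimes> f w \<noteq> \<zero>} \<subseteq> {w. f w \<noteq> \<zero>}" using assms by auto
  then have "finite {w. a \<otimes> f w \<noteq> \<zero>}"
    by (rule finite_subset) (use assms in \<open>simp add: free_algebra_carrier\<close>)
  with assms sub show ?thesis unfolding free_algebra_carrier by auto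
qed

lemma free_algebra_mult_closed:
  assumes f: "f \<in> carrier (FA n)" and g: "g \<in> carrier (FA n)"
  shows "f \<otimes>\<^bsub>FA n\<^esub> g \<in> carrier (FA n)"
proof -
  have sub: "\<exists>u v. w = u @ v \<and> f u \<noteq> \<zero> \<and> g v \<noteq> \<zero>" if "(f \<otimes>\<^bsub>FA n\<^esub> g) w \<noteq> \<zero>" for w
  proof (rule ccontr)
    assume *: "\<not> ?thesis"
    have "f (take k w) \<otimes> g (drop k w) = \<zero>" for k
    proof -
      have "f (take k w) = \<zero> \<or> g (drop k w) = \<zero>"
        using * append_take_drop_id[of k w] by metis
      then show ?thesis using f g by auto
    qed
    then have "(f \<otimes>\<^bsub>FA n\<^esub> g) w = \<zero>" by simp
    with that show False by simp
  qed
  then have "{w. (f \<otimes>\<^bsub>FA n\<^esub> g) w \<noteq> \<zero>} \<subseteq>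
      (\<lambda>(u, v). u @ v) ` ({w. f w \<noteq> \<zero>} \<times> {w. g w \<noteq> \<zero>})"
    by fastforce
  then have fin: "finite {w. (f \<otimes>\<^bsub>FA n\<^esub> g) w \<noteq> \<zero>}"
    by (rule finite_subset) (use f g in \<open>simp add: free_algebra_carrier\<close>)
  have "set w \<subseteq> {1..n}" if "(f \<otimes>\<^bsub>FA n\<^esub> g) w \<noteq> \<zero>" for w
    using sub[OF that] f g unfolding free_algebra_carrier by fastforce
  moreover have "(f \<otimes>\<^bsub>FA n\<^esub> g) w \<in> carrier R" for w
    using f g by (auto intro!: finsum_closed)
  ultimately show ?thesis
    using fin unfolding free_algebra_carrier by blast
qed

text \<open>
  Every element is a finite sum of scalar multiples of words. With this principle a bilinear identity
  has to be checked for words only, where the product is concatenation; associativity, the evaluation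
  homomorphisms and the multiplicativity of normal forms are all proved in this way.
\<close>

lemma free_algebra_induct [consumes 1, case_names zero add monomial]:
  assumes "f \<in> carrier (FA n)"
    and zero: "P \<zero>\<^bsub>FA n\<^esub>"
    and add: "\<And>f g. \<lbrakk>f \<in> carrier (FA n); g \<in> carrier (FA n); P f; P g\<rbrakk> \<Longrightarrow> P (f \<oplus>\<^bsub>FA n\<^esub> g)"
    and monomial: "\<And>a w. \<lbrakk>a \<in> carrier R; set w \<subseteq> {1..n}\<rbrakk> \<Longrightarrow> P (word_monomial R a w)"
  shows "P f"
proof -
  have "P f" if "finite S" "f \<in> carrier (FA n)" "{w. f w \<noteq> \<zero>} \<subseteq> S" for S f
    using that
  proof (induction S arbitrary: f rule: finite_induct)
    case empty
    then have "f = \<zero>\<^bsub>FA n\<^esub>" by auto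
    with zero show ?case by (simp only:)
  next
    case (insert v S)
    let ?g = "\<lambda>w. if w = v then \<zero> else f w"
    show ?case
    proof (cases "f v = \<zero>")
      case True
      then show ?thesis using insert by (intro insert.IH) auto
    next
      case False
      have fv: "f v \<in> carrier R" "set v \<subseteq> {1..n}"
        using insert.prems False by (auto simp: free_algebra_carrier)
      have g: "?g \<in> carrier (FA n)"
        using insert.prems(1) unfolding free_algebra_carrier
        by (auto elim: finite_subset[rotated])
      have "P ?g" by (rule insert.IH) (use insert g in auto)
      moreover have "P (word_monomial R (f v) v)" using fv by (rule monomial)
      ultimately have "P (word_monomial R (f v) v \<oplus>\<^bsub>FA n\<^esub> ?g)"
        using g fv by (intro add) auto
      moreover have "word_monomial R (f v) v \<oplus>\<^bsub>FA n\<^esub> ?g = f"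
        using insert.prems(1) by (auto simp: word_monomial_def free_algebra_carrier fun_eq_iff)
      ultimately show ?thesis by (simp only:)
    qed
  qed
  from this[of "{w. f w \<noteq> \<zero>}" f] assms(1) show ?thesis by (simp add: free_algebra_carrier)
qed

text \<open>
  Of all ways to cut a word into two, only the cut at position \<open>length u\<close> can contribute.
\<close>

lemma word_monomial_mult:
  assumes "a \<in> carrier R" "b \<in> carrier R"
  shows "word_monomial R a u \<otimes>\<^bsub>FA n\<^esub> word_monomial R b v = word_monomial R (a \<otimes> b) (u @ v)"
proof (rule ext)
  fix w
  have *: "word_monomial R a u (take k w) \<otimes> word_monomial R b v (drop k w)
      = (if length u = k then (if w = u @ v then a \<otimes> b else \<zero>) else \<zero>)" if "k \<le> length w" for k
    using that assms append_take_drop_id[of k w]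
    by (auto simp: word_monomial_def)
  show "(word_monomial R a u \<otimes>\<^bsub>FA n\<^esub> word_monomial R b v) w = word_monomial R (a \<otimes> b) (u @ v) w"
  proof (cases "length u \<le> length w")
    case True
    have "(\<Oplus>k\<in>{..length w}. word_monomial R a u (take k w) \<otimes> word_monomial R b v (drop k w))
      = (\<Oplus>k\<in>{..length w}. if length u = k then (if w = u @ v then a \<otimes> b else \<zero>) else \<zero>)"
      using assms by (intro finsum_cong') (auto simp: *)
    also have "\<dots> = (if w = u @ v then a \<otimes> b else \<zero>)"
      using assms True by (intro finsum_singleton) auto
    finally show ?thesis by (simp add: word_monomial_def)
  next
    case False
    have "(\<Oplus>k\<in>{..length w}. word_monomial R a u (take k w) \<otimes> word_monomial R b v (drop k w))
      = (\<Oplus>k\<in>{..length w}. \<zero>)"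
      using assms False by (intro finsum_cong') (auto simp: *)
    then show ?thesis using False by (auto simp: word_monomial_def)
  qed
qed

lemma free_algebra_l_distr:
  assumes "f \<in> carrier (FA n)" "g \<in> carrier (FA n)" "h \<in> carrier (FA n)"
  shows "(f \<oplus>\<^bsub>FA n\<^esub> g) \<otimes>\<^bsub>FA n\<^esub> h = f \<otimes>\<^bsub>FA n\<^esub> h \<oplus>\<^bsub>FA n\<^esub> g \<otimes>\<^bsub>FA n\<^esub> h"
proof (rule ext)
  fix w
  have "(\<Oplus>k\<in>{..length w}. (f (take k w) \<oplus> g (take k w)) \<otimes> h (drop k w))
    = (\<Oplus>k\<in>{..length w}. f (take k w) \<otimes> h (drop k w) \<oplus> g (take k w) \<otimes> h (drop k w))"
    by (rule finsum_cong') (use assms in \<open>auto simp: l_distr\<close>)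
  also have "\<dots> = (\<Oplus>k\<in>{..length w}. f (take k w) \<otimes> h (drop k w)) \<oplus> (\<Oplus>k\<in>{..length w}. g (take k w) \<otimes> h (drop k w))"
    by (rule finsum_addf) (use assms in auto)
  finally show "((f \<oplus>\<^bsub>FA n\<^esub> g) \<otimes>\<^bsub>FA n\<^esub> h) w = (f \<otimes>\<^bsub>FA n\<^esub> h \<oplus>\<^bsub>FA n\<^esub> g \<otimes>\<^bsub>FA n\<^esub> h) w"
    by simp
qed

lemma free_algebra_r_distr:
  assumes "f \<in> carrier (FA n)" "g \<in> carrier (FA n)" "h \<in> carrier (FA n)"
  shows "h \<otimes>\<^bsub>FA n\<^esub> (f \<oplus>\<^bsub>FA n\<^esub> g) = h \<otimes>\<^bsub>FA n\<^esub> f \<oplus>\<^bsub>FA n\<^esub> h \<otimes>\<^bsub>FA n\<^esub> g"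
proof (rule ext)
  fix w
  have "(\<Oplus>k\<in>{..length w}. h (take k w) \<otimes> (f (drop k w) \<oplus> g (drop k w)))
    = (\<Oplus>k\<in>{..length w}. h (take k w) \<otimes> f (drop k w) \<oplus> h (take k w) \<otimes> g (drop k w))"
    by (rule finsum_cong') (use assms in \<open>auto simp: r_distr\<close>)
  also have "\<dots> = (\<Oplus>k\<in>{..length w}. h (take k w) \<otimes> f (drop k w)) \<oplus> (\<Oplus>k\<in>{..length w}. h (take k w) \<otimes> g (drop k w))"
    by (rule finsum_addf) (use assms in auto)
  finally show "(h \<otimes>\<^bsub>FA n\<^esub> (f \<oplus>\<^bsub>FA n\<^esub> g)) w = (h \<otimes>\<^bsub>FA n\<^esub> f \<oplus>\<^bsub>FA n\<^esub> h \<otimes>\<^bsub>FA n\<^esub> g) w"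
    by simp
qed

lemma abelian_group_free_algebra: "abelian_group (FA n)"
proof (rule abelian_groupI, goal_cases)
  case (6 x)
  then have "(\<lambda>w. (\<ominus> \<one>) \<otimes> x w) \<in> carrier (FA n)"
    by (intro free_algebra_smult_closed) auto
  with 6 show ?case
    by (intro bexI[of _ "\<lambda>w. (\<ominus> \<one>) \<otimes> x w"]) (auto simp: l_minus l_neg free_algebra_coeff_closed[OF 6])
next
  case 2
  show ?case by (simp add: free_algebra_carrier)
qed (auto simp: free_algebra_add_closed a_assoc free_algebra_coeff_closed intro: a_comm)

lemma free_algebra_zero_mult:
  assumes "f \<in> carrier (FA n)"
  shows "\<zero>\<^bsub>FA n\<^esub> \<otimes>\<^bsub>FA n\<^esub> f = \<zero>\<^bsub>FA n\<^esub>" "f \<otimes>\<^bsub>FA n\<^esub> \<zero>\<^bsub>FA n\<^esub> = \<zero>\<^bsub>FA n\<^esub>"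
proof -
  have [simp]: "f w \<in> carrier R" for w using assms by auto
  show "\<zero>\<^bsub>FA n\<^esub> \<otimes>\<^bsub>FA n\<^esub> f = \<zero>\<^bsub>FA n\<^esub>" "f \<otimes>\<^bsub>FA n\<^esub> \<zero>\<^bsub>FA n\<^esub> = \<zero>\<^bsub>FA n\<^esub>" by auto
qed

lemma free_algebra_assoc:
  assumes f: "f \<in> carrier (FA n)" and g: "g \<in> carrier (FA n)" and h: "h \<in> carrier (FA n)"
  shows "(f \<otimes>\<^bsub>FA n\<^esub> g) \<otimes>\<^bsub>FA n\<^esub> h = f \<otimes>\<^bsub>FA n\<^esub> (g \<otimes>\<^bsub>FA n\<^esub> h)"
proof -
  note [simp del] = free_algebra_simps(1,3,4)
  note [simp] = free_algebra_zero_mult free_algebra_l_distr free_algebra_r_distr free_algebra_mult_closed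
    word_monomial_mult m_assoc
  have a: "x \<oplus>\<^bsub>FA n\<^esub> y \<in> carrier (FA n)" if "x \<in> carrier (FA n)" "y \<in> carrier (FA n)" for x y
    using free_algebra_add_closed[OF that] by (simp add: free_algebra_simps)
  note [simp] = a
  show ?thesis using f
  proof (induction f rule: free_algebra_induct)
    case zero then show ?case using g h by simp
  next
    case (add f f') then show ?case using g h by simp
  next
    case f: (monomial a u)
    show ?case using g
    proof (induction g rule: free_algebra_induct)
      case zero then show ?case using f h by simp
    next
      case (add f f') then show ?case using f h by simp
    next
      case g: (monomial b v)
      show ?case using h
        by (induction h rule: free_algebra_induct) (use f g in simp_all)
    qed
  qed
qed

lemma ring_free_algebra: "ring (FA n)"
proof (rule ringI)
  show "abelian_group (FA n)" by (rule abelian_group_free_algebra)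
  have one: "word_monomial R \<one> [] \<in> carrier (FA n)" by auto
  show "Group.monoid (FA n)"
  proof (rule monoidI)
    fix f assume f: "f \<in> carrier (FA n)"
    show "\<one>\<^bsub>FA n\<^esub> \<otimes>\<^bsub>FA n\<^esub> f = f"
    proof (rule ext)
      fix w
      have "(\<Oplus>k\<in>{..length w}. word_monomial R \<one> [] (take k w) \<otimes> f (drop k w))
        = (\<Oplus>k\<in>{..length w}. if 0 = k then f (drop k w) else \<zero>)"
        by (rule finsum_cong') (use f in \<open>auto simp: word_monomial_def\<close>)
      also have "\<dots> = f (drop 0 w)" by (rule finsum_singleton) (use f in auto)
      finally show "(\<one>\<^bsub>FA n\<^esub> \<otimes>\<^bsub>FA n\<^esub> f) w = f w" by simp
    qed
    show "f \<otimes>\<^bsub>FA n\<^esub> \<one>\<^bsub>FA n\<^esub> = f"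
    proof (rule ext)
      fix w
      have "(\<Oplus>k\<in>{..length w}. f (take k w) \<otimes> word_monomial R \<one> [] (drop k w))
        = (\<Oplus>k\<in>{..length w}. if length w = k then f (take k w) else \<zero>)"
        by (rule finsum_cong') (use f in \<open>auto simp: word_monomial_def\<close>)
      also have "\<dots> = f (take (length w) w)" by (rule finsum_singleton) (use f in auto)
      finally show "(f \<otimes>\<^bsub>FA n\<^esub> \<one>\<^bsub>FA n\<^esub>) w = f w" by simp
    qed
  qed (use free_algebra_mult_closed free_algebra_assoc one in \<open>simp_all add: free_algebra_simps(2)\<close>)
qed (use free_algebra_l_distr free_algebra_r_distr in blast)+

lemma unital_algebra_free_algebra: "unital_algebra R (FA n)"
proof (intro unital_algebra.intro unital_algebra_axioms.intro ring_free_algebra)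
  show "Module.module R (FA n)"
    by (rule moduleI)
      (auto simp: abelian_group_free_algebra free_algebra_smult_closed l_distr r_distr m_assoc
        free_algebra_coeff_closed cring_axioms)
next
  fix a f g assume "a \<in> carrier R" and f: "f \<in> carrier (FA n)" "g \<in> carrier (FA n)"
  then have [simp]: "a \<in> carrier R" "f w \<in> carrier R" "g w \<in> carrier R" for w by auto
  have 1: "a \<otimes> (\<Oplus>k\<in>S. f (p k) \<otimes> g (r k)) = (\<Oplus>k\<in>S. a \<otimes> (f (p k) \<otimes> g (r k)))"
    if "finite S" for S and p r :: "nat \<Rightarrow> nat list"
    using that by (intro finsum_rdistr) auto
  show "a \<odot>\<^bsub>FA n\<^esub> f \<otimes>\<^bsub>FA n\<^esub> g = a \<odot>\<^bsub>FA n\<^esub> (f \<otimes>\<^bsub>FA n\<^esub> g)"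
    by (auto simp: 1 m_assoc)
  show "f \<otimes>\<^bsub>FA n\<^esub> (a \<odot>\<^bsub>FA n\<^esub> g) = a \<odot>\<^bsub>FA n\<^esub> (f \<otimes>\<^bsub>FA n\<^esub> g)"
    by (auto simp: 1 m_lcomm)
qed

end

section \<open>Evaluation of noncommutative polynomials\<close>

definition word_value :: "('b, 'c) ring_scheme \<Rightarrow> (nat \<Rightarrow> 'b) \<Rightarrow> nat list \<Rightarrow> 'b"
  where "word_value B y w = foldr (\<lambda>i b. y i \<otimes>\<^bsub>B\<^esub> b) w \<one>\<^bsub>B\<^esub>"

definition free_eval ::
    "('a, 'b) ring_scheme \<Rightarrow> ('a, 'c, 'd) module_scheme \<Rightarrow> (nat \<Rightarrow> 'c) \<Rightarrow> (nat list \<Rightarrow> 'a) \<Rightarrow> 'c"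
  where "free_eval R B y f = (\<Oplus>\<^bsub>B\<^esub>w\<in>{w. f w \<noteq> \<zero>\<^bsub>R\<^esub>}. f w \<odot>\<^bsub>B\<^esub> word_value B y w)"

context unital_algebra
begin

lemma word_value_Nil [simp]: "word_value B y [] = \<one>\<^bsub>B\<^esub>"
  and word_value_Cons [simp]: "word_value B y (i # w) = y i \<otimes>\<^bsub>B\<^esub> word_value B y w"
  by (simp_all add: word_value_def)

lemma word_value_closed:
  "(\<And>i. i \<in> set w \<Longrightarrow> y i \<in> carrier B) \<Longrightarrow> word_value B y w \<in> carrier B"
  by (induction w) auto

lemma word_value_append:
  "(\<And>i. i \<in> set u \<union> set v \<Longrightarrow> y i \<in> carrier B) \<Longrightarrow>
    word_value B y (u @ v) = word_value B y u \<otimes>\<^bsub>B\<^esub> word_value B y v"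
  by (induction u) (auto simp: word_value_closed m_assoc)

lemma smult_zero_l: "x \<in> carrier B \<Longrightarrow> \<zero> \<odot>\<^bsub>B\<^esub> x = \<zero>\<^bsub>B\<^esub>"
proof -
  assume x: "x \<in> carrier B"
  have "\<zero> \<odot>\<^bsub>B\<^esub> x = \<zero> \<odot>\<^bsub>B\<^esub> x \<oplus>\<^bsub>B\<^esub> \<zero> \<odot>\<^bsub>B\<^esub> x"
    using smult_l_distr[of \<zero> \<zero> x] x by simp
  then show ?thesis using x by (metis add.l_cancel_one smult_closed R.zero_closed)
qed

lemma smult_neg_one: "x \<in> carrier B \<Longrightarrow> (\<ominus> \<one>) \<odot>\<^bsub>B\<^esub> x = \<ominus>\<^bsub>B\<^esub> x"
  by (metis R.add.inv_closed R.l_neg R.one_closed minus_equality smult_closed smult_l_distr smult_one smult_zero_l)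

context
  fixes y :: "nat \<Rightarrow> 'c" and n :: nat
  assumes y: "\<And>i. i \<in> {1..n} \<Longrightarrow> y i \<in> carrier B"
begin

lemma word_value_closed' [simp]: "set w \<subseteq> {1..n} \<Longrightarrow> word_value B y w \<in> carrier B"
  using y by (intro word_value_closed) auto

lemma free_eval_summand_closed [simp]:
  assumes "f \<in> carrier (R.FA n)" "f w \<noteq> \<zero>"
  shows "f w \<odot>\<^bsub>B\<^esub> word_value B y w \<in> carrier B"
  using assms by (auto simp: R.free_algebra_carrier)

text \<open>
  The sum that defines an evaluation runs over a support, which changes under addition. Summing over
  any larger finite set of words makes evaluation visibly additive.
\<close>

lemma free_eval_superset:
  assumes "f \<in> carrier (R.FA n)" "finite S" "{w. f w \<noteq> \<zero>} \<subseteq> S" "\<And>w. w \<in> S \<Longrightarrow> set w \<subseteq> {1..n}"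
  shows "free_eval R B y f = (\<Oplus>\<^bsub>B\<^esub>w\<in>S. f w \<odot>\<^bsub>B\<^esub> word_value B y w)"
  unfolding free_eval_def using assms
  by (intro add.finprod_mono_neutral_cong_left) (auto simp: smult_zero_l)

lemma free_eval_add:
  assumes f: "f \<in> carrier (R.FA n)" and g: "g \<in> carrier (R.FA n)"
  shows "free_eval R B y (f \<oplus>\<^bsub>R.FA n\<^esub> g) = free_eval R B y f \<oplus>\<^bsub>B\<^esub> free_eval R B y g"
proof -
  let ?S = "{w. f w \<noteq> \<zero>} \<union> {w. g w \<noteq> \<zero>}"
  have S: "finite ?S" "\<And>w. w \<in> ?S \<Longrightarrow> set w \<subseteq> {1..n}"
    using f g by (auto simp: R.free_algebra_carrier)
  have fg: "f \<oplus>\<^bsub>R.FA n\<^esub> g \<in> carrier (R.FA n)"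
    using R.free_algebra_add_closed[OF f g] by simp
  have sub: "{w. (f \<oplus>\<^bsub>R.FA n\<^esub> g) w \<noteq> \<zero>} \<subseteq> ?S" by auto
  have 1: "free_eval R B y (f \<oplus>\<^bsub>R.FA n\<^esub> g) =
      (\<Oplus>\<^bsub>B\<^esub>w\<in>?S. (f \<oplus>\<^bsub>R.FA n\<^esub> g) w \<odot>\<^bsub>B\<^esub> word_value B y w)"
    by (rule free_eval_superset[OF fg S(1) sub S(2)])
  also have "\<dots> = (\<Oplus>\<^bsub>B\<^esub>w\<in>?S. f w \<odot>\<^bsub>B\<^esub> word_value B y w \<oplus>\<^bsub>B\<^esub> g w \<odot>\<^bsub>B\<^esub> word_value B y w)"
  proof (rule add.finprod_cong')
    fix w assume "w \<in> ?S"
    then have "set w \<subseteq> {1..n}" by (rule S)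
    then show "(f \<oplus>\<^bsub>R.FA n\<^esub> g) w \<odot>\<^bsub>B\<^esub> word_value B y w =
        f w \<odot>\<^bsub>B\<^esub> word_value B y w \<oplus>\<^bsub>B\<^esub> g w \<odot>\<^bsub>B\<^esub> word_value B y w"
      using f g by (simp add: smult_l_distr R.free_algebra_coeff_closed)
  next
    show "(\<lambda>w. f w \<odot>\<^bsub>B\<^esub> word_value B y w \<oplus>\<^bsub>B\<^esub> g w \<odot>\<^bsub>B\<^esub> word_value B y w) \<in> ?S \<rightarrow> carrier B"
      by (intro funcsetI a_closed smult_closed R.free_algebra_coeff_closed[OF f]
          R.free_algebra_coeff_closed[OF g] word_value_closed' S(2))
  qed simp
  also have "\<dots> = (\<Oplus>\<^bsub>B\<^esub>w\<in>?S. f w \<odot>\<^bsub>B\<^esub> word_value B y w) \<oplus>\<^bsub>B\<^esub> (\<Oplus>\<^bsub>B\<^esub>w\<in>?S. g w \<odot>\<^bsub>B\<^esub> word_value B y w)"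
    by (intro add.finprod_multf funcsetI smult_closed R.free_algebra_coeff_closed[OF f]
        R.free_algebra_coeff_closed[OF g] word_value_closed' S(2))
  also have "\<dots> = free_eval R B y f \<oplus>\<^bsub>B\<^esub> free_eval R B y g"
    using free_eval_superset[OF f S(1) _ S(2)] free_eval_superset[OF g S(1) _ S(2)] by simp
  finally show ?thesis .
qed

lemma free_eval_monomial:
  assumes "a \<in> carrier R" "set w \<subseteq> {1..n}"
  shows "free_eval R B y (word_monomial R a w) = a \<odot>\<^bsub>B\<^esub> word_value B y w"
proof -
  have "free_eval R B y (word_monomial R a w) =
      (\<Oplus>\<^bsub>B\<^esub>v\<in>{w}. word_monomial R a w v \<odot>\<^bsub>B\<^esub> word_value B y v)"
    by (rule free_eval_superset[OF R.word_monomial_closed[OF assms]])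
      (use assms in \<open>auto simp: word_monomial_def\<close>)
  then show ?thesis using assms by (simp add: word_monomial_def)
qed

lemma free_eval_closed: "f \<in> carrier (R.FA n) \<Longrightarrow> free_eval R B y f \<in> carrier B"
  unfolding free_eval_def by (rule add.finprod_closed) auto

lemma free_eval_hom: "free_eval R B y \<in> algebra_hom R (R.FA n) B"
proof -
  interpret A: unital_algebra R "R.FA n" by (rule R.unital_algebra_free_algebra)
  note [simp del] = R.free_algebra_simps
  have z: "free_eval R B y \<zero>\<^bsub>R.FA n\<^esub> = \<zero>\<^bsub>B\<^esub>"
    by (simp add: free_eval_def R.free_algebra_simps)
  have sm: "free_eval R B y (a \<odot>\<^bsub>R.FA n\<^esub> f) = a \<odot>\<^bsub>B\<^esub> free_eval R B y f"
    if a: "a \<in> carrier R" and f: "f \<in> carrier (R.FA n)" for a f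
    using f
  proof (induction f rule: R.free_algebra_induct)
    case zero then show ?case using a by (simp add: z)
  next
    case (add f g)
    then show ?case using a by (simp add: A.smult_r_distr free_eval_add smult_r_distr free_eval_closed)
  next
    case (monomial b w)
    have "a \<odot>\<^bsub>R.FA n\<^esub> word_monomial R b w = word_monomial R (a \<otimes> b) w"
      using a by (auto simp: R.free_algebra_simps word_monomial_def)
    with monomial a show ?case by (simp add: free_eval_monomial smult_assoc1)
  qed
  show ?thesis
  proof (rule algebra_homI)
    fix f g assume f: "f \<in> carrier (R.FA n)" and g: "g \<in> carrier (R.FA n)"
    show "free_eval R B y (f \<otimes>\<^bsub>R.FA n\<^esub> g) = free_eval R B y f \<otimes>\<^bsub>B\<^esub> free_eval R B y g"
      using f
    proof (induction f rule: R.free_algebra_induct)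
      case zero then show ?case using g by (simp add: z free_eval_closed)
    next
      case (add f f')
      then show ?case using g by (simp add: A.l_distr free_eval_add l_distr free_eval_closed)
    next
      case f: (monomial a u)
      show ?case using g
      proof (induction g rule: R.free_algebra_induct)
        case zero then show ?case using f by (simp add: z free_eval_closed R.word_monomial_closed)
      next
        case (add g g')
        then show ?case using f
          by (simp add: A.r_distr free_eval_add r_distr free_eval_closed R.word_monomial_closed)
      next
        case g: (monomial b v)
        have "word_value B y (u @ v) = word_value B y u \<otimes>\<^bsub>B\<^esub> word_value B y v"
          by (rule word_value_append) (use f g y in auto)
        then show ?case using f g
          by (simp add: R.word_monomial_mult free_eval_monomial smult_mult_left smult_mult_right
            smult_assoc1[symmetric] R.m_comm)
      qed
    qed
  next
    show "free_eval R B y \<one>\<^bsub>R.FA n\<^esub> = \<one>\<^bsub>B\<^esub>"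
      by (simp add: R.free_algebra_simps free_eval_monomial)
  qed (auto simp: free_eval_add free_eval_closed sm)
qed

end

end

section \<open>The quotient by the commutation relations\<close>

locale quantum_space = field R for R (structure) +
  fixes n :: nat and q :: "nat \<Rightarrow> nat \<Rightarrow> 'a"
  assumes antisym: "mult_antisymmetric R n q"
begin

abbreviation A :: "('a, nat list \<Rightarrow> 'a) module" where "A \<equiv> free_algebra R n"
abbreviation I :: "(nat list \<Rightarrow> 'a) set" where "I \<equiv> quantum_ideal R n q"
abbreviation Q :: "('a, (nat list \<Rightarrow> 'a) set) module" where "Q \<equiv> quantum_affine R n q"
abbreviation X :: "nat \<Rightarrow> (nat list \<Rightarrow> 'a) set" where "X \<equiv> quantum_var R n q"
abbreviation cls :: "(nat list \<Rightarrow> 'a) \<Rightarrow> (nat list \<Rightarrow> 'a) set" where "cls f \<equiv> I +>\<^bsub>A\<^esub> f"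
definition word :: "nat list \<Rightarrow> (nat list \<Rightarrow> 'a) set" where "word w = cls (word_monomial R \<one> w)"

sublocale A: unital_algebra R A
  by (rule unital_algebra_free_algebra)

lemma q_Units [simp]: "i \<in> {1..n} \<Longrightarrow> j \<in> {1..n} \<Longrightarrow> q i j \<in> Units R"
  and q_diag: "i \<in> {1..n} \<Longrightarrow> q i i = \<one>"
  and q_inv: "i \<in> {1..n} \<Longrightarrow> j \<in> {1..n} \<Longrightarrow> q j i = inv (q i j)"
  using antisym unfolding mult_antisymmetric_def by blast+

lemma q_closed [simp]: "i \<in> {1..n} \<Longrightarrow> j \<in> {1..n} \<Longrightarrow> q i j \<in> carrier R"
  by (simp add: Units_closed)

lemma q_cancel: "i \<in> {1..n} \<Longrightarrow> j \<in> {1..n} \<Longrightarrow> q i j \<otimes> q j i = \<one>"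
  using q_inv[of i j] Units_r_inv[of "q i j"] by simp

definition relator :: "nat \<Rightarrow> nat \<Rightarrow> nat list \<Rightarrow> 'a"
  where "relator i j = word_monomial R \<one> [i, j] \<ominus>\<^bsub>A\<^esub> word_monomial R (q i j) [j, i]"

definition relators :: "(nat list \<Rightarrow> 'a) set"
  where "relators = {relator i j | i j. 1 \<le> i \<and> i < j \<and> j \<le> n}"

lemma smult_word_monomial:
  "a \<in> carrier R \<Longrightarrow> b \<in> carrier R \<Longrightarrow> a \<odot>\<^bsub>A\<^esub> word_monomial R b w = word_monomial R (a \<otimes> b) w"
  by (auto simp: word_monomial_def)

lemma quantum_ideal_eq: "I = Idl\<^bsub>A\<^esub> relators"
proof -
  have [simp]: "free_var R i = word_monomial R \<one> [i]" for i
    by (simp add: free_var_def word_monomial_def)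
  have "free_var R i \<otimes>\<^bsub>A\<^esub> free_var R j \<ominus>\<^bsub>A\<^esub> q i j \<odot>\<^bsub>A\<^esub> (free_var R j \<otimes>\<^bsub>A\<^esub> free_var R i) = relator i j"
    if "1 \<le> i \<and> i < j \<and> j \<le> n" for i j
    using that by (simp add: relator_def word_monomial_mult smult_word_monomial del: free_algebra_simps)
  then show ?thesis
    unfolding quantum_ideal_def relators_def Let_def
    by (intro arg_cong[where f = "genideal A"] Collect_cong ex_cong1) (auto simp del: free_algebra_simps)
qed

lemma relators_subset: "relators \<subseteq> carrier A"
  by (auto simp: relators_def relator_def simp del: free_algebra_simps intro!: A.minus_closed)

sublocale I: ideal I A
  unfolding quantum_ideal_eq by (rule A.genideal_ideal[OF relators_subset])

lemma relator_in_I: "1 \<le> i \<Longrightarrow> i < j \<Longrightarrow> j \<le> n \<Longrightarrow> relator i j \<in> I"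
  unfolding quantum_ideal_eq using A.genideal_self[OF relators_subset] by (auto simp: relators_def)

lemma I_minimal:
  assumes "ideal J A" "\<And>i j. 1 \<le> i \<Longrightarrow> i < j \<Longrightarrow> j \<le> n \<Longrightarrow> relator i j \<in> J"
  shows "I \<subseteq> J"
  unfolding quantum_ideal_eq by (rule A.genideal_minimal) (use assms in \<open>auto simp: relators_def\<close>)

text \<open>
  An ideal of a ring absorbs scalars as well, since \<open>a f = (a 1) f\<close>.
\<close>

lemma I_smult: "a \<in> carrier R \<Longrightarrow> f \<in> I \<Longrightarrow> a \<odot>\<^bsub>A\<^esub> f \<in> I"
proof -
  assume a: "a \<in> carrier R" and f: "f \<in> I"
  have fA: "f \<in> carrier A" using f by (rule I.Icarr)
  have "(a \<odot>\<^bsub>A\<^esub> \<one>\<^bsub>A\<^esub>) \<otimes>\<^bsub>A\<^esub> f \<in> I"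
    by (rule I.I_l_closed) (use a f in \<open>auto simp del: free_algebra_simps\<close>)
  also have "(a \<odot>\<^bsub>A\<^esub> \<one>\<^bsub>A\<^esub>) \<otimes>\<^bsub>A\<^esub> f = a \<odot>\<^bsub>A\<^esub> f"
    using a fA by (simp add: A.smult_mult_left del: free_algebra_simps)
  finally show ?thesis .
qed

lemma cls_eq_iff:
  assumes "f \<in> carrier A" "g \<in> carrier A"
  shows "cls f = cls g \<longleftrightarrow> f \<ominus>\<^bsub>A\<^esub> g \<in> I"
  using A.quotient_eq_iff_same_a_r_cos[OF I.ideal_axioms assms] by blast

lemma carrier_Q: "carrier Q = cls ` carrier A"
  by (auto simp: quantum_affine_def ring.defs module.defs Let_def FactRing_def A_RCOSETS_def' image_def)

lemma cls_closed [simp, intro]: "f \<in> carrier A \<Longrightarrow> cls f \<in> carrier Q"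
  by (simp add: carrier_Q)

lemma Q_cases: assumes "C \<in> carrier Q" obtains f where "f \<in> carrier A" "C = cls f"
  using assms by (auto simp: carrier_Q)

lemma Q_zero: "\<zero>\<^bsub>Q\<^esub> = cls \<zero>\<^bsub>A\<^esub>"
  by (simp add: quantum_affine_def ring.defs module.defs Let_def FactRing_def
      del: free_algebra_simps) (metis A.a_coset_add_zero I.a_subset)

lemma Q_one: "\<one>\<^bsub>Q\<^esub> = cls \<one>\<^bsub>A\<^esub>"
  by (simp add: quantum_affine_def ring.defs module.defs Let_def FactRing_def del: free_algebra_simps)

lemma Q_add: "f \<in> carrier A \<Longrightarrow> g \<in> carrier A \<Longrightarrow> cls f \<oplus>\<^bsub>Q\<^esub> cls g = cls (f \<oplus>\<^bsub>A\<^esub> g)"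
  by (simp add: quantum_affine_def ring.defs module.defs Let_def FactRing_def I.a_rcos_sum
      del: free_algebra_simps)

lemma Q_mult: "f \<in> carrier A \<Longrightarrow> g \<in> carrier A \<Longrightarrow> cls f \<otimes>\<^bsub>Q\<^esub> cls g = cls (f \<otimes>\<^bsub>A\<^esub> g)"
  by (simp add: quantum_affine_def ring.defs module.defs Let_def FactRing_def I.rcoset_mult_add
      del: free_algebra_simps)

text \<open>
  Scalar multiplication of a coset is defined by a union over its representatives; all of them give
  the same coset because the ideal is stable under scalars.
\<close>

lemma Q_smult:
  assumes "a \<in> carrier R" "f \<in> carrier A"
  shows "a \<odot>\<^bsub>Q\<^esub> cls f = cls (a \<odot>\<^bsub>A\<^esub> f)"
proof -
  have "cls (a \<odot>\<^bsub>A\<^esub> g) = cls (a \<odot>\<^bsub>A\<^esub> f)" if "g \<in> cls f" for g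
  proof -
    have g: "g \<in> carrier A"
      using that A.a_r_coset_subset_G[OF I.a_subset assms(2)] by blast
    have "cls f = cls g"
      using that assms(2) I.additive_subgroup_axioms by (intro A.a_repr_independence) (auto simp: additive_subgroup_def)
    then have "a \<odot>\<^bsub>A\<^esub> (g \<ominus>\<^bsub>A\<^esub> f) \<in> I"
      using g assms by (intro I_smult) (auto simp: cls_eq_iff[symmetric])
    also have "a \<odot>\<^bsub>A\<^esub> (g \<ominus>\<^bsub>A\<^esub> f) = a \<odot>\<^bsub>A\<^esub> g \<ominus>\<^bsub>A\<^esub> a \<odot>\<^bsub>A\<^esub> f"
      using g assms by (simp add: A.smult_r_minus A.smult_r_distr a_minus_def del: free_algebra_simps)
    finally show ?thesis using g assms by (simp add: cls_eq_iff del: free_algebra_simps)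
  qed
  moreover have "f \<in> cls f"
    using assms by (intro I.a_rcos_self)
  ultimately have "(\<Union>x\<in>cls f. cls (a \<odot>\<^bsub>A\<^esub> x)) = cls (a \<odot>\<^bsub>A\<^esub> f)" by blast
  then show ?thesis
    by (simp add: quantum_affine_def ring.defs module.defs Let_def FactRing_def del: free_algebra_simps)
qed

lemma unital_algebra_Q: "unital_algebra R Q"
proof (intro unital_algebra.intro unital_algebra_axioms.intro)
  note [simp del] = free_algebra_simps
  show ring: "ring Q"
  proof (rule ringI)
    show "abelian_group Q"
    proof (rule abelian_groupI)
      fix C assume "C \<in> carrier Q"
      then obtain f where f: "f \<in> carrier A" "C = cls f" by (rule Q_cases)
      then have "cls (\<ominus>\<^bsub>A\<^esub> f) \<oplus>\<^bsub>Q\<^esub> C = \<zero>\<^bsub>Q\<^esub>"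
        by (simp add: Q_add Q_zero A.l_neg)
      then show "\<exists>D\<in>carrier Q. D \<oplus>\<^bsub>Q\<^esub> C = \<zero>\<^bsub>Q\<^esub>"
        using f by (intro bexI[of _ "cls (\<ominus>\<^bsub>A\<^esub> f)"]) auto
    qed (auto elim!: Q_cases simp: Q_add Q_zero A.a_ac)
    show "Group.monoid Q"
      by (rule monoidI) (auto elim!: Q_cases simp: Q_mult Q_one A.m_assoc)
  qed (auto elim!: Q_cases simp: Q_add Q_mult A.l_distr A.r_distr)
  show "Module.module R Q"
  proof (rule moduleI)
    show "abelian_group Q" using ring by (rule ring.is_abelian_group)
  qed (auto elim!: Q_cases simp: Q_smult Q_add A.smult_l_distr A.smult_r_distr A.smult_assoc1 cring_axioms)
next
  note [simp del] = free_algebra_simps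
  fix a C D assume "a \<in> carrier R" "C \<in> carrier Q" "D \<in> carrier Q"
  then show "a \<odot>\<^bsub>Q\<^esub> C \<otimes>\<^bsub>Q\<^esub> D = a \<odot>\<^bsub>Q\<^esub> (C \<otimes>\<^bsub>Q\<^esub> D)" "C \<otimes>\<^bsub>Q\<^esub> (a \<odot>\<^bsub>Q\<^esub> D) = a \<odot>\<^bsub>Q\<^esub> (C \<otimes>\<^bsub>Q\<^esub> D)"
    by (auto elim!: Q_cases simp: Q_smult Q_mult A.smult_mult_left A.smult_mult_right)
qed

sublocale Q: unital_algebra R Q
  by (rule unital_algebra_Q)

end

section \<open>Generators and the universal property\<close>

context quantum_space
begin

text \<open>
  From here on elements of the free algebra are handled through the algebra laws only, so their
  description as coefficient functions must not be unfolded any more.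
\<close>

declare free_algebra_simps [simp del]

lemma X_eq_word: "X i = word [i]"
  by (simp add: word_def quantum_var_def free_var_def word_monomial_def)

lemma word_closed [simp]: "set w \<subseteq> {1..n} \<Longrightarrow> word w \<in> carrier Q"
  by (auto simp: word_def)

lemma X_closed [simp]: "i \<in> {1..n} \<Longrightarrow> X i \<in> carrier Q"
  by (simp add: X_eq_word)

lemma word_append:
  "set u \<subseteq> {1..n} \<Longrightarrow> set v \<subseteq> {1..n} \<Longrightarrow> word (u @ v) = word u \<otimes>\<^bsub>Q\<^esub> word v"
  by (simp add: word_def Q_mult word_monomial_mult)

lemma word_Nil: "word [] = \<one>\<^bsub>Q\<^esub>"
  by (simp add: word_def Q_one free_algebra_simps)

lemma word_Cons:
  "i \<in> {1..n} \<Longrightarrow> set w \<subseteq> {1..n} \<Longrightarrow> word (i # w) = X i \<otimes>\<^bsub>Q\<^esub> word w"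
  using word_append[of "[i]" w] by (simp add: X_eq_word)

lemma cls_monomial:
  "a \<in> carrier R \<Longrightarrow> set w \<subseteq> {1..n} \<Longrightarrow> cls (word_monomial R a w) = a \<odot>\<^bsub>Q\<^esub> word w"
  by (simp add: word_def Q_smult smult_word_monomial)

lemma quantum_induct_word [consumes 1, case_names zero add monomial]:
  assumes "C \<in> carrier Q"
    and zero: "P \<zero>\<^bsub>Q\<^esub>"
    and add: "\<And>C D. \<lbrakk>C \<in> carrier Q; D \<in> carrier Q; P C; P D\<rbrakk> \<Longrightarrow> P (C \<oplus>\<^bsub>Q\<^esub> D)"
    and monomial: "\<And>a w. \<lbrakk>a \<in> carrier R; set w \<subseteq> {1..n}\<rbrakk> \<Longrightarrow> P (a \<odot>\<^bsub>Q\<^esub> word w)"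
  shows "P C"
proof -
  obtain f where f: "f \<in> carrier A" "C = cls f" using assms(1) by (rule Q_cases)
  have "P (cls f)" using f(1)
  proof (induction f rule: free_algebra_induct)
    case zero then show ?case using assms(2) by (simp add: Q_zero)
  next
    case (add f g) then show ?case using assms(3)[of "cls f" "cls g"] by (simp add: Q_add)
  next
    case (monomial a w) then show ?case using assms(4)[of a w] by (simp add: cls_monomial)
  qed
  with f show ?thesis by simp
qed

lemma quantum_induct [consumes 1, case_names one var add mult smult]:
  assumes "C \<in> carrier Q"
    and one: "P \<one>\<^bsub>Q\<^esub>"
    and var: "\<And>i. i \<in> {1..n} \<Longrightarrow> P (X i)"
    and add: "\<And>C D. \<lbrakk>C \<in> carrier Q; D \<in> carrier Q; P C; P D\<rbrakk> \<Longrightarrow> P (C \<oplus>\<^bsub>Q\<^esub> D)"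
    and mult: "\<And>C D. \<lbrakk>C \<in> carrier Q; D \<in> carrier Q; P C; P D\<rbrakk> \<Longrightarrow> P (C \<otimes>\<^bsub>Q\<^esub> D)"
    and smult: "\<And>a C. \<lbrakk>a \<in> carrier R; C \<in> carrier Q; P C\<rbrakk> \<Longrightarrow> P (a \<odot>\<^bsub>Q\<^esub> C)"
  shows "P C"
  using assms(1)
proof (induction C rule: quantum_induct_word)
  case zero
  show ?case using smult[of \<zero> "\<one>\<^bsub>Q\<^esub>"] one by (simp add: Q.smult_zero_l)
next
  case (add C D) then show ?case by (rule assms(4))
next
  case (monomial a w)
  from monomial(2) have "P (word w)"
    by (induction w) (auto simp: word_Nil one word_Cons intro!: mult var)
  with monomial show ?case by (intro smult) auto
qed

lemma algebra_hom_eqI: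
  assumes "g \<in> algebra_hom R Q B" "h \<in> algebra_hom R Q B"
    and "\<And>i. i \<in> {1..n} \<Longrightarrow> g (X i) = h (X i)" "C \<in> carrier Q"
  shows "g C = h C"
  using assms(4)
  by (induction C rule: quantum_induct)
     (simp_all add: algebra_homD[OF assms(1)] algebra_homD[OF assms(2)] assms(3))

lemma X_relation_less:
  assumes "1 \<le> i" "i < j" "j \<le> n"
  shows "X i \<otimes>\<^bsub>Q\<^esub> X j = q i j \<odot>\<^bsub>Q\<^esub> (X j \<otimes>\<^bsub>Q\<^esub> X i)"
proof -
  have "cls (word_monomial R \<one> [i, j]) = cls (word_monomial R (q i j) [j, i])"
    using relator_in_I[OF assms] assms by (subst cls_eq_iff) (auto simp: relator_def)
  then show ?thesis
    using assms word_append[of "[i]" "[j]"] word_append[of "[j]" "[i]"]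
    by (simp add: X_eq_word cls_monomial)
qed

lemma X_relation:
  assumes ij: "i \<in> {1..n}" "j \<in> {1..n}"
  shows "X i \<otimes>\<^bsub>Q\<^esub> X j = q i j \<odot>\<^bsub>Q\<^esub> (X j \<otimes>\<^bsub>Q\<^esub> X i)"
proof -
  consider "i < j" | "i = j" | "j < i" by linarith
  then show ?thesis
  proof cases
    case 1 then show ?thesis using ij by (intro X_relation_less) auto
  next
    case 2 then show ?thesis using ij by (simp add: q_diag)
  next
    case 3
    then have "q i j \<odot>\<^bsub>Q\<^esub> (X j \<otimes>\<^bsub>Q\<^esub> X i) = q i j \<odot>\<^bsub>Q\<^esub> (q j i \<odot>\<^bsub>Q\<^esub> (X i \<otimes>\<^bsub>Q\<^esub> X j))"
      using X_relation_less[of j i] ij by simp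
    also have "\<dots> = X i \<otimes>\<^bsub>Q\<^esub> X j"
      using ij by (simp add: Q.smult_assoc1[symmetric] q_cancel)
    finally show ?thesis by simp
  qed
qed

text \<open>
  The kernel of an evaluation is an ideal. If it contains the relators, it contains the whole ideal
  that they generate, and the evaluation descends to the quotient.
\<close>

lemma quantum_lift:
  assumes "unital_algebra R B"
    and y: "\<And>i. i \<in> {1..n} \<Longrightarrow> y i \<in> carrier B"
    and rel: "\<And>i j. \<lbrakk>1 \<le> i; i < j; j \<le> n\<rbrakk> \<Longrightarrow> y i \<otimes>\<^bsub>B\<^esub> y j = q i j \<odot>\<^bsub>B\<^esub> (y j \<otimes>\<^bsub>B\<^esub> y i)"
  obtains h where "h \<in> algebra_hom R Q B" "\<And>i. i \<in> {1..n} \<Longrightarrow> h (X i) = y i"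
proof -
  interpret B: unital_algebra R B by fact
  let ?e = "free_eval R B y"
  have e: "?e \<in> algebra_hom R A B" using y by (rule B.free_eval_hom)
  interpret e: ring_hom_ring A B ?e
    by (rule ring_hom_ringI2) (use e A.ring_axioms B.ring_axioms in \<open>auto simp: algebra_hom_def\<close>)
  have eX: "?e (word_monomial R a w) = a \<odot>\<^bsub>B\<^esub> word_value B y w"
    if "a \<in> carrier R" "set w \<subseteq> {1..n}" for a w
    using y that by (rule B.free_eval_monomial)
  have "I \<subseteq> a_kernel A B ?e"
  proof (rule I_minimal)
    show "ideal (a_kernel A B ?e) A" by (rule e.kernel_is_ideal)
    fix i j assume ij: "1 \<le> i" "i < j" "j \<le> n"
    have "?e (word_monomial R \<one> [i, j]) = ?e (word_monomial R (q i j) [j, i])"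
      using ij y rel[OF ij] by (simp add: eX)
    then show "relator i j \<in> a_kernel A B ?e"
      using ij unfolding relator_def a_kernel_def kernel_def
      by (simp add: a_minus_def B.r_neg)
  qed
  then have ker: "?e f = ?e g" if "f \<in> carrier A" "g \<in> carrier A" "cls f = cls g" for f g
  proof -
    have "f \<ominus>\<^bsub>A\<^esub> g \<in> a_kernel A B ?e"
      using that \<open>I \<subseteq> _\<close> cls_eq_iff by blast
    then have "?e (f \<ominus>\<^bsub>A\<^esub> g) = \<zero>\<^bsub>B\<^esub>"
      unfolding a_kernel_def' by blast
    moreover have "?e (f \<ominus>\<^bsub>A\<^esub> g) = ?e f \<ominus>\<^bsub>B\<^esub> ?e g"
      unfolding a_minus_def
      by (subst e.hom_add[OF that(1) A.a_inv_closed[OF that(2)]]) (subst e.hom_a_inv[OF that(2)], rule refl)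
    ultimately show ?thesis
      using B.minus_equality[of "?e f" "\<ominus>\<^bsub>B\<^esub> ?e g"] B.minus_minus e.hom_closed that(1,2)
      by (metis B.a_inv_closed a_minus_def)
  qed
  define h where "h C = ?e (SOME f. f \<in> carrier A \<and> C = cls f)" for C
  have h: "h (cls f) = ?e f" if "f \<in> carrier A" for f
  proof -
    have "(SOME g. g \<in> carrier A \<and> cls f = cls g) \<in> carrier A \<and> cls f = cls (SOME g. g \<in> carrier A \<and> cls f = cls g)"
      by (rule someI[of _ f]) (use that in simp)
    then show ?thesis unfolding h_def using that by (intro ker) auto
  qed
  show ?thesis
  proof
    show "h \<in> algebra_hom R Q B"
      by (rule algebra_homI)
        (auto elim!: Q_cases simp: h Q_add Q_mult Q_one Q_smult algebra_homD[OF e])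
    show "h (X i) = y i" if "i \<in> {1..n}" for i
      using that y by (simp add: X_eq_word word_def h eX)
  qed
qed

end

section \<open>Sorting words\<close>

lemma finite_mset_eq: "finite {w. mset w = M}"
proof (rule finite_subset)
  show "{w. mset w = M} \<subseteq> {w. set w \<subseteq> set_mset M \<and> length w = size M}" by auto
qed (simp add: finite_lists_length_eq)

lemma finite_submultisets: "finite {K. K \<subseteq># M}"
proof (rule finite_subset)
  show "{K. K \<subseteq># M} \<subseteq> mset ` {w. set w \<subseteq> set_mset M \<and> length w \<le> size M}"
  proof
    fix K assume "K \<in> {K. K \<subseteq># M}"
    moreover obtain w where "mset w = K" using ex_mset by blast
    ultimately show "K \<in> mset ` {w. set w \<subseteq> set_mset M \<and> length w \<le> size M}"
      by (auto simp: size_mset_mono set_mset_mono image_iff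
          intro!: exI[of _ w] dest: mset_subset_eqD size_mset_mono simp flip: size_mset)
  qed
qed (simp add: finite_lists_length_le)

lemma (in comm_monoid) finprod_Units:
  "(\<And>i. i \<in> S \<Longrightarrow> f i \<in> Units G) \<Longrightarrow> finprod G f S \<in> Units G"
  by (induction S rule: infinite_finite_induct) (auto simp: Pi_def Units_closed)

lemma (in monoid) nat_pow_Units: "x \<in> Units G \<Longrightarrow> x [^] (k::nat) \<in> Units G"
  by (induction k) auto

context quantum_space
begin

text \<open>
  The scalar that appears when a letter \<open>i\<close> is moved to the right across a letter \<open>j\<close> in order to
  sort them. The cases \<open>i \<le> j\<close> need no move.
\<close>

definition crossing :: "nat \<Rightarrow> nat \<Rightarrow> 'a"
  where "crossing i j = (if j < i then q i j else \<one>)"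

text \<open>
  The scalar that appears when \<open>X\<^sub>i\<close> is sorted into the ordered monomial with exponents \<open>M\<close>.
\<close>

definition row_factor :: "nat \<Rightarrow> nat multiset \<Rightarrow> 'a"
  where "row_factor i M = (\<Otimes>j\<in>{1..n}. crossing i j [^] count M j)"

text \<open>
  The structure constants of the algebra: the product of the ordered monomials with exponents \<open>K\<close> and
  \<open>M\<close> is \<open>cocycle K M\<close> times the ordered monomial with exponents \<open>K + M\<close>. Exponent vectors are
  multisets of indices, which come with a linear order compatible with addition.
\<close>

definition cocycle :: "nat multiset \<Rightarrow> nat multiset \<Rightarrow> 'a"
  where "cocycle K M = (\<Otimes>i\<in>{1..n}. row_factor i M [^] count K i)"

lemma crossing_Units [simp]: "i \<in> {1..n} \<Longrightarrow> j \<in> {1..n} \<Longrightarrow> crossing i j \<in> Units R"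
  by (simp add: crossing_def)

lemma row_factor_Units [simp]: "i \<in> {1..n} \<Longrightarrow> row_factor i M \<in> Units R"
  unfolding row_factor_def by (intro finprod_Units nat_pow_Units crossing_Units)

lemma cocycle_Units [simp]: "cocycle K M \<in> Units R"
  unfolding cocycle_def by (intro finprod_Units nat_pow_Units row_factor_Units)

lemma row_factor_closed [simp]: "i \<in> {1..n} \<Longrightarrow> row_factor i M \<in> carrier R"
  and cocycle_closed [simp]: "cocycle K M \<in> carrier R"
  by (simp_all add: Units_closed)

lemma row_factor_add: "i \<in> {1..n} \<Longrightarrow> row_factor i (M + N) = row_factor i M \<otimes> row_factor i N"
  unfolding row_factor_def
  by (subst finprod_multf[symmetric])
     (auto simp: nat_pow_mult Units_closed simp del: finprod_multf intro!: finprod_cong' Units_closed nat_pow_Units)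

lemma row_factor_single: "i \<in> {1..n} \<Longrightarrow> j \<in> {1..n} \<Longrightarrow> row_factor i {#j#} = crossing i j"
proof -
  assume ij: "i \<in> {1..n}" "j \<in> {1..n}"
  have "row_factor i {#j#} = (\<Otimes>k\<in>{1..n}. if j = k then crossing i k else \<one>)"
    unfolding row_factor_def using ij by (intro finprod_cong') (auto simp: Units_closed)
  also have "\<dots> = crossing i j"
    using ij by (intro finprod_singleton) (auto simp: Units_closed)
  finally show ?thesis .
qed

lemma row_factor_ge: "(\<And>j. j \<in># M \<Longrightarrow> i \<le> j) \<Longrightarrow> row_factor i M = \<one>"
  unfolding row_factor_def
proof (rule finprod_one_eqI)
  fix j assume "\<And>j. j \<in># M \<Longrightarrow> i \<le> j"
  then show "crossing i j [^] count M j = \<one>"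
    by (cases "j \<in># M") (auto simp: crossing_def not_in_iff dest: leD)
qed

lemma row_factor_empty [simp]: "row_factor i {#} = \<one>"
  by (rule row_factor_ge) simp

lemma cocycle_add_left: "cocycle (K + L) M = cocycle K M \<otimes> cocycle L M"
  unfolding cocycle_def
  by (subst finprod_multf[symmetric])
     (auto simp: nat_pow_mult Units_closed simp del: finprod_multf intro!: finprod_cong' Units_closed nat_pow_Units)

lemma cocycle_add_right: "cocycle K (M + N) = cocycle K M \<otimes> cocycle K N"
  unfolding cocycle_def
  by (subst finprod_multf[symmetric])
     (auto simp: nat_pow_distrib row_factor_add Units_closed simp del: finprod_multf intro!: finprod_cong' Units_closed nat_pow_Units)

lemma cocycle_single_left: "i \<in> {1..n} \<Longrightarrow> cocycle {#i#} M = row_factor i M"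
proof -
  assume i: "i \<in> {1..n}"
  have "cocycle {#i#} M = (\<Otimes>k\<in>{1..n}. if i = k then row_factor k M else \<one>)"
    unfolding cocycle_def using i by (intro finprod_cong') (auto simp: Units_closed)
  also have "\<dots> = row_factor i M"
    using i by (intro finprod_singleton) (auto simp: Units_closed)
  finally show ?thesis .
qed

lemma cocycle_empty [simp]: "cocycle {#} M = \<one>" "cocycle K {#} = \<one>"
proof -
  show "cocycle {#} M = \<one>" unfolding cocycle_def by (rule finprod_one_eqI) simp
  show "cocycle K {#} = \<one>" unfolding cocycle_def by (rule finprod_one_eqI) simp
qed

text \<open>
  The scalar by which a word differs from its sorted rearrangement (see \<open>word_sort\<close>).
\<close>

fun sorting_factor :: "nat list \<Rightarrow> 'a"
  where "sorting_factor [] = \<one>"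
  | "sorting_factor (i # w) = cocycle {#i#} (mset w) \<otimes> sorting_factor w"

lemma sorting_factor_Units [simp]: "sorting_factor w \<in> Units R"
  by (induction w) auto

lemma sorting_factor_closed [simp]: "sorting_factor w \<in> carrier R"
  by (simp add: Units_closed)

lemma sorting_factor_append:
  "sorting_factor (u @ v) = sorting_factor u \<otimes> sorting_factor v \<otimes> cocycle (mset u) (mset v)"
proof (induction u)
  case (Cons i u)
  have "cocycle (add_mset i (mset u)) (mset v) = cocycle {#i#} (mset v) \<otimes> cocycle (mset u) (mset v)"
    using cocycle_add_left[of "{#i#}" "mset u"] by simp
  then show ?case by (simp add: Cons cocycle_add_right m_ac)
qed simp

lemma X_insort:
  assumes "i \<in> {1..n}" "set w \<subseteq> {1..n}" "sorted w"
  shows "X i \<otimes>\<^bsub>Q\<^esub> word w = row_factor i (mset w) \<odot>\<^bsub>Q\<^esub> word (insort i w)"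
  using assms(2,3)
proof (induction w)
  case Nil
  then show ?case using assms(1) word_Cons[of i "[]"] by simp
next
  case (Cons j w)
  show ?case
  proof (cases "i \<le> j")
    case True
    then have "row_factor i (mset (j # w)) = \<one>" using Cons.prems by (intro row_factor_ge) auto
    with True Cons.prems assms(1) show ?thesis by (simp add: word_Cons)
  next
    case False
    have c: "row_factor i (mset (j # w)) = q i j \<otimes> row_factor i (mset w)"
      using row_factor_add[of i "{#j#}" "mset w"] row_factor_single[of i j] False Cons.prems assms(1)
      by (simp add: crossing_def)
    have ins: "set (insort i w) \<subseteq> {1..n}" using Cons.prems assms(1) by (simp add: set_insort_key)
    have "X i \<otimes>\<^bsub>Q\<^esub> word (j # w) = X i \<otimes>\<^bsub>Q\<^esub> X j \<otimes>\<^bsub>Q\<^esub> word w"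
      using Cons.prems assms(1) by (simp add: word_Cons Q.m_assoc)
    also have "\<dots> = q i j \<odot>\<^bsub>Q\<^esub> (X j \<otimes>\<^bsub>Q\<^esub> (X i \<otimes>\<^bsub>Q\<^esub> word w))"
      using Cons.prems assms(1) X_relation[of i j] by (simp add: Q.smult_mult_left Q.m_assoc)
    also have "\<dots> = q i j \<odot>\<^bsub>Q\<^esub> (X j \<otimes>\<^bsub>Q\<^esub> (row_factor i (mset w) \<odot>\<^bsub>Q\<^esub> word (insort i w)))"
      using Cons by simp
    also have "\<dots> = (q i j \<otimes> row_factor i (mset w)) \<odot>\<^bsub>Q\<^esub> (X j \<otimes>\<^bsub>Q\<^esub> word (insort i w))"
      using Cons.prems assms(1) ins by (simp add: Q.smult_mult_right Q.smult_assoc1)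
    also have "\<dots> = row_factor i (mset (j # w)) \<odot>\<^bsub>Q\<^esub> word (insort i (j # w))"
      using False Cons.prems ins word_Cons[of j "insort i w"] unfolding c by simp
    finally show ?thesis .
  qed
qed

lemma word_sort:
  "set w \<subseteq> {1..n} \<Longrightarrow> word w = sorting_factor w \<odot>\<^bsub>Q\<^esub> word (sort w)"
proof (induction w)
  case (Cons i w)
  have s: "set (sort w) \<subseteq> {1..n}" "set (insort i (sort w)) \<subseteq> {1..n}"
    using Cons.prems by (auto simp: set_insort_key)
  have "word (i # w) = X i \<otimes>\<^bsub>Q\<^esub> (sorting_factor w \<odot>\<^bsub>Q\<^esub> word (sort w))"
    using Cons by (simp add: word_Cons)
  also have "\<dots> = sorting_factor w \<odot>\<^bsub>Q\<^esub> (X i \<otimes>\<^bsub>Q\<^esub> word (sort w))"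
    using Cons.prems s by (simp add: Q.smult_mult_right)
  also have "\<dots> = sorting_factor w \<odot>\<^bsub>Q\<^esub> (row_factor i (mset w) \<odot>\<^bsub>Q\<^esub> word (insort i (sort w)))"
    using X_insort[of i "sort w"] Cons.prems s by simp
  also have "\<dots> = sorting_factor (i # w) \<odot>\<^bsub>Q\<^esub> word (sort (i # w))"
    using Cons.prems s by (simp add: Q.smult_assoc1[symmetric] cocycle_single_left m_comm)
  finally show ?case .
qed (simp add: word_Nil)

end

section \<open>The basis of ordered monomials\<close>

context quantum_space
begin

text \<open>
  The coefficient of the ordered monomial \<open>M\<close> in a noncommutative polynomial: words that are
  rearrangements of \<open>M\<close> contribute according to their sorting factors.
\<close>

definition normal_form :: "(nat list \<Rightarrow> 'a) \<Rightarrow> nat multiset \<Rightarrow> 'a"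
  where "normal_form f M = (\<Oplus>w\<in>{w. mset w = M}. sorting_factor w \<otimes> f w)"

text \<open>
  The product of coefficient functions in the basis of ordered monomials.
\<close>

definition convolve :: "(nat multiset \<Rightarrow> 'a) \<Rightarrow> (nat multiset \<Rightarrow> 'a) \<Rightarrow> nat multiset \<Rightarrow> 'a"
  where "convolve p r M = (\<Oplus>K\<in>{K. K \<subseteq># M}. cocycle K (M - K) \<otimes> (p K \<otimes> r (M - K)))"

lemma normal_form_closed [simp]: "f \<in> carrier A \<Longrightarrow> normal_form f M \<in> carrier R"
  unfolding normal_form_def by (auto intro!: finsum_closed)

lemma normal_form_zero: "normal_form \<zero>\<^bsub>A\<^esub> M = \<zero>"
  by (simp add: normal_form_def free_algebra_simps)

lemma normal_form_add:
  "f \<in> carrier A \<Longrightarrow> g \<in> carrier A \<Longrightarrow> normal_form (f \<oplus>\<^bsub>A\<^esub> g) M = normal_form f M \<oplus> normal_form g M"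
  unfolding normal_form_def
  by (subst finsum_addf[symmetric])
     (auto simp: free_algebra_simps r_distr simp del: finsum_addf intro!: finsum_cong')

lemma normal_form_smult:
  "a \<in> carrier R \<Longrightarrow> f \<in> carrier A \<Longrightarrow> normal_form (a \<odot>\<^bsub>A\<^esub> f) M = a \<otimes> normal_form f M"
  unfolding normal_form_def
  by (subst finsum_rdistr)
     (auto simp: free_algebra_simps m_lcomm finite_mset_eq intro!: finsum_cong')

lemma normal_form_monomial:
  assumes "a \<in> carrier R"
  shows "normal_form (word_monomial R a w) M = (if M = mset w then sorting_factor w \<otimes> a else \<zero>)"
proof (cases "M = mset w")
  case True
  have "normal_form (word_monomial R a w) M =
      (\<Oplus>v\<in>{v. mset v = M}. if w = v then sorting_factor v \<otimes> a else \<zero>)"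
    unfolding normal_form_def using assms by (intro finsum_cong') (auto simp: word_monomial_def)
  also have "\<dots> = sorting_factor w \<otimes> a"
    using assms True by (intro finsum_singleton) (auto simp: finite_mset_eq)
  finally show ?thesis using True by simp
next
  case False
  have "normal_form (word_monomial R a w) M = (\<Oplus>v\<in>{v. mset v = M}. \<zero>)"
    unfolding normal_form_def using assms False by (intro finsum_cong') (auto simp: word_monomial_def)
  then show ?thesis using False by simp
qed

lemma convolve_add_left:
  assumes "\<And>M. p M \<in> carrier R" "\<And>M. p' M \<in> carrier R" "\<And>M. r M \<in> carrier R"
  shows "convolve (\<lambda>M. p M \<oplus> p' M) r M = convolve p r M \<oplus> convolve p' r M"
  unfolding convolve_def
  by (subst finsum_addf[symmetric])
     (auto simp: assms r_distr l_distr simp del: finsum_addf intro!: finsum_cong')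

lemma convolve_add_right:
  assumes "\<And>M. p M \<in> carrier R" "\<And>M. r M \<in> carrier R" "\<And>M. r' M \<in> carrier R"
  shows "convolve p (\<lambda>M. r M \<oplus> r' M) M = convolve p r M \<oplus> convolve p r' M"
  unfolding convolve_def
  by (subst finsum_addf[symmetric])
     (auto simp: assms r_distr l_distr simp del: finsum_addf intro!: finsum_cong')

lemma convolve_zero:
  assumes "\<And>M. p M \<in> carrier R"
  shows "convolve (\<lambda>M. \<zero>) p M = \<zero>" "convolve p (\<lambda>M. \<zero>) M = \<zero>"
  by (simp_all add: convolve_def assms)

text \<open>
  If a monomial can be written as a product of monomials of the two factors in one way only, no
  cancellation occurs in its coefficient. This is what makes extremal monomials multiplicative.
\<close>

lemma convolve_unique:
  assumes p: "\<And>M. p M \<in> carrier R" and r: "\<And>M. r M \<in> carrier R"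
    and unique: "\<And>K' L'. \<lbrakk>p K' \<noteq> \<zero>; r L' \<noteq> \<zero>; K' + L' = K + L\<rbrakk> \<Longrightarrow> K' = K"
  shows "convolve p r (K + L) = cocycle K L \<otimes> (p K \<otimes> r L)"
proof -
  let ?g = "\<lambda>N. cocycle N (K + L - N) \<otimes> (p N \<otimes> r (K + L - N))"
  have "?g N = \<zero>" if "N \<subseteq># K + L" "K \<noteq> N" for N
  proof -
    have "p N = \<zero> \<or> r (K + L - N) = \<zero>"
      using unique[of N "K + L - N"] that by (metis subset_mset.add_diff_inverse)
    then show ?thesis using p r by auto
  qed
  then have "convolve p r (K + L) = (\<Oplus>N\<in>{N. N \<subseteq># K + L}. if K = N then ?g N else \<zero>)"
    unfolding convolve_def using p r by (intro finsum_cong') auto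
  also have "\<dots> = ?g K"
    using p r by (intro finsum_singleton) (auto simp: finite_submultisets)
  finally show ?thesis by simp
qed

lemma convolve_nonzeroE:
  assumes "convolve p r M \<noteq> \<zero>" and p: "\<And>M. p M \<in> carrier R" and r: "\<And>M. r M \<in> carrier R"
  obtains K L where "M = K + L" "p K \<noteq> \<zero>" "r L \<noteq> \<zero>"
proof -
  have "\<exists>K. K \<subseteq># M \<and> p K \<noteq> \<zero> \<and> r (M - K) \<noteq> \<zero>"
  proof (rule ccontr)
    assume *: "\<not> ?thesis"
    have "cocycle K (M - K) \<otimes> (p K \<otimes> r (M - K)) = \<zero>" if "K \<subseteq># M" for K
    proof -
      have "p K = \<zero> \<or> r (M - K) = \<zero>" using * that by blast
      then show ?thesis using p r by auto
    qed
    then have "convolve p r M = (\<Oplus>K\<in>{K. K \<subseteq># M}. \<zero>)"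
      unfolding convolve_def by (intro finsum_cong') auto
    with assms(1) show False by simp
  qed
  then show ?thesis using that by (metis subset_mset.add_diff_inverse)
qed

text \<open>
  By bilinearity this is the cocycle property \<open>sorting_factor_append\<close>, read for words.
\<close>

lemma normal_form_mult:
  assumes f: "f \<in> carrier A" and g: "g \<in> carrier A"
  shows "normal_form (f \<otimes>\<^bsub>A\<^esub> g) M = convolve (normal_form f) (normal_form g) M"
proof -
  have nf_add: "normal_form (f \<oplus>\<^bsub>A\<^esub> g) = (\<lambda>M. normal_form f M \<oplus> normal_form g M)"
    if "f \<in> carrier A" "g \<in> carrier A" for f g
    using normal_form_add[OF that] by auto
  have nf_zero: "normal_form \<zero>\<^bsub>A\<^esub> = (\<lambda>M. \<zero>)" using normal_form_zero by auto
  show ?thesis using f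
  proof (induction f rule: free_algebra_induct)
    case zero
    then show ?case using g by (simp add: nf_zero convolve_zero)
  next
    case (add f f')
    then show ?case using g by (simp add: A.l_distr nf_add convolve_add_left)
  next
    case f: (monomial a u)
    show ?case using g
    proof (induction g rule: free_algebra_induct)
      case zero
      then show ?case using f by (simp add: nf_zero convolve_zero)
    next
      case (add g g')
      then show ?case using f by (simp add: A.r_distr nf_add convolve_add_right)
    next
      case g: (monomial b v)
      show ?case
      proof (cases "M = mset u + mset v")
        case True
        have conv: "convolve (normal_form (word_monomial R a u)) (normal_form (word_monomial R b v)) M =
            cocycle (mset u) (mset v) \<otimes> (normal_form (word_monomial R a u) (mset u) \<otimes> normal_form (word_monomial R b v) (mset v))"
          unfolding True by (rule convolve_unique) (use f g in \<open>auto simp: normal_form_monomial split: if_splits\<close>)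
        have "normal_form (word_monomial R a u \<otimes>\<^bsub>A\<^esub> word_monomial R b v) M =
            sorting_factor (u @ v) \<otimes> (a \<otimes> b)"
          using True f g by (simp add: word_monomial_mult normal_form_monomial)
        then show ?thesis unfolding conv using f g
          by (simp add: normal_form_monomial sorting_factor_append m_ac)
      next
        case False
        have "convolve (normal_form (word_monomial R a u)) (normal_form (word_monomial R b v)) M = \<zero>"
        proof (rule ccontr)
          assume "\<not> ?thesis"
          then obtain K L where "M = K + L" "normal_form (word_monomial R a u) K \<noteq> \<zero>"
              "normal_form (word_monomial R b v) L \<noteq> \<zero>"
            by (rule convolve_nonzeroE) (use f g in auto)
          then show False using f g False by (auto simp: normal_form_monomial split: if_splits)
        qed
        then show ?thesis using False f g
          by (simp only: word_monomial_mult) (simp add: normal_form_monomial[of "a \<otimes> b"])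
      qed
    qed
  qed
qed

text \<open>
  The polynomials with vanishing normal form are an ideal, by the product formula, and it contains the
  relators: \<open>X\<^sub>i X\<^sub>j\<close> is sorted and \<open>X\<^sub>j X\<^sub>i\<close> has sorting factor \<open>q\<^sub>j\<^sub>i\<close>. So ordered monomials are
  linearly independent in the quotient.
\<close>

lemma normal_form_ideal:
  assumes "f \<in> I"
  shows "normal_form f M = \<zero>"
proof -
  let ?J = "{f \<in> carrier A. normal_form f = (\<lambda>M. \<zero>)}"
  have neg: "normal_form (\<ominus>\<^bsub>A\<^esub> f) = (\<lambda>M. \<zero>)" if "f \<in> carrier A" "normal_form f = (\<lambda>M. \<zero>)" for f
    using normal_form_smult[of "\<ominus> \<one>" f] that by (auto simp: A.smult_neg_one)
  have "I \<subseteq> ?J"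
  proof (rule I_minimal)
    show "ideal ?J A"
    proof (rule idealI)
      show "ring A" by (rule A.ring_axioms)
      show "subgroup ?J (add_monoid A)"
      proof (rule A.add.subgroupI)
        have "\<zero>\<^bsub>A\<^esub> \<in> ?J" by (auto simp: normal_form_zero)
        then show "?J \<noteq> {}" by blast
      qed (auto simp: normal_form_add neg)
      show "g \<otimes>\<^bsub>A\<^esub> f \<in> ?J" "f \<otimes>\<^bsub>A\<^esub> g \<in> ?J" if "f \<in> ?J" "g \<in> carrier A" for f g
        using that by (auto simp: normal_form_mult convolve_zero)
    qed
    fix i j assume ij: "1 \<le> i" "i < j" "j \<le> n"
    have "sorting_factor [i, j] = \<one>" "sorting_factor [j, i] = q j i"
      using ij by (simp_all add: cocycle_single_left row_factor_single crossing_def)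
    then have "normal_form (relator i j) M = \<zero>" for M
      using ij q_cancel[of j i] A.smult_neg_one[of "word_monomial R (q i j) [j, i]"]
      by (simp add: relator_def a_minus_def normal_form_add normal_form_monomial normal_form_smult l_minus r_neg
          del: sorting_factor.simps flip: A.smult_neg_one)
    moreover have "relator i j \<in> carrier A"
      using ij by (intro subsetD[OF relators_subset]) (auto simp: relators_def)
    ultimately show "relator i j \<in> ?J" by auto
  qed
  with assms show ?thesis by (auto simp: fun_eq_iff)
qed

lemma normal_form_diff:
  assumes "f \<in> carrier A" "g \<in> carrier A"
  shows "normal_form (f \<ominus>\<^bsub>A\<^esub> g) M = normal_form f M \<ominus> normal_form g M"
  using assms normal_form_smult[of "\<ominus> \<one>" g M]
  by (simp add: a_minus_def normal_form_add A.smult_neg_one l_minus)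

lemma normal_form_cong:
  assumes "f \<in> carrier A" "g \<in> carrier A" "cls f = cls g"
  shows "normal_form f M = normal_form g M"
proof -
  have "f \<ominus>\<^bsub>A\<^esub> g \<in> I" using assms cls_eq_iff by blast
  then have "normal_form f M \<ominus> normal_form g M = \<zero>"
    using normal_form_ideal normal_form_diff[OF assms(1,2)] by metis
  moreover have "normal_form f M \<in> carrier R" "normal_form g M \<in> carrier R"
    using assms(1,2) by (simp_all only: normal_form_closed)
  ultimately show ?thesis
    using minus_equality[of "normal_form f M" "\<ominus> normal_form g M"] minus_minus
    by (metis a_inv_closed a_minus_def)
qed

text \<open>
  Applied to a normal form, this picks a representative of the class (see \<open>cls_standard_form\<close>).
\<close>

definition standard_form :: "(nat multiset \<Rightarrow> 'a) \<Rightarrow> nat list \<Rightarrow> 'a"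
  where "standard_form p w = (if sorted w then p (mset w) else \<zero>)"

text \<open>
  Sorting the words of a polynomial does not change its class, so the ordered monomials span the
  quotient and a class is determined by its normal form.
\<close>

lemma cls_standard_form:
  "f \<in> carrier A \<Longrightarrow> standard_form (normal_form f) \<in> carrier A \<and> cls (standard_form (normal_form f)) = cls f"
proof (induction f rule: free_algebra_induct)
  case zero
  have "standard_form (normal_form \<zero>\<^bsub>A\<^esub>) = \<zero>\<^bsub>A\<^esub>"
    by (rule ext) (simp add: standard_form_def normal_form_zero, simp add: free_algebra_simps)
  then show ?case by simp
next
  case (add f g)
  have "standard_form (normal_form (f \<oplus>\<^bsub>A\<^esub> g)) =
      standard_form (normal_form f) \<oplus>\<^bsub>A\<^esub> standard_form (normal_form g)"
    using add.hyps by (intro ext) (simp add: standard_form_def normal_form_add,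
        simp add: standard_form_def free_algebra_simps)
  with add show ?case by (simp flip: Q_add)
next
  case (monomial a w)
  have "standard_form (normal_form (word_monomial R a w)) =
      word_monomial R (sorting_factor w \<otimes> a) (sort w)"
  proof (rule ext)
    fix v
    have "sorted v \<and> mset v = mset w \<longleftrightarrow> v = sort w"
      by (metis mset_sort properties_for_sort sorted_sort)
    then show "standard_form (normal_form (word_monomial R a w)) v =
        word_monomial R (sorting_factor w \<otimes> a) (sort w) v"
      using monomial unfolding standard_form_def normal_form_monomial[OF monomial(1)] word_monomial_def[of R _ "sort w"]
      by auto
  qed
  moreover have "cls (word_monomial R a w) = (a \<otimes> sorting_factor w) \<odot>\<^bsub>Q\<^esub> word (sort w)"
    using monomial word_sort[of w] by (simp add: cls_monomial Q.smult_assoc1)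
  ultimately show ?case using monomial by (simp add: cls_monomial m_comm)
qed

definition coeff :: "(nat list \<Rightarrow> 'a) set \<Rightarrow> nat multiset \<Rightarrow> 'a"
  where "coeff C = normal_form (SOME f. f \<in> carrier A \<and> C = cls f)"

lemma coeff_cls: "f \<in> carrier A \<Longrightarrow> coeff (cls f) = normal_form f"
proof -
  assume f: "f \<in> carrier A"
  let ?g = "SOME g. g \<in> carrier A \<and> cls f = cls g"
  have "?g \<in> carrier A \<and> cls f = cls ?g"
    by (rule someI[of _ f]) (use f in simp)
  then have "normal_form ?g M = normal_form f M" for M
    using f normal_form_cong[of ?g f M] by metis
  then show ?thesis unfolding coeff_def by (rule ext)
qed

lemma coeff_closed [simp]: "C \<in> carrier Q \<Longrightarrow> coeff C M \<in> carrier R"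
  by (auto elim!: Q_cases simp: coeff_cls)

lemma coeff_zero: "coeff \<zero>\<^bsub>Q\<^esub> M = \<zero>"
  by (simp add: Q_zero coeff_cls normal_form_zero)

lemma coeff_add: "C \<in> carrier Q \<Longrightarrow> D \<in> carrier Q \<Longrightarrow> coeff (C \<oplus>\<^bsub>Q\<^esub> D) M = coeff C M \<oplus> coeff D M"
  by (auto elim!: Q_cases simp: coeff_cls Q_add normal_form_add)

lemma coeff_smult: "a \<in> carrier R \<Longrightarrow> C \<in> carrier Q \<Longrightarrow> coeff (a \<odot>\<^bsub>Q\<^esub> C) M = a \<otimes> coeff C M"
  by (auto elim!: Q_cases simp: coeff_cls Q_smult normal_form_smult)

lemma coeff_mult: "C \<in> carrier Q \<Longrightarrow> D \<in> carrier Q \<Longrightarrow> coeff (C \<otimes>\<^bsub>Q\<^esub> D) M = convolve (coeff C) (coeff D) M"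
  by (auto elim!: Q_cases simp: coeff_cls Q_mult normal_form_mult)

lemma coeff_word:
  "set w \<subseteq> {1..n} \<Longrightarrow> coeff (word w) M = (if M = mset w then sorting_factor w else \<zero>)"
  by (simp add: word_def coeff_cls normal_form_monomial)

lemma coeff_X: "i \<in> {1..n} \<Longrightarrow> coeff (X i) M = (if M = {#i#} then \<one> else \<zero>)"
  using coeff_word[of "[i]" M] by (simp add: X_eq_word)

lemma coeff_one: "coeff \<one>\<^bsub>Q\<^esub> M = (if M = {#} then \<one> else \<zero>)"
  using coeff_word[of "[]" M] by (simp add: word_Nil)

lemma coeff_inject:
  assumes "C \<in> carrier Q" "D \<in> carrier Q" "coeff C = coeff D"
  shows "C = D"
proof -
  obtain f g where f: "f \<in> carrier A" "C = cls f" and g: "g \<in> carrier A" "D = cls g"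
    using assms(1,2) by (auto elim!: Q_cases)
  have "normal_form f = normal_form g" using assms(3) f g by (simp add: coeff_cls)
  with cls_standard_form[OF f(1)] cls_standard_form[OF g(1)] f g show ?thesis by metis
qed

definition support :: "(nat list \<Rightarrow> 'a) set \<Rightarrow> nat multiset set"
  where "support C = {M. coeff C M \<noteq> \<zero>}"

lemma support_subset_finite:
  "C \<in> carrier Q \<Longrightarrow> finite (support C) \<and> (\<forall>M\<in>support C. set_mset M \<subseteq> {1..n})"
proof (induction C rule: quantum_induct_word)
  case zero
  then show ?case by (simp add: support_def coeff_zero)
next
  case (add C D)
  have "support (C \<oplus>\<^bsub>Q\<^esub> D) \<subseteq> support C \<union> support D"
    using add.hyps by (auto simp: support_def coeff_add)
  with add show ?case by (meson UnE finite_UnI finite_subset subsetD)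
next
  case (monomial a w)
  have sub: "support (a \<odot>\<^bsub>Q\<^esub> word w) \<subseteq> {mset w}"
    using monomial by (auto simp: support_def coeff_smult coeff_word split: if_splits)
  show ?case
    using finite_subset[OF sub] subsetD[OF sub] monomial(2) by fastforce
qed

lemma support_nonempty: "C \<in> carrier Q \<Longrightarrow> C \<noteq> \<zero>\<^bsub>Q\<^esub> \<Longrightarrow> support C \<noteq> {}"
  using coeff_inject[of C "\<zero>\<^bsub>Q\<^esub>"] by (auto simp: support_def coeff_zero fun_eq_iff)

end

section \<open>Multiplicative dependence of the entries\<close>

context quantum_space
begin

text \<open>
  The group generated by the entries of the minor in which row and column \<open>k\<close> are deleted.
\<close>

definition minor_group :: "nat \<Rightarrow> 'a set"
  where "minor_group k = generate (units_of R) {q i j | i j. i \<in> {1..n} - {k} \<and> j \<in> {1..n} - {k}}"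

definition dependent_at :: "nat \<Rightarrow> bool"
  where "dependent_at k \<longleftrightarrow> (\<forall>j\<in>{1..n}. \<exists>m>0. q k j [^] (m::nat) \<in> minor_group k)"

lemma minor_group_gen: "i \<in> {1..n} - {k} \<Longrightarrow> j \<in> {1..n} - {k} \<Longrightarrow> q i j \<in> minor_group k"
  unfolding minor_group_def by (rule generate.incl) blast

lemma minor_group_subgroup: "subgroup (minor_group k) (units_of R)"
  unfolding minor_group_def by (rule group.generate_is_subgroup[OF units_group]) (auto simp: units_of_carrier)

lemma minor_group_Units: "x \<in> minor_group k \<Longrightarrow> x \<in> Units R"
  using subgroup.subset[OF minor_group_subgroup] by (auto simp: units_of_carrier)

lemma minor_group_one: "\<one> \<in> minor_group k"
  using subgroup.one_closed[OF minor_group_subgroup] by (simp add: units_of_one)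

lemma minor_group_mult: "x \<in> minor_group k \<Longrightarrow> y \<in> minor_group k \<Longrightarrow> x \<otimes> y \<in> minor_group k"
  using subgroup.m_closed[OF minor_group_subgroup] by (simp add: units_of_mult)

lemma minor_group_inv: "x \<in> minor_group k \<Longrightarrow> inv x \<in> minor_group k"
  using subgroup.m_inv_closed[OF minor_group_subgroup] minor_group_Units[of x k]
  by (metis units_of_inv)

lemma minor_group_pow: "x \<in> minor_group k \<Longrightarrow> x [^] (m::nat) \<in> minor_group k"
  by (induction m) (auto simp: minor_group_one minor_group_mult)

lemma minor_group_finprod:
  "(\<And>i. i \<in> S \<Longrightarrow> f i \<in> minor_group k) \<Longrightarrow> finprod R f S \<in> minor_group k"
proof (induction S rule: infinite_finite_induct)
  case (insert i S)
  have "f \<in> S \<rightarrow> carrier R" "f i \<in> carrier R"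
    using insert.prems by (auto intro!: Units_closed minor_group_Units)
  then have "finprod R f (insert i S) = f i \<otimes> finprod R f S" using insert.hyps by simp
  then show ?case using insert by (simp add: minor_group_mult)
qed (auto simp: minor_group_one)

text \<open>
  Moving \<open>X\<^sub>j\<close> across the monomial with exponents \<open>M\<close> produces the scalar \<open>character M j\<close>
  (see \<open>cocycle_swap\<close>).
\<close>

definition character :: "nat multiset \<Rightarrow> nat \<Rightarrow> 'a"
  where "character M j = (\<Otimes>i\<in>{1..n}. q i j [^] count M i)"

lemma character_Units: "j \<in> {1..n} \<Longrightarrow> character M j \<in> Units R"
  unfolding character_def by (intro finprod_Units nat_pow_Units q_Units)

lemma character_split:
  assumes k: "k \<in> {1..n}" and j: "j \<in> {1..n}" "j \<noteq> k"
  obtains x where "x \<in> minor_group k" "character M j = q k j [^] count M k \<otimes> x"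
proof
  let ?x = "\<Otimes>i\<in>{1..n}-{k}. q i j [^] count M i"
  show "?x \<in> minor_group k"
    using j by (intro minor_group_finprod minor_group_pow minor_group_gen) auto
  have "character M j = (\<Otimes>i\<in>insert k ({1..n}-{k}). q i j [^] count M i)"
    unfolding character_def using k by (simp add: insert_absorb)
  also have "\<dots> = q k j [^] count M k \<otimes> ?x"
    using k j by (intro finprod_insert) auto
  finally show "character M j = q k j [^] count M k \<otimes> ?x" .
qed

text \<open>
  Cancelling the smaller power of \<open>q\<^sub>k\<^sub>j\<close> in \<open>character M j = character N j\<close> leaves a positive power of
  \<open>q\<^sub>k\<^sub>j\<close> on one side and entries that avoid \<open>k\<close> in all other factors. The factor \<open>q\<^sub>k\<^sub>k = 1\<close> is harmless.
\<close>

lemma dependent_at_less: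
  assumes k: "k \<in> {1..n}" and less: "count M k < count N k"
    and eq: "\<And>j. j \<in> {1..n} \<Longrightarrow> character M j = character N j"
  shows "dependent_at k"
  unfolding dependent_at_def
proof
  fix j assume j: "j \<in> {1..n}"
  show "\<exists>m>0. q k j [^] (m::nat) \<in> minor_group k"
  proof (cases "j = k")
    case True
    then show ?thesis using k q_diag minor_group_one by (intro exI[of _ 1]) auto
  next
    case False
    obtain x where x: "x \<in> minor_group k" "character M j = q k j [^] count M k \<otimes> x"
      using character_split[OF k j False] .
    obtain y where y: "y \<in> minor_group k" "character N j = q k j [^] count N k \<otimes> y"
      using character_split[OF k j False] .
    have [simp]: "x \<in> Units R" "y \<in> Units R" "x \<in> carrier R" "y \<in> carrier R" "q k j \<in> carrier R"
      using x y k j by (auto intro: minor_group_Units Units_closed)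
    let ?d = "count N k - count M k"
    have "q k j [^] count M k \<otimes> x = q k j [^] count M k \<otimes> (q k j [^] ?d \<otimes> y)"
      using eq[OF j] x y less by (simp add: m_assoc[symmetric] nat_pow_mult)
    moreover have "q k j [^] count M k \<in> Units R" using k j by (intro nat_pow_Units) simp
    moreover have "q k j [^] ?d \<otimes> y \<in> carrier R" by simp
    ultimately have "x = q k j [^] ?d \<otimes> y"
      using Units_l_cancel \<open>x \<in> carrier R\<close> by blast
    then have "x \<otimes> inv y = q k j [^] ?d \<otimes> y \<otimes> inv y" by (rule arg_cong)
    also have "\<dots> = q k j [^] ?d" by (simp add: m_assoc)
    finally have "q k j [^] ?d \<in> minor_group k"
      using x(1) y(1) by (metis minor_group_inv minor_group_mult)
    then show ?thesis using less by (intro exI[of _ ?d]) auto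
  qed
qed

lemma dependent_at_character_eq:
  assumes "set_mset M \<subseteq> {1..n}" "set_mset N \<subseteq> {1..n}" "M \<noteq> N"
    and eq: "\<And>j. j \<in> {1..n} \<Longrightarrow> character M j = character N j"
  obtains k where "k \<in> {1..n}" "dependent_at k"
proof -
  obtain k where ne: "count M k \<noteq> count N k" using assms(3) by (auto simp: multiset_eq_iff)
  then have "k \<in># M \<or> k \<in># N" by (metis not_in_iff)
  then have k: "k \<in> {1..n}" using assms(1,2) by blast
  from ne consider "count M k < count N k" | "count N k < count M k" by linarith
  then have "dependent_at k"
    using dependent_at_less[OF k, of M N] dependent_at_less[OF k, of N M] eq by cases auto
  with k show ?thesis by (rule that)
qed

text \<open>
  The entry \<open>q\<^sub>k\<^sub>j\<close> equals the entry at \<open>(\<tau> k, \<tau> j)\<close>, which avoids \<open>k\<close> unless \<open>\<tau> j = k\<close>. In that case put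
  \<open>l = \<tau> k\<close>. If \<open>l = j\<close> then \<open>q\<^sub>k\<^sub>j = q\<^sub>j\<^sub>k\<close> and the square is \<open>1\<close>. Otherwise \<open>q\<^sub>k\<^sub>j = q\<^sub>l\<^sub>k\<close> is the
  inverse of \<open>q\<^sub>k\<^sub>l\<close>, which equals the entry at \<open>(l, \<tau> l)\<close>, and \<open>\<tau> l \<noteq> k\<close> by injectivity.
\<close>

lemma dependent_at_permutation:
  assumes \<tau>: "\<And>i. i \<in> {1..n} \<Longrightarrow> \<tau> i \<in> {1..n}" "inj_on \<tau> {1..n}"
    and eq: "\<And>i j. i \<in> {1..n} \<Longrightarrow> j \<in> {1..n} \<Longrightarrow> q (\<tau> i) (\<tau> j) = q i j"
    and k: "k \<in> {1..n}" "\<tau> k \<noteq> k"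
  shows "dependent_at k"
  unfolding dependent_at_def
proof
  fix j assume j: "j \<in> {1..n}"
  show "\<exists>m>0. q k j [^] (m::nat) \<in> minor_group k"
  proof (cases "\<tau> j = k")
    case False
    then have "q (\<tau> k) (\<tau> j) \<in> minor_group k"
      using j k \<tau> by (intro minor_group_gen) auto
    then have "q k j [^] (1::nat) \<in> minor_group k"
      using eq[OF k(1) j] j k by simp
    then show ?thesis by (intro exI[of _ 1]) auto
  next
    case True
    then have jk: "j \<noteq> k" using k by auto
    have lk: "q k j = q (\<tau> k) k" using eq[OF k(1) j] True by simp
    show ?thesis
    proof (cases "\<tau> k = j")
      case True
      then have "q k j [^] (2::nat) = \<one>"
        using lk j k q_cancel[of k j] by (simp add: numeral_2_eq_2)
      then show ?thesis using minor_group_one by (intro exI[of _ 2]) auto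
    next
      case False
      have "\<tau> (\<tau> k) \<noteq> k"
        using inj_onD[OF \<tau>(2), of "\<tau> k" j] True False \<tau>(1) k j by auto
      then have "q (\<tau> k) (\<tau> (\<tau> k)) \<in> minor_group k"
        using \<tau>(1) k by (intro minor_group_gen) auto
      then have "inv (q k (\<tau> k)) \<in> minor_group k"
        using eq[of k "\<tau> k"] \<tau>(1) k by (intro minor_group_inv) auto
      then have "q k j \<in> minor_group k"
        using lk q_inv[of k "\<tau> k"] \<tau>(1) k by simp
      then show ?thesis using j k by (intro exI[of _ 1]) auto
    qed
  qed
qed

section \<open>Normal elements\<close>

lemma cocycle_swap:
  assumes j: "j \<in> {1..n}"
  shows "cocycle M {#j#} = character M j \<otimes> cocycle {#j#} M"
proof -
  have "crossing i j = q i j \<otimes> crossing j i" if "i \<in> {1..n}" for i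
    using that j q_cancel[of i j] q_diag[of i]
    by (cases i j rule: linorder_cases) (auto simp: crossing_def)
  then have "cocycle M {#j#} = (\<Otimes>i\<in>{1..n}. (q i j \<otimes> crossing j i) [^] count M i)"
    unfolding cocycle_def using j
    by (intro finprod_cong') (auto simp: row_factor_single Units_closed simp del: nat_pow_distrib)
  also have "\<dots> = (\<Otimes>i\<in>{1..n}. q i j [^] count M i \<otimes> crossing j i [^] count M i)"
    using j by (intro finprod_cong') (auto simp: nat_pow_distrib Units_closed)
  also have "\<dots> = character M j \<otimes> cocycle {#j#} M"
    using j unfolding character_def cocycle_single_left[OF j] row_factor_def
    by (intro finprod_multf) (auto simp: Units_closed)
  finally show ?thesis .
qed

lemma coeff_mult_X:
  assumes C: "C \<in> carrier Q" and j: "j \<in> {1..n}"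
  shows "coeff (C \<otimes>\<^bsub>Q\<^esub> X j) (M + {#j#}) = cocycle M {#j#} \<otimes> coeff C M"
proof -
  have "convolve (coeff C) (coeff (X j)) (M + {#j#}) = cocycle M {#j#} \<otimes> (coeff C M \<otimes> coeff (X j) {#j#})"
    by (rule convolve_unique) (use assms in \<open>auto simp: coeff_X split: if_splits\<close>)
  then show ?thesis using assms by (simp add: coeff_mult coeff_X)
qed

lemma support_mult_X:
  assumes C: "C \<in> carrier Q" and j: "j \<in> {1..n}" and "M \<in> support (C \<otimes>\<^bsub>Q\<^esub> X j)"
  obtains K where "K \<in> support C" "M = K + {#j#}"
proof -
  have "convolve (coeff C) (coeff (X j)) M \<noteq> \<zero>"
    using assms by (simp add: support_def coeff_mult)
  then obtain K L where "M = K + L" "coeff C K \<noteq> \<zero>" "coeff (X j) L \<noteq> \<zero>"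
    by (rule convolve_nonzeroE) (use C j in auto)
  with j show ?thesis by (intro that[of K]) (auto simp: coeff_X support_def split: if_splits)
qed

lemma Units_mult_nonzero: "x \<in> Units R \<Longrightarrow> y \<in> carrier R \<Longrightarrow> y \<noteq> \<zero> \<Longrightarrow> x \<otimes> y \<noteq> \<zero>"
  using integral_iff field_Units by (auto simp: Units_closed)

text \<open>
  The linear order on multisets is compatible with addition, so the largest monomial of \<open>f u\<close> is the
  product of the largest ones of \<open>f\<close> and \<open>u\<close>, while every monomial of \<open>u X\<^sub>j\<close> is at most the largest one
  of \<open>u\<close> times \<open>X\<^sub>j\<close>. Hence all monomials of \<open>f\<close> are at most \<open>X\<^sub>j\<close>, and by the same argument for smallest
  monomials they are at least \<open>X\<^sub>j\<close>.
\<close>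

lemma normal_twist_monomial:
  assumes u: "u \<in> carrier Q" "u \<noteq> \<zero>\<^bsub>Q\<^esub>" and f: "f \<in> carrier Q" and j: "j \<in> {1..n}"
    and eq: "u \<otimes>\<^bsub>Q\<^esub> X j = f \<otimes>\<^bsub>Q\<^esub> u"
  shows "support f \<subseteq> {{#j#}}"
proof -
  have fin: "finite (support u)" "finite (support f)" "support u \<noteq> {}"
    using u f support_subset_finite support_nonempty by auto
  \<comment> \<open>If \<open>L = b\<close>, \<open>K = a\<close> is the only way to obtain the product of these two monomials, it survives in \<open>f u\<close>.\<close>
  have extremal: "\<exists>K\<in>support u. a + b = K + {#j#}"
    if a: "a \<in> support u" and b: "b \<in> support f"
      and ord: "\<And>K L. \<lbrakk>K \<in> support u; L \<in> support f; L + K = b + a\<rbrakk> \<Longrightarrow> L = b" for a b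
  proof -
    have "convolve (coeff f) (coeff u) (b + a) = cocycle b a \<otimes> (coeff f b \<otimes> coeff u a)"
      by (rule convolve_unique) (use ord u f in \<open>auto simp: support_def\<close>)
    also have "\<dots> \<noteq> \<zero>"
      using a b u f by (intro Units_mult_nonzero[OF cocycle_Units]) (auto simp: support_def integral_iff)
    finally have "b + a \<in> support (u \<otimes>\<^bsub>Q\<^esub> X j)"
      using eq u f by (simp add: support_def coeff_mult)
    then obtain K where "K \<in> support u" "b + a = K + {#j#}"
      by (rule support_mult_X[OF u(1) j])
    then show ?thesis by (intro bexI[of _ K]) (simp_all add: add.commute)
  qed
  show ?thesis
  proof
    fix L assume L: "L \<in> support f"
    then have ne: "support f \<noteq> {}" by auto
    define a b a' b' where "a = Max (support u)" and "b = Max (support f)"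
      and "a' = Min (support u)" and "b' = Min (support f)"
    have mem: "a \<in> support u" "b \<in> support f" "a' \<in> support u" "b' \<in> support f"
      using fin ne by (simp_all add: a_def b_def a'_def b'_def)
    have le: "K \<le> a" "a' \<le> K" if "K \<in> support u" for K
      using fin that by (simp_all add: a_def a'_def)
    have le': "K \<le> b" "b' \<le> K" if "K \<in> support f" for K
      using fin that by (simp_all add: b_def b'_def)
    have "\<exists>K\<in>support u. a + b = K + {#j#}"
    proof (rule extremal[OF mem(1,2)])
      fix K L assume KL: "K \<in> support u" "L \<in> support f" "L + K = b + a"
      show "L = b"
      proof (rule ccontr)
        assume "L \<noteq> b"
        then have "L < b" by (rule le_neq_trans[OF le'(1)[OF KL(2)]])
        then have "L + K < b + a" using le(1)[OF KL(1)] by (rule add_less_le_mono)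
        with KL(3) show False by (simp only: less_irrefl)
      qed
    qed
    then obtain K where K: "K \<in> support u" "a + b = K + {#j#}" by blast
    then have "a + b \<le> a + {#j#}" using le(1)[OF K(1)] by simp
    then have upper: "b \<le> {#j#}" by (simp only: add_le_cancel_left)
    have "\<exists>K\<in>support u. a' + b' = K + {#j#}"
    proof (rule extremal[OF mem(3,4)])
      fix K L assume KL: "K \<in> support u" "L \<in> support f" "L + K = b' + a'"
      show "L = b'"
      proof (rule ccontr)
        assume "L \<noteq> b'"
        then have "b' < L" by (rule le_neq_trans[OF le'(2)[OF KL(2)] not_sym])
        then have "b' + a' < L + K" using le(2)[OF KL(1)] by (rule add_less_le_mono)
        with KL(3) show False by (simp only: less_irrefl)
      qed
    qed
    then obtain K where K: "K \<in> support u" "a' + b' = K + {#j#}" by blast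
    then have "a' + {#j#} \<le> a' + b'" using le(2)[OF K(1)] by simp
    then have "{#j#} \<le> b'" by (simp only: add_le_cancel_left)
    with upper le'[OF L] show "L \<in> {{#j#}}" by (metis order.trans order.antisym singletonI)
  qed
qed

text \<open>
  Once \<open>f\<close> is a multiple of \<open>X\<^sub>j\<close>, comparing coefficients in \<open>u X\<^sub>j = f u\<close> shows that all monomials of
  \<open>u\<close> have the same character, and two distinct monomials with the same character force a dependence.
\<close>

lemma normal_support_single:
  assumes u: "u \<in> carrier Q" "u \<noteq> \<zero>\<^bsub>Q\<^esub>"
    and twist: "\<And>j. j \<in> {1..n} \<Longrightarrow> \<exists>f\<in>carrier Q. u \<otimes>\<^bsub>Q\<^esub> X j = f \<otimes>\<^bsub>Q\<^esub> u"
    and indep: "\<And>k. k \<in> {1..n} \<Longrightarrow> \<not> dependent_at k"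
  obtains M where "support u = {M}"
proof -
  have char: "\<exists>c. \<forall>M\<in>support u. character M j = c" if j: "j \<in> {1..n}" for j
  proof -
    obtain f where f: "f \<in> carrier Q" and eq: "u \<otimes>\<^bsub>Q\<^esub> X j = f \<otimes>\<^bsub>Q\<^esub> u"
      using twist[OF j] by blast
    have sub: "support f \<subseteq> {{#j#}}" by (rule normal_twist_monomial[OF u f j eq])
    have "character M j = coeff f {#j#}" if M: "M \<in> support u" for M
    proof -
      have "convolve (coeff f) (coeff u) ({#j#} + M) = cocycle {#j#} M \<otimes> (coeff f {#j#} \<otimes> coeff u M)"
        by (rule convolve_unique) (use u f sub in \<open>auto simp: support_def\<close>)
      then have "cocycle M {#j#} \<otimes> coeff u M = cocycle {#j#} M \<otimes> (coeff f {#j#} \<otimes> coeff u M)"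
        using coeff_mult_X[OF u(1) j, of M] eq u f by (simp add: coeff_mult add.commute)
      then have "cocycle {#j#} M \<otimes> (character M j \<otimes> coeff u M) = cocycle {#j#} M \<otimes> (coeff f {#j#} \<otimes> coeff u M)"
        using u f j character_Units[OF j, of M] by (simp add: cocycle_swap m_ac Units_closed)
      then have "character M j \<otimes> coeff u M = coeff f {#j#} \<otimes> coeff u M"
        using u f j character_Units[OF j, of M] by (simp add: Units_closed)
      then show ?thesis
        using M u f character_Units[OF j, of M] m_rcancel[of "coeff u M" "character M j" "coeff f {#j#}"]
        by (simp add: support_def Units_closed)
    qed
    then show ?thesis by blast
  qed
  obtain M where M: "M \<in> support u" using support_nonempty[OF u] by blast
  have "N = M" if N: "N \<in> support u" for N
  proof (rule ccontr)
    assume "N \<noteq> M"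
    moreover have "character N j = character M j" if "j \<in> {1..n}" for j
      using char[OF that] M N by metis
    ultimately obtain k where "k \<in> {1..n}" "dependent_at k"
      using dependent_at_character_eq[of N M] support_subset_finite[OF u(1)] M N by metis
    with indep show False by blast
  qed
  with M show ?thesis by (intro that[of M]) blast
qed

section \<open>Automorphisms permute the variables up to scalars\<close>

text \<open>
  Nonzero scalar multiples of the ordered monomial \<open>M\<close>, recognised by their support.
\<close>

definition is_term :: "nat multiset \<Rightarrow> (nat list \<Rightarrow> 'a) set \<Rightarrow> bool"
  where "is_term M C \<longleftrightarrow> C \<in> carrier Q \<and> support C = {M}"

lemma is_term_unique: "is_term M C \<Longrightarrow> is_term N C \<Longrightarrow> M = N"
  by (auto simp: is_term_def)

lemma is_term_one: "is_term {#} \<one>\<^bsub>Q\<^esub>"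
  by (auto simp: is_term_def support_def coeff_one)

lemma is_term_X: "i \<in> {1..n} \<Longrightarrow> is_term {#i#} (X i)"
  by (auto simp: is_term_def support_def coeff_X)

lemma is_term_smult: "a \<in> carrier R \<Longrightarrow> a \<noteq> \<zero> \<Longrightarrow> is_term M C \<Longrightarrow> is_term M (a \<odot>\<^bsub>Q\<^esub> C)"
  by (auto simp: is_term_def support_def coeff_smult integral_iff)

lemma is_term_mult:
  assumes C: "is_term M C" and D: "is_term N D"
  shows "is_term (M + N) (C \<otimes>\<^bsub>Q\<^esub> D)"
proof -
  have c: "C \<in> carrier Q" "D \<in> carrier Q" using assms by (auto simp: is_term_def)
  have supp: "coeff C K \<noteq> \<zero> \<longleftrightarrow> K = M" "coeff D K \<noteq> \<zero> \<longleftrightarrow> K = N" for K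
    using assms by (auto simp: is_term_def support_def)
  have "convolve (coeff C) (coeff D) (M + N) = cocycle M N \<otimes> (coeff C M \<otimes> coeff D N)"
    by (rule convolve_unique) (use c supp in auto)
  also have "\<dots> \<noteq> \<zero>"
    using c supp by (intro Units_mult_nonzero[OF cocycle_Units]) (auto simp: integral_iff)
  finally have "M + N \<in> support (C \<otimes>\<^bsub>Q\<^esub> D)" using c by (simp add: support_def coeff_mult)
  moreover have "K = M + N" if "K \<in> support (C \<otimes>\<^bsub>Q\<^esub> D)" for K
  proof -
    have "convolve (coeff C) (coeff D) K \<noteq> \<zero>" using that c by (simp add: support_def coeff_mult)
    then obtain M' N' where "K = M' + N'" "coeff C M' \<noteq> \<zero>" "coeff D N' \<noteq> \<zero>"
      by (rule convolve_nonzeroE) (use c in auto)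
    then show ?thesis using supp by simp
  qed
  ultimately have "support (C \<otimes>\<^bsub>Q\<^esub> D) = {M + N}" by blast
  with c show ?thesis by (simp add: is_term_def)
qed

lemma is_termE:
  assumes "is_term M C"
  obtains a where "a \<in> carrier R" "a \<noteq> \<zero>" "set (sorted_list_of_multiset M) \<subseteq> {1..n}"
    "C = a \<odot>\<^bsub>Q\<^esub> word (sorted_list_of_multiset M)"
proof -
  let ?w = "sorted_list_of_multiset M"
  have C: "C \<in> carrier Q" and supp: "support C = {M}" using assms by (auto simp: is_term_def)
  have w: "set ?w \<subseteq> {1..n}" using support_subset_finite[OF C] supp by simp
  let ?a = "coeff C M \<otimes> inv (sorting_factor ?w)"
  have u: "sorting_factor ?w \<in> Units R" by simp
  then have i: "inv (sorting_factor ?w) \<in> carrier R" "inv (sorting_factor ?w) \<otimes> sorting_factor ?w = \<one>"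
    by (auto simp: Units_closed)
  have a: "?a \<in> carrier R" using i C by simp
  have eq: "?a \<otimes> sorting_factor ?w = coeff C M" using i C by (simp add: m_assoc)
  have "C = ?a \<odot>\<^bsub>Q\<^esub> word ?w"
  proof (rule coeff_inject[OF C])
    show "?a \<odot>\<^bsub>Q\<^esub> word ?w \<in> carrier Q" using a w by simp
    have "coeff C N = coeff (?a \<odot>\<^bsub>Q\<^esub> word ?w) N" for N
    proof (cases "N = M")
      case True
      then show ?thesis using eq by (simp add: coeff_smult[OF a word_closed[OF w]] coeff_word[OF w])
    next
      case False
      then have "coeff C N = \<zero>" using supp by (auto simp: support_def)
      then show ?thesis using False a by (simp add: coeff_smult[OF a word_closed[OF w]] coeff_word[OF w])
    qed
    then show "coeff C = coeff (?a \<odot>\<^bsub>Q\<^esub> word ?w)" by (rule ext)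
  qed
  moreover have "?a \<noteq> \<zero>" using eq supp by (auto simp: support_def)
  ultimately show ?thesis using that a w by blast
qed

lemma is_term_hom:
  assumes h: "h \<in> algebra_hom R Q Q"
    and M: "\<And>i. i \<in> {1..n} \<Longrightarrow> is_term (M i) (h (X i))"
    and C: "is_term N C"
  shows "is_term (\<Sum>i\<in>#N. M i) (h C)"
proof -
  have word: "is_term (\<Sum>i\<in>#mset w. M i) (h (word w))" if "set w \<subseteq> {1..n}" for w
    using that
  proof (induction w)
    case Nil
    then show ?case by (simp add: word_Nil algebra_homD[OF h] is_term_one)
  next
    case (Cons i w)
    then show ?case
      using is_term_mult[OF M[of i], of "\<Sum>i\<in>#mset w. M i" "h (word w)"]
      by (simp add: word_Cons algebra_homD[OF h])
  qed
  obtain a where a: "a \<in> carrier R" "a \<noteq> \<zero>" "set (sorted_list_of_multiset N) \<subseteq> {1..n}"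
    "C = a \<odot>\<^bsub>Q\<^esub> word (sorted_list_of_multiset N)"
    using is_termE[OF C] .
  then have "h C = a \<odot>\<^bsub>Q\<^esub> h (word (sorted_list_of_multiset N))"
    by (simp add: algebra_homD(5)[OF h])
  with word[OF a(3)] a show ?thesis by (simp add: is_term_smult)
qed

text \<open>
  The elements \<open>y\<close> that can be moved across \<open>X\<^sub>i\<close> form a subalgebra, and it contains the variables.
\<close>

lemma X_twist:
  assumes i: "i \<in> {1..n}" and y: "y \<in> carrier Q"
  shows "\<exists>y'\<in>carrier Q. X i \<otimes>\<^bsub>Q\<^esub> y = y' \<otimes>\<^bsub>Q\<^esub> X i"
  using y
proof (induction y rule: quantum_induct)
  case one
  then show ?case using i by (intro bexI[of _ "\<one>\<^bsub>Q\<^esub>"]) auto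
next
  case (var j)
  then show ?case using i X_relation[of i j]
    by (intro bexI[of _ "q i j \<odot>\<^bsub>Q\<^esub> X j"]) (auto simp: Q.smult_mult_left)
next
  case (add C D)
  then obtain C' D' where "C' \<in> carrier Q" "D' \<in> carrier Q"
    "X i \<otimes>\<^bsub>Q\<^esub> C = C' \<otimes>\<^bsub>Q\<^esub> X i" "X i \<otimes>\<^bsub>Q\<^esub> D = D' \<otimes>\<^bsub>Q\<^esub> X i" by blast
  then show ?case using add.hyps i
    by (intro bexI[of _ "C' \<oplus>\<^bsub>Q\<^esub> D'"]) (auto simp: Q.l_distr Q.r_distr)
next
  case (mult C D)
  then obtain C' D' where c: "C' \<in> carrier Q" "D' \<in> carrier Q"
    and e: "X i \<otimes>\<^bsub>Q\<^esub> C = C' \<otimes>\<^bsub>Q\<^esub> X i" "X i \<otimes>\<^bsub>Q\<^esub> D = D' \<otimes>\<^bsub>Q\<^esub> X i" by blast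
  have "X i \<otimes>\<^bsub>Q\<^esub> (C \<otimes>\<^bsub>Q\<^esub> D) = C' \<otimes>\<^bsub>Q\<^esub> X i \<otimes>\<^bsub>Q\<^esub> D"
    using mult.hyps i e(1) by (simp flip: Q.m_assoc)
  also have "\<dots> = C' \<otimes>\<^bsub>Q\<^esub> D' \<otimes>\<^bsub>Q\<^esub> X i"
    using mult.hyps i c e(2) by (simp add: Q.m_assoc)
  finally show ?case using c by (intro bexI[of _ "C' \<otimes>\<^bsub>Q\<^esub> D'"]) auto
next
  case (smult a C)
  then obtain C' where "C' \<in> carrier Q" "X i \<otimes>\<^bsub>Q\<^esub> C = C' \<otimes>\<^bsub>Q\<^esub> X i" by blast
  then show ?case using smult.hyps i
    by (intro bexI[of _ "a \<odot>\<^bsub>Q\<^esub> C'"]) (auto simp: Q.smult_mult_left Q.smult_mult_right)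
qed

text \<open>
  Since every \<open>X\<^sub>j\<close> is of the form \<open>h y\<close>, moving \<open>y\<close> across \<open>X\<^sub>i\<close> and applying \<open>h\<close> shows that
  \<open>X\<^sub>j\<close> can be moved across \<open>h (X\<^sub>i)\<close>.
\<close>

lemma automorphism_X_term:
  assumes h: "h \<in> algebra_auto R Q" and i: "i \<in> {1..n}"
    and indep: "\<And>k. k \<in> {1..n} \<Longrightarrow> \<not> dependent_at k"
  shows "\<exists>M. is_term M (h (X i))"
proof -
  have hom: "h \<in> algebra_hom R Q Q" and bij: "bij_betw h (carrier Q) (carrier Q)"
    using h by (auto simp: algebra_auto_eq Bij_def)
  have hX: "h (X i) \<in> carrier Q" using i by (simp add: algebra_homD(1)[OF hom])
  have "X i \<noteq> \<zero>\<^bsub>Q\<^esub>"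
    using i is_term_X[OF i] by (auto simp: is_term_def support_def coeff_zero)
  then have ne: "h (X i) \<noteq> \<zero>\<^bsub>Q\<^esub>"
    using Q.algebra_hom_zero[OF hom Q.abelian_group_axioms] bij i
    by (metis Q.zero_closed X_closed bij_betw_inv_into_left)
  have "\<exists>f\<in>carrier Q. h (X i) \<otimes>\<^bsub>Q\<^esub> X j = f \<otimes>\<^bsub>Q\<^esub> h (X i)" if j: "j \<in> {1..n}" for j
  proof -
    have "X j \<in> h ` carrier Q" using bij j by (simp add: bij_betw_def)
    then obtain y where y: "y \<in> carrier Q" "X j = h y" by blast
    obtain y' where y': "y' \<in> carrier Q" "X i \<otimes>\<^bsub>Q\<^esub> y = y' \<otimes>\<^bsub>Q\<^esub> X i"
      using X_twist[OF i y(1)] by blast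
    have "h (X i) \<otimes>\<^bsub>Q\<^esub> X j = h (X i \<otimes>\<^bsub>Q\<^esub> y)"
      using y i by (simp add: algebra_homD(3)[OF hom])
    also have "\<dots> = h y' \<otimes>\<^bsub>Q\<^esub> h (X i)"
      using y' i by (simp add: algebra_homD(3)[OF hom])
    finally show ?thesis using y' algebra_homD(1)[OF hom] by blast
  qed
  then obtain M where "support (h (X i)) = {M}"
    using normal_support_single[OF hX ne _ indep] by blast
  with hX show ?thesis by (auto simp: is_term_def)
qed

lemma sum_mset_singleton:
  fixes M :: "nat \<Rightarrow> nat multiset"
  assumes "(\<Sum>i\<in>#N. M i) = {#j#}" "\<And>i. i \<in># N \<Longrightarrow> M i \<noteq> {#}"
  shows "\<exists>i. N = {#i#} \<and> M i = {#j#}"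
proof -
  obtain i N' where N: "N = add_mset i N'" using assms(1) by (cases N) auto
  then have eq: "M i + (\<Sum>i\<in>#N'. M i) = {#j#}" using assms(1) by simp
  then have Mi: "M i = {#j#}" "(\<Sum>i\<in>#N'. M i) = {#}"
    using assms(2)[of i] N by (auto simp: union_is_single)
  have "N' = {#}"
  proof (rule ccontr)
    assume "N' \<noteq> {#}"
    then obtain l where "l \<in># N'" by (meson multiset_nonemptyE)
    with Mi(2) assms(2)[of l] N show False by auto
  qed
  with N Mi show ?thesis by simp
qed

text \<open>
  Both \<open>h\<close> and its inverse \<open>g\<close> map monomials to monomials, up to scalars: say \<open>X\<^sub>i\<close> to exponents \<open>M i\<close>
  and \<open>N i\<close>. No \<open>M i\<close> is empty, because \<open>g\<close> fixes scalars. As \<open>h (g (X\<^sub>j)) = X\<^sub>j\<close>, the multisets \<open>M i\<close> with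
  \<open>i\<close> in \<open>N j\<close> add up to \<open>{#j#}\<close>, so \<open>N j\<close> has a single element \<open>\<tau> j\<close>. Applying \<open>h\<close> to the
  commutation relations shows that the permutation \<open>\<tau>\<close> preserves the matrix.
\<close>

lemma automorphism_scalar:
  assumes h: "h \<in> algebra_auto R Q" and indep: "\<And>k. k \<in> {1..n} \<Longrightarrow> \<not> dependent_at k"
    and j: "j \<in> {1..n}"
  shows "is_term {#j#} (h (X j))"
proof -
  let ?g = "restrict (inv_into (carrier Q) h) (carrier Q)"
  have g: "?g \<in> algebra_auto R Q" using h by (rule Q.inverse_algebra_auto)
  have hom: "h \<in> algebra_hom R Q Q" "?g \<in> algebra_hom R Q Q"
    and bij: "bij_betw h (carrier Q) (carrier Q)"
    using h g by (auto simp: algebra_auto_eq Bij_def)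
  have hg: "h (?g C) = C" if "C \<in> carrier Q" for C
    using that bij bij_betw_inv_into_right by fastforce
  have gh: "?g (h C) = C" if "C \<in> carrier Q" for C
    using that bij bij_betw_inv_into_left algebra_homD(1)[OF hom(1)] by fastforce
  obtain M where M: "is_term (M i) (h (X i))" if "i \<in> {1..n}" for i
    using automorphism_X_term[OF h _ indep] by metis
  obtain N where N: "is_term (N i) (?g (X i))" if "i \<in> {1..n}" for i
    using automorphism_X_term[OF g _ indep] by metis
  have nonempty: "M i \<noteq> {#}" if i: "i \<in> {1..n}" for i
  proof
    assume "M i = {#}"
    then have "is_term (\<Sum>i\<in>#{#}. N i) (?g (h (X i)))"
      using is_term_hom[OF hom(2) N, of "{#}" "h (X i)"] M[OF i] by simp
    then have "is_term {#} (X i)" using gh i by simp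
    from is_term_unique[OF is_term_X[OF i] this] show False by simp
  qed
  have ex: "\<exists>i\<in>{1..n}. M i = {#j#}" if j: "j \<in> {1..n}" for j
  proof -
    have "is_term (\<Sum>i\<in>#N j. M i) (h (?g (X j)))"
      using is_term_hom[OF hom(1) M N[OF j]] .
    then have sum: "(\<Sum>i\<in>#N j. M i) = {#j#}"
      using hg[of "X j"] j is_term_X[OF j] is_term_unique by simp
    have sub: "set_mset (N j) \<subseteq> {1..n}"
      using N[OF j] support_subset_finite unfolding is_term_def by fastforce
    obtain i where "N j = {#i#}" "M i = {#j#}"
      using sum_mset_singleton[OF sum] nonempty sub by blast
    with sub show ?thesis by auto
  qed
  then obtain \<tau> where \<tau>: "\<And>j. j \<in> {1..n} \<Longrightarrow> \<tau> j \<in> {1..n} \<and> M (\<tau> j) = {#j#}" by metis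
  have inj: "inj_on \<tau> {1..n}"
    by (rule inj_onI) (metis \<tau> add_mset_eq_single)
  have htau: "is_term {#j#} (h (X (\<tau> j)))" if "j \<in> {1..n}" for j
    using M[of "\<tau> j"] \<tau>[OF that] by simp
  have scal: "\<exists>a\<in>carrier R. a \<noteq> \<zero> \<and> h (X (\<tau> j)) = a \<odot>\<^bsub>Q\<^esub> X j" if "j \<in> {1..n}" for j
    using is_termE[OF htau[OF that]] by (metis X_eq_word sorted_list_of_multiset_singleton)
  \<comment> \<open>Apply \<open>h\<close> to a commutation relation and compare the coefficients of \<open>X\<^sub>j X\<^sub>i\<close>.\<close>
  have rel: "q (\<tau> i) (\<tau> j) = q i j" if i: "i \<in> {1..n}" and j: "j \<in> {1..n}" for i j
  proof -
    obtain a b where a: "a \<in> carrier R" "a \<noteq> \<zero>" "h (X (\<tau> i)) = a \<odot>\<^bsub>Q\<^esub> X i"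
      and b: "b \<in> carrier R" "b \<noteq> \<zero>" "h (X (\<tau> j)) = b \<odot>\<^bsub>Q\<^esub> X j"
      using scal[OF i] scal[OF j] by blast
    let ?q = "q (\<tau> i) (\<tau> j)"
    have qc: "?q \<in> carrier R" using \<tau> i j by simp
    have XX: "X j \<otimes>\<^bsub>Q\<^esub> X i \<in> carrier Q" using i j by simp
    have "h (X (\<tau> i) \<otimes>\<^bsub>Q\<^esub> X (\<tau> j)) = ?q \<odot>\<^bsub>Q\<^esub> h (X (\<tau> j) \<otimes>\<^bsub>Q\<^esub> X (\<tau> i))"
      using X_relation[of "\<tau> i" "\<tau> j"] \<tau> i j qc by (simp add: algebra_homD(5)[OF hom(1)])
    then have "(a \<odot>\<^bsub>Q\<^esub> X i) \<otimes>\<^bsub>Q\<^esub> (b \<odot>\<^bsub>Q\<^esub> X j) = ?q \<odot>\<^bsub>Q\<^esub> ((b \<odot>\<^bsub>Q\<^esub> X j) \<otimes>\<^bsub>Q\<^esub> (a \<odot>\<^bsub>Q\<^esub> X i))"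
      using \<tau> i j a b by (simp add: algebra_homD(3)[OF hom(1)])
    moreover have "(a \<odot>\<^bsub>Q\<^esub> X i) \<otimes>\<^bsub>Q\<^esub> (b \<odot>\<^bsub>Q\<^esub> X j) = (b \<otimes> a) \<odot>\<^bsub>Q\<^esub> (q i j \<odot>\<^bsub>Q\<^esub> (X j \<otimes>\<^bsub>Q\<^esub> X i))"
      using X_relation[OF i j] i j a b by (simp add: Q.smult_mult_left Q.smult_mult_right Q.smult_assoc1)
    moreover have "(b \<odot>\<^bsub>Q\<^esub> X j) \<otimes>\<^bsub>Q\<^esub> (a \<odot>\<^bsub>Q\<^esub> X i) = (a \<otimes> b) \<odot>\<^bsub>Q\<^esub> (X j \<otimes>\<^bsub>Q\<^esub> X i)"
      using i j a b by (simp add: Q.smult_mult_left Q.smult_mult_right Q.smult_assoc1)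
    ultimately have "((a \<otimes> b) \<otimes> q i j) \<odot>\<^bsub>Q\<^esub> (X j \<otimes>\<^bsub>Q\<^esub> X i) = ((a \<otimes> b) \<otimes> ?q) \<odot>\<^bsub>Q\<^esub> (X j \<otimes>\<^bsub>Q\<^esub> X i)"
      using i j a b qc XX by (simp add: Q.smult_assoc1[symmetric] m_ac)
    then have "coeff (((a \<otimes> b) \<otimes> q i j) \<odot>\<^bsub>Q\<^esub> (X j \<otimes>\<^bsub>Q\<^esub> X i)) {#j, i#} =
        coeff (((a \<otimes> b) \<otimes> ?q) \<odot>\<^bsub>Q\<^esub> (X j \<otimes>\<^bsub>Q\<^esub> X i)) {#j, i#}"
      by (rule arg_cong[where f = "\<lambda>C. coeff C {#j, i#}"])
    then have "((a \<otimes> b) \<otimes> q i j) \<otimes> coeff (X j \<otimes>\<^bsub>Q\<^esub> X i) {#j, i#} =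
        ((a \<otimes> b) \<otimes> ?q) \<otimes> coeff (X j \<otimes>\<^bsub>Q\<^esub> X i) {#j, i#}"
      unfolding coeff_smult[OF m_closed[OF m_closed[OF a(1) b(1)] q_closed[OF i j]] XX]
        coeff_smult[OF m_closed[OF m_closed[OF a(1) b(1)] qc] XX] .
    moreover have "coeff (X j \<otimes>\<^bsub>Q\<^esub> X i) {#j, i#} \<noteq> \<zero>"
    proof -
      have "{#j#} + {#i#} \<in> support (X j \<otimes>\<^bsub>Q\<^esub> X i)"
        using is_term_mult[OF is_term_X[OF j] is_term_X[OF i]] unfolding is_term_def by blast
      moreover have "{#j#} + {#i#} = {#j, i#}" by simp
      ultimately show ?thesis unfolding support_def by (simp only: mem_Collect_eq not_False_eq_True)
    qed
    ultimately have "(a \<otimes> b) \<otimes> q i j = (a \<otimes> b) \<otimes> ?q"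
      using m_rcancel[OF _ coeff_closed[OF XX]] a b i j qc m_closed q_closed by metis
    moreover have "a \<otimes> b \<noteq> \<zero>" using a b by (simp add: integral_iff)
    ultimately show ?thesis using m_lcancel[of "a \<otimes> b" "q i j" ?q] a b i j qc m_closed q_closed by metis
  qed
  have "\<tau> j = j"
    using dependent_at_permutation[OF _ inj rel j] indep[OF j] \<tau> by blast
  then show ?thesis using htau[OF j] by simp
qed

theorem automorphisms_scalar:
  assumes "\<And>k. k \<in> {1..n} \<Longrightarrow> \<not> dependent_at k"
  shows "carrier (quantum_Aut R n q) = scalar_automorphisms R n q"
proof
  show "scalar_automorphisms R n q \<subseteq> carrier (quantum_Aut R n q)"
    by (auto simp: scalar_automorphisms_def)
  show "carrier (quantum_Aut R n q) \<subseteq> scalar_automorphisms R n q"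
  proof
    fix h assume hc: "h \<in> carrier (quantum_Aut R n q)"
    then have h: "h \<in> algebra_auto R Q" by simp
    have "\<exists>a\<in>Units R. h (X j) = a \<odot>\<^bsub>Q\<^esub> X j" if "j \<in> {1..n}" for j
    proof -
      have "is_term {#j#} (h (X j))" by (rule automorphism_scalar[OF h _ that]) (rule assms)
      then obtain a where "a \<in> carrier R" "a \<noteq> \<zero>" "h (X j) = a \<odot>\<^bsub>Q\<^esub> word (sorted_list_of_multiset {#j#})"
        by (rule is_termE)
      then show ?thesis by (auto simp: X_eq_word field_Units)
    qed
    then obtain t where t: "\<And>j. j \<in> {1..n} \<Longrightarrow> t j \<in> Units R \<and> h (X j) = t j \<odot>\<^bsub>Q\<^esub> X j" by metis
    have "restrict t {1..n} \<in> carrier (torus R n)"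
      using t by (auto simp: torus_def product_group_def units_of_carrier)
    with t hc show "h \<in> scalar_automorphisms R n q"
      unfolding scalar_automorphisms_def by (auto intro!: bexI[of _ "restrict t {1..n}"])
  qed
qed

end

section \<open>The rational vector space of an abelian group\<close>

context comm_group
begin

text \<open>
  The space \<^const>\<open>rational_tensor\<close> consists of the cosets of a subgroup \<open>tensor_null\<close> of the free abelian
  group \<open>F\<close> on pairs; \<open>tensor x s\<close> is the class of a pure tensor.
\<close>

abbreviation F :: "('a \<times> rat \<Rightarrow>\<^sub>0 int) monoid"
  where "F \<equiv> free_Abelian_group (carrier G \<times> UNIV)"

abbreviation tensor_null :: "('a \<times> rat \<Rightarrow>\<^sub>0 int) set"
  where "tensor_null \<equiv> generate F (tensor_relations G)"

abbreviation T :: "(rat, ('a \<times> rat \<Rightarrow>\<^sub>0 int) set) module"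
  where "T \<equiv> rational_tensor G"

definition tensor_class :: "('a \<times> rat \<Rightarrow>\<^sub>0 int) \<Rightarrow> ('a \<times> rat \<Rightarrow>\<^sub>0 int) set"
  where "tensor_class c = tensor_null #>\<^bsub>F\<^esub> c"

definition tensor :: "'a \<Rightarrow> rat \<Rightarrow> ('a \<times> rat \<Rightarrow>\<^sub>0 int) set"
  where "tensor x s = tensor_class (frag_of (x, s))"

definition scale :: "rat \<Rightarrow> ('a \<times> rat \<Rightarrow>\<^sub>0 int) \<Rightarrow> ('a \<times> rat \<Rightarrow>\<^sub>0 int)"
  where "scale r = frag_extend (\<lambda>(x, s). frag_of (x, r * s))"

lemma carrier_tensor_free: "c \<in> carrier F \<longleftrightarrow> Poly_Mapping.keys c \<subseteq> carrier G \<times> UNIV"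
  by simp

lemma tensor_free_add: "c \<in> carrier F \<Longrightarrow> d \<in> carrier F \<Longrightarrow> c + d \<in> carrier F"
  using keys_add[of c d] by auto

lemma tensor_free_diff: "c \<in> carrier F \<Longrightarrow> d \<in> carrier F \<Longrightarrow> c - d \<in> carrier F"
  using keys_diff[of c d] by auto

lemma tensor_free_induct [consumes 1, case_names zero diff of]:
  assumes "c \<in> carrier F" "P 0"
    and "\<And>c d. \<lbrakk>c \<in> carrier F; d \<in> carrier F; P c; P d\<rbrakk> \<Longrightarrow> P (c - d)"
    and "\<And>x s. x \<in> carrier G \<Longrightarrow> P (frag_of (x, s))"
  shows "P c"
  by (rule free_Abelian_group_induct[of c "carrier G \<times> UNIV"]) (use assms in auto)

lemma tensor_relations_subset: "tensor_relations G \<subseteq> carrier F"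
  unfolding tensor_relations_def
  by (auto simp del: carrier_free_Abelian_group_iff
      intro!: tensor_free_add tensor_free_diff simp: frag_of_in_free_Abelian_group)

text \<open>
  A permanent instance would produce free abelian groups over free abelian groups without end, so the
  instance is confined to this context.
\<close>

interpretation tensor_free: comm_group F
  by (rule abelian_free_Abelian_group)

lemma tensor_null_subgroup: "subgroup tensor_null F"
  by (rule tensor_free.generate_is_subgroup[OF tensor_relations_subset])

lemma tensor_null_normal: "normal tensor_null F"
  by (rule tensor_free.subgroup_imp_normal[OF tensor_null_subgroup])

lemma tensor_null_diff: "c \<in> tensor_null \<Longrightarrow> d \<in> tensor_null \<Longrightarrow> c - d \<in> tensor_null"
proof -
  assume c: "c \<in> tensor_null" and d: "d \<in> tensor_null"
  then have "Poly_Mapping.keys d \<subseteq> carrier G \<times> UNIV"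
    using subgroup.subset[OF tensor_null_subgroup] carrier_tensor_free by blast
  then show ?thesis
    using subgroup.m_closed[OF tensor_null_subgroup c subgroup.m_inv_closed[OF tensor_null_subgroup d]] by simp
qed

lemma tensor_class_eq_iff:
  assumes c: "c \<in> carrier F" and d: "d \<in> carrier F"
  shows "tensor_class c = tensor_class d \<longleftrightarrow> c - d \<in> tensor_null"
proof
  assume "tensor_class c = tensor_class d"
  then have "c \<in> tensor_null #>\<^bsub>F\<^esub> d"
    using tensor_free.rcos_self[OF c tensor_null_subgroup] by (simp add: tensor_class_def)
  then show "c - d \<in> tensor_null" by (auto simp: r_coset_def)
next
  assume cd: "c - d \<in> tensor_null"
  have "(tensor_null #>\<^bsub>F\<^esub> (c - d)) #>\<^bsub>F\<^esub> d = tensor_null #>\<^bsub>F\<^esub> c"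
    using tensor_free.coset_mult_assoc[OF subgroup.subset[OF tensor_null_subgroup] tensor_free_diff[OF c d] d]
    by simp
  moreover have "tensor_null #>\<^bsub>F\<^esub> (c - d) = tensor_null"
    by (rule tensor_free.coset_join2[OF tensor_free_diff[OF c d] tensor_null_subgroup cd])
  ultimately show "tensor_class c = tensor_class d" by (simp add: tensor_class_def)
qed

lemma carrier_tensor_space: "carrier T = tensor_class ` carrier F"
  by (auto simp: rational_tensor_def Let_def FactGroup_def RCOSETS_def tensor_class_def)

lemma tensor_class_closed [intro]: "c \<in> carrier F \<Longrightarrow> tensor_class c \<in> carrier T"
  unfolding carrier_tensor_space by (rule imageI)

lemma tensor_space_cases:
  assumes "C \<in> carrier T" obtains c where "c \<in> carrier F" "C = tensor_class c"
  using assms unfolding carrier_tensor_space by blast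

lemma tensor_space_add:
  assumes "c \<in> carrier F" "d \<in> carrier F"
  shows "tensor_class c \<oplus>\<^bsub>T\<^esub> tensor_class d = tensor_class (c + d)"
  using normal.rcos_sum[OF tensor_null_normal assms]
  by (simp add: rational_tensor_def Let_def FactGroup_def tensor_class_def)

lemma tensor_space_zero: "\<zero>\<^bsub>T\<^esub> = tensor_class 0"
  using tensor_free.coset_join2[OF _ tensor_null_subgroup, of 0] subgroup.one_closed[OF tensor_null_subgroup]
  by (simp add: rational_tensor_def Let_def FactGroup_def tensor_class_def)

lemma scale_simps:
  "scale r 0 = 0" "scale r (c + d) = scale r c + scale r d" "scale r (c - d) = scale r c - scale r d"
  "scale r (frag_of (x, s)) = frag_of (x, r * s)"
  by (simp_all add: scale_def frag_extend_add frag_extend_diff)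

lemma scale_closed: "c \<in> carrier F \<Longrightarrow> scale r c \<in> carrier F"
proof (induction c rule: tensor_free_induct)
  case zero
  then show ?case by (simp add: scale_simps)
next
  case (diff c d)
  then show ?case unfolding scale_simps by (intro tensor_free_diff)
next
  case (of x s)
  then show ?case by (simp add: scale_simps)
qed

lemma scale_null:
  assumes "c \<in> tensor_null"
  shows "scale r c \<in> tensor_null"
proof -
  have rel: "scale r c \<in> tensor_relations G" if "c \<in> tensor_relations G" for c
    using that unfolding tensor_relations_def
    by (auto simp: scale_simps distrib_left) blast+
  from assms show ?thesis
  proof (induction rule: generate.induct)
    case one
    then show ?case
      using subgroup.one_closed[OF tensor_null_subgroup] by (simp add: scale_simps)
  next
    case (incl c)
    then show ?case using rel by (intro generate.incl)
  next
    case (inv c)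
    then have c: "Poly_Mapping.keys c \<subseteq> carrier G \<times> UNIV"
      using tensor_relations_subset carrier_tensor_free by blast
    have "0 \<in> tensor_null" using subgroup.one_closed[OF tensor_null_subgroup] by simp
    moreover have "scale r c \<in> tensor_null" using inv rel by (intro generate.incl)
    ultimately have "0 - scale r c \<in> tensor_null" by (rule tensor_null_diff)
    then show ?case using c scale_simps(3)[of r 0 c] by (simp add: scale_simps(1))
  next
    case (eng c d)
    then show ?case using subgroup.m_closed[OF tensor_null_subgroup] by (simp add: scale_simps)
  qed
qed

lemma tensor_space_smult:
  assumes c: "c \<in> carrier F"
  shows "r \<odot>\<^bsub>T\<^esub> tensor_class c = tensor_class (scale r c)"
proof -
  have "tensor_class (scale r d) = tensor_class (scale r c)" if d: "d \<in> tensor_class c" for d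
  proof -
    have dc: "d \<in> carrier F"
      using d tensor_free.r_coset_subset_G[OF subgroup.subset[OF tensor_null_subgroup] c]
      unfolding tensor_class_def by blast
    have "d - c \<in> tensor_null" using d by (auto simp: tensor_class_def r_coset_def)
    then have "scale r d - scale r c \<in> tensor_null" using scale_null scale_simps(3) by metis
    then show ?thesis using tensor_class_eq_iff[OF scale_closed[OF dc] scale_closed[OF c]] by blast
  qed
  moreover have "c \<in> tensor_class c"
    unfolding tensor_class_def by (rule tensor_free.rcos_self[OF c tensor_null_subgroup])
  ultimately have "(\<Union>d\<in>tensor_class c. tensor_class (scale r d)) = tensor_class (scale r c)" by blast
  then show ?thesis
    by (simp add: rational_tensor_def Let_def tensor_class_def scale_def)
qed

lemma tensor_add_left:
  assumes "x \<in> carrier G" "y \<in> carrier G"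
  shows "tensor (x \<otimes> y) s = tensor x s \<oplus>\<^bsub>T\<^esub> tensor y s"
proof -
  have "frag_of (x \<otimes> y, s) - (frag_of (x, s) + frag_of (y, s)) \<in> tensor_null"
    using assms by (intro generate.incl) (auto simp: tensor_relations_def)
  then have "tensor_class (frag_of (x \<otimes> y, s)) = tensor_class (frag_of (x, s) + frag_of (y, s))"
    using assms by (subst tensor_class_eq_iff) (auto simp del: carrier_free_Abelian_group_iff
        intro!: tensor_free_add simp: frag_of_in_free_Abelian_group)
  then show ?thesis using assms by (simp add: tensor_def tensor_space_add)
qed

lemma tensor_closed: "x \<in> carrier G \<Longrightarrow> tensor x s \<in> carrier T"
  unfolding tensor_def by (rule tensor_class_closed) simp

lemma tensor_smult: "x \<in> carrier G \<Longrightarrow> r \<odot>\<^bsub>T\<^esub> tensor x s = tensor x (r * s)"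
  by (simp add: tensor_def tensor_space_smult scale_simps)

lemma tensor_class_distrib:
  assumes "c \<in> carrier F"
  shows "tensor_class (scale (a + b) c) = tensor_class (scale a c + scale b c)"
proof -
  have "scale (a + b) c - (scale a c + scale b c) \<in> tensor_null"
    using assms
  proof (induction c rule: tensor_free_induct)
    case zero
    then show ?case using subgroup.one_closed[OF tensor_null_subgroup] by (simp add: scale_simps)
  next
    case (diff c d)
    have "(scale (a + b) c - (scale a c + scale b c)) - (scale (a + b) d - (scale a d + scale b d)) \<in> tensor_null"
      using diff.IH by (rule tensor_null_diff)
    then show ?case by (simp add: scale_simps algebra_simps)
  next
    case (of x s)
    then show ?case
      unfolding scale_simps distrib_right tensor_relations_def by (intro generate.incl UnI2) blast
  qed
  then show ?thesis
    using assms by (subst tensor_class_eq_iff) (auto simp del: carrier_free_Abelian_group_iff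
        intro!: tensor_free_add scale_closed)
qed

lemma tensor_space_smult_distrib:
  assumes "C \<in> carrier T"
  shows "(a + b) \<odot>\<^bsub>T\<^esub> C = a \<odot>\<^bsub>T\<^esub> C \<oplus>\<^bsub>T\<^esub> b \<odot>\<^bsub>T\<^esub> C"
proof -
  obtain c where "c \<in> carrier F" "C = tensor_class c" using assms by (rule tensor_space_cases)
  then show ?thesis
    by (simp add: tensor_space_smult tensor_space_add scale_closed tensor_class_distrib
        del: carrier_free_Abelian_group_iff)
qed

lemma tensor_space_one_smult: "c \<in> carrier F \<Longrightarrow> 1 \<odot>\<^bsub>T\<^esub> tensor_class c = tensor_class c"
proof -
  assume c: "c \<in> carrier F"
  then have "scale 1 c = c"
    by (induction c rule: tensor_free_induct) (auto simp: scale_simps)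
  with c show ?thesis by (simp add: tensor_space_smult del: carrier_free_Abelian_group_iff)
qed

lemma tensor_add_right: "x \<in> carrier G \<Longrightarrow> tensor x (s + t) = tensor x s \<oplus>\<^bsub>T\<^esub> tensor x t"
  using tensor_space_smult_distrib[OF tensor_closed[of x 1], of s t] by (simp add: tensor_smult)

lemma vectorspace_tensor_space: "vectorspace (class_ring :: rat ring) T"
proof (intro vectorspace.intro moduleI)
  note [simp del] = carrier_free_Abelian_group_iff
  have zero: "0 \<in> carrier F" using tensor_free.one_closed by simp
  have ops [simp]: "\<one>\<^bsub>(class_ring :: rat ring)\<^esub> = 1" "carrier (class_ring :: rat ring) = UNIV"
    "x \<oplus>\<^bsub>(class_ring :: rat ring)\<^esub> y = x + y" "x \<otimes>\<^bsub>(class_ring :: rat ring)\<^esub> y = x * y" for x y by auto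
  show "field (class_ring :: rat ring)" by (rule class_field)
  then show "cring (class_ring :: rat ring)" by (intro domain.axioms(1) field.axioms(1))
  show "abelian_group T"
  proof (rule abelian_groupI)
    fix C assume "C \<in> carrier T"
    then obtain c where c: "c \<in> carrier F" "C = tensor_class c" by (rule tensor_space_cases)
    have nc: "0 - c \<in> carrier F" using zero c(1) by (rule tensor_free_diff)
    then show "\<exists>D\<in>carrier T. D \<oplus>\<^bsub>T\<^esub> C = \<zero>\<^bsub>T\<^esub>"
      using c tensor_space_add[OF nc c(1)]
      by (intro bexI[of _ "tensor_class (0 - c)"]) (auto simp: tensor_space_zero)
  qed (auto elim!: tensor_space_cases simp: tensor_space_add tensor_space_zero tensor_free_add zero add_ac
      intro!: tensor_class_closed tensor_free_add)
next
  note [simp del] = carrier_free_Abelian_group_iff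
  fix a b :: rat and C assume "C \<in> carrier T"
  then obtain c where c: "c \<in> carrier F" "C = tensor_class c" by (rule tensor_space_cases)
  show "a \<odot>\<^bsub>T\<^esub> C \<in> carrier T"
    using c by (auto simp: tensor_space_smult scale_closed)
  show "(a \<oplus>\<^bsub>(class_ring :: rat ring)\<^esub> b) \<odot>\<^bsub>T\<^esub> C = a \<odot>\<^bsub>T\<^esub> C \<oplus>\<^bsub>T\<^esub> b \<odot>\<^bsub>T\<^esub> C"
    using c by (simp add: tensor_space_smult_distrib tensor_class_closed)
  have "scale (a * b) c = scale a (scale b c)" using c(1)
    by (induction c rule: tensor_free_induct) (auto simp: scale_simps mult.assoc)
  then show "(a \<otimes>\<^bsub>(class_ring :: rat ring)\<^esub> b) \<odot>\<^bsub>T\<^esub> C = a \<odot>\<^bsub>T\<^esub> (b \<odot>\<^bsub>T\<^esub> C)"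
    using c by (simp add: tensor_space_smult scale_closed)
  show "\<one>\<^bsub>(class_ring :: rat ring)\<^esub> \<odot>\<^bsub>T\<^esub> C = C"
    using c by (simp add: tensor_space_one_smult)
  fix D assume "D \<in> carrier T"
  then obtain d where "d \<in> carrier F" "D = tensor_class d" by (rule tensor_space_cases)
  then show "a \<odot>\<^bsub>T\<^esub> (C \<oplus>\<^bsub>T\<^esub> D) = a \<odot>\<^bsub>T\<^esub> C \<oplus>\<^bsub>T\<^esub> a \<odot>\<^bsub>T\<^esub> D"
    using c by (simp add: tensor_space_smult tensor_space_add scale_closed scale_simps tensor_free_add)
qed

text \<open>
  Differences of generators exhaust \<open>F\<close>, and \<open>x \<otimes> s = s (x \<otimes> 1)\<close>.
\<close>

lemma tensor_space_generated:
  assumes W: "LinearCombinations.submodule (class_ring :: rat ring) W T"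
    and t: "\<And>x. x \<in> carrier G \<Longrightarrow> tensor x 1 \<in> W"
  shows "carrier T \<subseteq> W"
proof
  interpret V: vectorspace "class_ring :: rat ring" T by (rule vectorspace_tensor_space)
  have sc: "r \<odot>\<^bsub>T\<^esub> C \<in> W" if "C \<in> W" for r C
    using submodule.smult_closed[OF W _ that, of r] by simp
  fix C assume "C \<in> carrier T"
  then obtain c where c: "c \<in> carrier F" "C = tensor_class c" by (rule tensor_space_cases)
  have "tensor_class c \<in> W" using c(1)
  proof (induction c rule: tensor_free_induct)
    case zero
    then show ?case using submodule.zero_closed[OF W] by (simp add: tensor_space_zero)
  next
    case (diff c d)
    let ?C = "tensor_class c" and ?D = "tensor_class d" and ?E = "tensor_class (c - d)"
    have car: "?C \<in> carrier T" "?D \<in> carrier T" "?E \<in> carrier T"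
      "(-1) \<odot>\<^bsub>T\<^esub> ?D \<in> carrier T"
      using diff.hyps tensor_free_diff by (auto intro!: tensor_class_closed scale_closed
          simp: tensor_space_smult simp del: carrier_free_Abelian_group_iff)
    have "?D \<oplus>\<^bsub>T\<^esub> (-1) \<odot>\<^bsub>T\<^esub> ?D = \<zero>\<^bsub>T\<^esub>"
      using tensor_space_smult_distrib[OF car(2), of 1 "-1"] tensor_space_one_smult[OF diff.hyps(2)]
        V.lmult_0[OF car(2)] by simp
    moreover have "?E \<oplus>\<^bsub>T\<^esub> ?D = ?C"
      using tensor_space_add[OF tensor_free_diff[OF diff.hyps] diff.hyps(2)] by simp
    ultimately have "?E = ?C \<oplus>\<^bsub>T\<^esub> (-1) \<odot>\<^bsub>T\<^esub> ?D"
      using car V.M.a_assoc V.M.r_zero by metis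
    then show ?case using submodule.m_closed[OF W diff.IH(1) sc[OF diff.IH(2)]] by simp
  next
    case (of x s)
    then show ?case using sc[OF t[of x], of s] by (simp add: tensor_smult) (simp add: tensor_def)
  qed
  with c show "C \<in> W" by simp
qed

lemma tensor_pow: "x \<in> carrier G \<Longrightarrow> tensor (x [^] (m::nat)) s = tensor x (of_nat m * s)"
proof (induction m)
  case 0
  interpret V: vectorspace "class_ring :: rat ring" T by (rule vectorspace_tensor_space)
  have "tensor \<one> s \<oplus>\<^bsub>T\<^esub> tensor \<one> s = tensor \<one> s \<oplus>\<^bsub>T\<^esub> \<zero>\<^bsub>T\<^esub>"
    using tensor_add_left[of \<one> \<one> s] tensor_closed[of \<one> s] by simp
  then have "tensor \<one> s = \<zero>\<^bsub>T\<^esub>"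
    using tensor_closed[of \<one> s] by (simp add: V.M.add.l_cancel_one)
  moreover have "tensor x 0 = \<zero>\<^bsub>T\<^esub>"
    using tensor_smult[OF 0, of 0 0] V.lmult_0[OF tensor_closed[OF 0]] by simp
  ultimately show ?case by simp
next
  case (Suc m)
  then show ?case
    using tensor_add_left[of "x [^] m" x s] tensor_add_right[of x "of_nat m * s" s]
    by (simp add: algebra_simps)
qed

end

section \<open>Bounds for the torsion-free rank\<close>

context comm_group
begin

text \<open>
  The elements \<open>x\<close> for which \<open>x \<otimes> 1\<close> lies in the span of the tensors \<open>y \<otimes> 1\<close> with \<open>y \<in> S\<close> form a subgroup.
  It is closed under roots because \<open>x \<otimes> 1 = (1/m) (x\<^sup>m \<otimes> 1)\<close>. So if no proper subgroup with this
  closure property contains \<open>S\<close>, the tensors span everything.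
\<close>

lemma torsion_free_rank_le:
  assumes S: "finite S" "S \<subseteq> carrier G"
    and isolated: "\<And>H. \<lbrakk>subgroup H G; S \<subseteq> H;
        \<And>x m. \<lbrakk>x \<in> carrier G; 0 < m; x [^] (m::nat) \<in> H\<rbrakk> \<Longrightarrow> x \<in> H\<rbrakk> \<Longrightarrow> carrier G \<subseteq> H"
  shows "vectorspace.fin_dim (class_ring :: rat ring) T"
    and "torsion_free_rank G \<le> card S"
proof -
  interpret V: vectorspace "class_ring :: rat ring" T by (rule vectorspace_tensor_space)
  let ?B = "(\<lambda>x. tensor x 1) ` S"
  have B: "finite ?B" "?B \<subseteq> carrier T" using S tensor_closed by auto
  let ?W = "V.span ?B"
  have W: "LinearCombinations.submodule (class_ring :: rat ring) ?W T"
    using B(2) by (rule V.span_is_submodule)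
  have sc: "r \<odot>\<^bsub>T\<^esub> C \<in> ?W" if "C \<in> ?W" for r C
    using submodule.smult_closed[OF W _ that, of r] by simp
  let ?H = "{x \<in> carrier G. tensor x 1 \<in> ?W}"
  have "carrier G \<subseteq> ?H"
  proof (rule isolated)
    show "S \<subseteq> ?H"
      using S V.in_own_span[OF B(2)] by auto
    show "subgroup ?H G"
    proof (rule subgroupI)
      have "tensor \<one> 1 = 0 \<odot>\<^bsub>T\<^esub> tensor \<one> 1"
        using tensor_pow[of \<one> 0 1] by (simp add: tensor_smult)
      then have "tensor \<one> 1 \<in> ?W"
        using V.lmult_0[OF tensor_closed[OF one_closed]] submodule.zero_closed[OF W] by simp
      then show "?H \<noteq> {}" by blast
    next
      fix x assume "x \<in> ?H"
      then have x: "x \<in> carrier G" "tensor x 1 \<in> ?W" by auto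
      have "tensor (inv x) 1 = tensor x (-1)"
      proof -
        have c: "tensor (inv x) 1 \<in> carrier T" "tensor x 1 \<in> carrier T"
          "tensor x (-1) \<in> carrier T" using x tensor_closed by auto
        have one: "tensor \<one> 1 = tensor x 0" using tensor_pow[OF x(1), of 0 1] by simp
        have "tensor x 0 = 0 \<odot>\<^bsub>T\<^esub> tensor x 0" using x by (simp add: tensor_smult)
        then have zero: "tensor x 0 = \<zero>\<^bsub>T\<^esub>"
          using V.lmult_0[OF tensor_closed[OF x(1)]] by simp
        have 1: "tensor (inv x) 1 \<oplus>\<^bsub>T\<^esub> tensor x 1 = \<zero>\<^bsub>T\<^esub>"
          using tensor_add_left[of "inv x" x 1] x zero one by simp
        have 2: "tensor x 1 \<oplus>\<^bsub>T\<^esub> tensor x (-1) = \<zero>\<^bsub>T\<^esub>"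
          using tensor_add_right[OF x(1), of 1 "-1"] zero by simp
        show ?thesis using 1 2 c V.M.minus_unique V.M.a_comm by metis
      qed
      also have "\<dots> = (-1) \<odot>\<^bsub>T\<^esub> tensor x 1" using x by (simp add: tensor_smult)
      finally show "inv x \<in> ?H" using x sc by auto
    next
      fix x y assume "x \<in> ?H" "y \<in> ?H"
      then show "x \<otimes> y \<in> ?H"
        using submodule.m_closed[OF W] by (auto simp: tensor_add_left)
    qed auto
    fix x and m :: nat assume x: "x \<in> carrier G" and m: "0 < m" and p: "x [^] m \<in> ?H"
    have "tensor x 1 = (1 / of_nat m) \<odot>\<^bsub>T\<^esub> tensor (x [^] m) 1"
      using x m by (simp add: tensor_pow tensor_smult)
    then show "x \<in> ?H" using x p sc by auto
  qed
  then have "carrier T \<subseteq> ?W"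
    by (intro tensor_space_generated[OF W]) auto
  then have gen: "V.gen_set ?B"
    using submodule.subset[OF W] by blast
  show "V.fin_dim" using B gen unfolding V.fin_dim_def by blast
  have "torsion_free_rank G \<le> card ?B"
    unfolding torsion_free_rank_def by (rule V.gen_ge_dim[OF B gen])
  also have "\<dots> \<le> card S" using S by (intro card_image_le)
  finally show "torsion_free_rank G \<le> card S" .
qed

text \<open>
  A homomorphism to the integers extends to a rational functional, by the universal property of the
  free abelian group: \<open>(x, s) \<mapsto> \<phi> x * s\<close> vanishes on both kinds of biadditivity relations.
\<close>

lemma tensor_functional:
  fixes \<phi> :: "'a \<Rightarrow> int"
  assumes \<phi>: "\<phi> \<in> hom G integer_group"
  obtains L :: "('a \<times> rat \<Rightarrow>\<^sub>0 int) set \<Rightarrow> rat"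
  where "\<And>x s. x \<in> carrier G \<Longrightarrow> L (tensor x s) = of_int (\<phi> x) * s"
    and "\<And>C D. \<lbrakk>C \<in> carrier T; D \<in> carrier T\<rbrakk>
      \<Longrightarrow> L (C \<oplus>\<^bsub>T\<^esub> D) = L C + L D"
    and "\<And>r C. C \<in> carrier T \<Longrightarrow> L (r \<odot>\<^bsub>T\<^esub> C) = r * L C"
proof -
  let ?Q = "add_monoid (class_ring :: rat ring)"
  interpret Q: comm_group ?Q
    by (rule abelian_group.a_comm_group) (rule ring.is_abelian_group, rule class_ring.ring_axioms)
  have "(\<lambda>(x, s). of_int (\<phi> x) * s) ` (carrier G \<times> UNIV) \<subseteq> carrier ?Q" by simp
  then obtain h where h: "h \<in> hom F ?Q"
    and h_of: "\<And>p. p \<in> carrier G \<times> UNIV \<Longrightarrow> h (frag_of p) = (case p of (x, s) \<Rightarrow> of_int (\<phi> x) * s)"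
    by (rule Q.free_Abelian_group_universal) blast
  note [simp del] = carrier_free_Abelian_group_iff
  have h_add: "h (c + d) = h c + h d" if "c \<in> carrier F" "d \<in> carrier F" for c d
    using hom_mult[OF h that] by simp
  have h_diff: "h (c - d) = h c - h d" if "c \<in> carrier F" "d \<in> carrier F" for c d
    using h_add[OF tensor_free_diff[OF that] that(2)] by simp
  have h0: "h 0 = 0" using h_diff[of 0 0] by (simp add: carrier_free_Abelian_group_iff)
  have h_rel: "h c = 0" if "c \<in> tensor_relations G" for c
  proof -
    have "\<phi> (x \<otimes> y) = \<phi> x + \<phi> y" if "x \<in> carrier G" "y \<in> carrier G" for x y
      using hom_mult[OF \<phi> that] by simp
    then show ?thesis using that unfolding tensor_relations_def
      by (auto simp: h_diff h_add h_of tensor_free_add frag_of_in_free_Abelian_group distrib_left distrib_right)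
  qed
  have sub: "c \<in> carrier F" if "c \<in> tensor_null" for c
    using subgroup.subset[OF tensor_null_subgroup] that by blast
  have h_null: "h c = 0" if "c \<in> tensor_null" for c
    using that
  proof (induction rule: generate.induct)
    case (inv c)
    then have c: "c \<in> carrier F" using tensor_relations_subset by blast
    then have "inv\<^bsub>F\<^esub> c = 0 - c"
      using carrier_tensor_free inv_free_Abelian_group by fastforce
    then show ?case using h_diff[of 0 c] c h0 h_rel[OF inv] by (simp add: carrier_free_Abelian_group_iff)
  next
    case (eng c d)
    then show ?case using h_add[of c d] sub by simp
  qed (simp_all add: h0 h_rel)
  have h_scale: "h (scale r c) = r * h c" if "c \<in> carrier F" for r c
    using that
    by (induction c rule: tensor_free_induct) (simp_all add: scale_simps h0 h_diff h_of scale_closed right_diff_distrib)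
  define L where "L C = h (SOME c. c \<in> carrier F \<and> C = tensor_class c)" for C
  have cong: "h c = h d" if "c \<in> carrier F" "d \<in> carrier F" "tensor_class c = tensor_class d" for c d
    using h_null[of "c - d"] h_diff[OF that(1,2)] tensor_class_eq_iff[OF that(1,2)] that(3) by simp
  have L: "L (tensor_class c) = h c" if c: "c \<in> carrier F" for c
  proof -
    let ?d = "SOME d. d \<in> carrier F \<and> tensor_class c = tensor_class d"
    have d: "?d \<in> carrier F \<and> tensor_class c = tensor_class ?d"
      by (rule someI[of _ c]) (use c in simp)
    then have "h ?d = h c" by (intro cong) (use c in auto)
    then show ?thesis unfolding L_def .
  qed
  show ?thesis
  proof (rule that)
    show "L (tensor x s) = of_int (\<phi> x) * s" if "x \<in> carrier G" for x s
      using that by (simp add: tensor_def L h_of frag_of_in_free_Abelian_group)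
    show "L (C \<oplus>\<^bsub>T\<^esub> D) = L C + L D"
      if "C \<in> carrier T" "D \<in> carrier T" for C D
      using that by (auto elim!: tensor_space_cases simp: tensor_space_add L h_add tensor_free_add)
    show "L (r \<odot>\<^bsub>T\<^esub> C) = r * L C" if "C \<in> carrier T" for r C
      using that by (auto elim!: tensor_space_cases simp: tensor_space_smult L h_scale scale_closed)
  qed
qed

text \<open>
  Functionals that are dual to the tensors \<open>e i \<otimes> 1\<close> witness their linear independence. The dimension
  is only meaningful in finite dimension, hence the first hypothesis.
\<close>

lemma torsion_free_rank_ge:
  fixes \<phi> :: "'i \<Rightarrow> 'a \<Rightarrow> int" and e :: "'i \<Rightarrow> 'a"
  assumes fin: "vectorspace.fin_dim (class_ring :: rat ring) T"
    and \<phi>: "\<And>i. i \<in> J \<Longrightarrow> \<phi> i \<in> hom G integer_group"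
    and e: "\<And>i. i \<in> J \<Longrightarrow> e i \<in> carrier G"
    and dual: "\<And>i j. i \<in> J \<Longrightarrow> j \<in> J \<Longrightarrow> \<phi> i (e j) = (if i = j then 1 else 0)"
  shows "card J \<le> torsion_free_rank G"
proof -
  interpret V: vectorspace "class_ring :: rat ring" T by (rule vectorspace_tensor_space)
  let ?v = "\<lambda>i. tensor (e i) 1"
  let ?B = "?v ` J"
  have B: "?B \<subseteq> carrier T" using e tensor_closed by auto
  have functional: "\<exists>L. (\<forall>j\<in>J. L (?v j) = (if i = j then 1 else 0)) \<and>
      (\<forall>C\<in>carrier T. \<forall>D\<in>carrier T. L (C \<oplus>\<^bsub>T\<^esub> D) = L C + L D) \<and>
      (\<forall>r. \<forall>C\<in>carrier T. L (r \<odot>\<^bsub>T\<^esub> C) = r * L C)" if i: "i \<in> J" for i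
  proof -
    obtain L where L: "\<And>x s. x \<in> carrier G \<Longrightarrow> L (tensor x s) = of_int (\<phi> i x) * s"
      "\<And>C D. \<lbrakk>C \<in> carrier T; D \<in> carrier T\<rbrakk>
        \<Longrightarrow> L (C \<oplus>\<^bsub>T\<^esub> D) = L C + L D"
      "\<And>r C. C \<in> carrier T \<Longrightarrow> L (r \<odot>\<^bsub>T\<^esub> C) = r * (L C :: rat)"
      using tensor_functional[OF \<phi>[OF i]] by blast
    then show ?thesis using e dual i by (intro exI[of _ L]) auto
  qed
  have "inj_on ?v J"
  proof (rule inj_onI)
    fix i j assume ij: "i \<in> J" "j \<in> J" "?v i = ?v j"
    obtain L where L: "\<forall>j\<in>J. L (?v j) = (if i = j then 1 else (0 :: rat))"
      using functional[OF ij(1)] by blast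
    have "(if i = j then 1 else 0) = L (?v j)" using bspec[OF L ij(2)] by (rule sym)
    also have "\<dots> = L (?v i)" using ij(3) by (rule arg_cong[OF sym])
    also have "\<dots> = 1" using bspec[OF L ij(1)] by simp
    finally show "i = j" by (simp split: if_splits)
  qed
  then have "card J = card ?B" by (simp add: card_image)
  also have "\<dots> \<le> torsion_free_rank G"
    unfolding torsion_free_rank_def
  proof (rule V.li_le_dim(2)[OF fin B])
    show "\<not> V.lin_dep ?B"
    proof
      assume "V.lin_dep ?B"
      then obtain S a v where S: "finite S" "S \<subseteq> ?B" and zero: "V.lincomb a S = \<zero>\<^bsub>T\<^esub>"
        and v: "v \<in> S" "a v \<noteq> (0 :: rat)"
        unfolding V.lin_dep_def by auto
      then obtain i where i: "i \<in> J" "v = ?v i" by auto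
      from functional[OF i(1)] obtain L where functional_L:
        "\<forall>j\<in>J. L (?v j) = (if i = j then 1 else 0)"
        "\<forall>C\<in>carrier T. \<forall>D\<in>carrier T. L (C \<oplus>\<^bsub>T\<^esub> D) = L C + L D"
        "\<forall>r. \<forall>C\<in>carrier T. L (r \<odot>\<^bsub>T\<^esub> C) = r * L C"
        by (elim exE conjE)
      note L = bspec[OF functional_L(1)]
      note L_add = bspec[OF bspec[OF functional_L(2)]]
      note L_smult = bspec[OF spec[OF functional_L(3)]]
      have Sc: "S \<subseteq> carrier T" using S B by blast
      have L0: "L \<zero>\<^bsub>T\<^esub> = 0"
        using L_add[of "\<zero>\<^bsub>T\<^esub>" "\<zero>\<^bsub>T\<^esub>"] by simp
      have sc: "a w \<odot>\<^bsub>T\<^esub> w \<in> carrier T" if "w \<in> S" for w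
        using that Sc V.smult_closed[of "a w" w] by auto
      have "L (\<Oplus>\<^bsub>T\<^esub>w\<in>U. a w \<odot>\<^bsub>T\<^esub> w) = (\<Sum>w\<in>U. a w * L w)" if "finite U" "U \<subseteq> S" for U
        using that
      proof (induction U rule: finite_induct)
        case empty
        then show ?case by (simp add: L0)
      next
        case (insert w U)
        have "(\<Oplus>\<^bsub>T\<^esub>w\<in>insert w U. a w \<odot>\<^bsub>T\<^esub> w) =
            a w \<odot>\<^bsub>T\<^esub> w \<oplus>\<^bsub>T\<^esub> (\<Oplus>\<^bsub>T\<^esub>w\<in>U. a w \<odot>\<^bsub>T\<^esub> w)"
          using insert sc by (intro V.M.finsum_insert) auto
        moreover have "(\<Oplus>\<^bsub>T\<^esub>w\<in>U. a w \<odot>\<^bsub>T\<^esub> w) \<in> carrier T"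
          using insert sc by (intro V.M.finsum_closed) auto
        ultimately show ?case using insert sc Sc by (auto simp: L_add L_smult)
      qed
      then have "(\<Sum>w\<in>S. a w * L w) = 0"
        using S zero L0 unfolding V.lincomb_def by fastforce
      moreover have "(\<Sum>w\<in>S. a w * L w) = (\<Sum>w\<in>S. if w = v then a v else 0)"
      proof (rule sum.cong)
        fix w assume "w \<in> S"
        then obtain j where j: "j \<in> J" "w = ?v j" using S by auto
        then show "a w * L w = (if w = v then a v else 0)"
          using L[OF j(1)] L[OF i(1)] i by (cases "i = j") auto
      qed simp
      ultimately show False using S v by simp
    qed
  qed
  finally show ?thesis .
qed

end

section \<open>The rank of the group generated by the entries\<close>

context quantum_space
begin

abbreviation \<Lambda> :: "'a monoid" where "\<Lambda> \<equiv> lambda_group R n q"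

lemma comm_group_lambda: "comm_group \<Lambda>"
  unfolding lambda_group_def by (rule group.abelian_subgroup_generated[OF units_group units_comm_group])

lemma lambda_entry: "i \<in> {1..n} \<Longrightarrow> j \<in> {1..n} \<Longrightarrow> q i j \<in> carrier \<Lambda>"
  unfolding lambda_group_def carrier_subgroup_generated
  by (rule generate.incl) (auto simp: units_of_carrier)

lemma lambda_Units: "x \<in> carrier \<Lambda> \<Longrightarrow> x \<in> Units R"
  unfolding lambda_group_def
  using group.carrier_subgroup_generated_subset[OF units_group] by (auto simp: units_of_carrier)

lemma lambda_simps [simp]: "\<one>\<^bsub>\<Lambda>\<^esub> = \<one>" "x \<otimes>\<^bsub>\<Lambda>\<^esub> y = x \<otimes> y"
  by (simp_all add: lambda_group_def units_of_one units_of_mult)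

lemma lambda_inv: "x \<in> carrier \<Lambda> \<Longrightarrow> inv\<^bsub>\<Lambda>\<^esub> x = inv x"
  using lambda_Units[of x] group.inv_subgroup_generated[OF units_group]
  by (simp add: lambda_group_def units_of_inv)

lemma lambda_pow: "x \<in> carrier \<Lambda> \<Longrightarrow> x [^]\<^bsub>\<Lambda>\<^esub> (m::nat) = x [^] m"
  using lambda_Units[of x] by (simp add: lambda_group_def pow_subgroup_generated units_of_pow)

lemma lambda_subgroup_Units:
  assumes "subgroup H \<Lambda>"
  shows "subgroup H (units_of R)"
  using assms unfolding lambda_group_def
  by (simp add: group.subgroup_subgroup_generated_iff[OF units_group])

lemma lambda_subset:
  assumes "subgroup H \<Lambda>" "\<And>i j. i \<in> {1..n} \<Longrightarrow> j \<in> {1..n} \<Longrightarrow> q i j \<in> H"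
  shows "carrier \<Lambda> \<subseteq> H"
  unfolding lambda_group_def
  using lambda_subgroup_Units[OF assms(1)] assms(2)
  by (intro group.subgroup_generated_minimal[OF units_group]) auto

text \<open>
  A subgroup that is closed under roots and contains the entries \<open>q\<^sub>i\<^sub>j\<close> with \<open>i < j\<close> and \<open>i, j \<noteq> k\<close> contains
  the group of the minor, hence by dependence also row and column \<open>k\<close>. The pairs \<open>i < j\<close> are counted as
  two-element subsets, with \<open>i\<close> and \<open>j\<close> their minimum and maximum.
\<close>

lemma lambda_rank_dependent:
  assumes k: "k \<in> {1..n}" and dep: "dependent_at k"
  shows "torsion_free_rank \<Lambda> \<le> (n - 1) choose 2"
proof -
  interpret L: comm_group \<Lambda> by (rule comm_group_lambda)
  let ?J = "{1..n} - {k}"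
  let ?P = "{B. B \<subseteq> ?J \<and> card B = 2}"
  let ?S = "(\<lambda>B. q (Min B) (Max B)) ` ?P"
  have finP: "finite ?P" by (rule finite_subset[of _ "Pow ?J"]) auto
  have mm: "Min B \<in> {1..n} \<and> Max B \<in> {1..n}" if "B \<in> ?P" for B
  proof -
    have "finite B" "B \<noteq> {}" using that by (auto intro: card_ge_0_finite)
    then have "Min B \<in> B" "Max B \<in> B" by auto
    with that show ?thesis by blast
  qed
  have "torsion_free_rank \<Lambda> \<le> card ?S"
  proof (rule L.torsion_free_rank_le(2))
    show "finite ?S" using finP by simp
    show "?S \<subseteq> carrier \<Lambda>" using mm lambda_entry by blast
    fix H assume H: "subgroup H \<Lambda>" and S: "?S \<subseteq> H"
      and isolated: "\<And>x m. \<lbrakk>x \<in> carrier \<Lambda>; 0 < m; x [^]\<^bsub>\<Lambda>\<^esub> (m::nat) \<in> H\<rbrakk> \<Longrightarrow> x \<in> H"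
    have upper: "q i j \<in> H" if "i \<in> ?J" "j \<in> ?J" "i < j" for i j
    proof -
      have "{i, j} \<in> ?P" using that by auto
      moreover have "Min {i, j} = i" "Max {i, j} = j" using that by auto
      ultimately have "q i j \<in> ?S" by (metis (mono_tags, lifting) image_eqI)
      with S show ?thesis by blast
    qed
    have swap: "q j i \<in> H" if "q i j \<in> H" "i \<in> {1..n}" "j \<in> {1..n}" for i j
      using subgroup.m_inv_closed[OF H that(1)] that lambda_inv[OF lambda_entry[OF that(2,3)]] q_inv[OF that(2,3)]
      by simp
    have J: "q i j \<in> H" if "i \<in> ?J" "j \<in> ?J" for i j
    proof (cases i j rule: linorder_cases)
      case less
      then show ?thesis using that upper by blast
    next
      case equal
      then show ?thesis using that q_diag[of i] subgroup.one_closed[OF H] by simp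
    next
      case greater
      then show ?thesis using that upper swap by blast
    qed
    have minor: "minor_group k \<subseteq> H"
      unfolding minor_group_def
      using J by (intro group.generate_subgroup_incl[OF units_group _ lambda_subgroup_Units[OF H]]) auto
    have kj: "q k j \<in> H" if j: "j \<in> {1..n}" for j
    proof -
      obtain m :: nat where "m > 0" "q k j [^] m \<in> minor_group k"
        using dep j unfolding dependent_at_def by blast
      then show ?thesis
        using isolated[OF lambda_entry[OF k j]] lambda_pow[OF lambda_entry[OF k j]] minor by auto
    qed
    show "carrier \<Lambda> \<subseteq> H"
    proof (rule lambda_subset[OF H])
      fix i j assume "i \<in> {1..n}" "j \<in> {1..n}"
      then show "q i j \<in> H" using J[of i j] kj[of j] swap[OF kj[of i]] k by (cases "i = k"; cases "j = k") auto
    qed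
  qed
  also have "\<dots> \<le> card ?P" using finP by (rule card_image_le)
  also have "\<dots> = (n - 1) choose 2"
    using n_subsets[of ?J 2] k by simp
  finally show ?thesis .
qed

theorem automorphisms_scalar_of_large_rank:
  assumes "torsion_free_rank \<Lambda> > (n - 1) choose 2"
  shows "carrier (quantum_Aut R n q) = scalar_automorphisms R n q"
  by (rule automorphisms_scalar) (use lambda_rank_dependent assms in fastforce)

end

section \<open>Affine substitutions for a central variable\<close>

text \<open>
  The inverse of a bijective homomorphism, for structures not known to be groups.
\<close>

lemma inv_into_iso:
  assumes \<theta>: "\<theta> \<in> hom G H" and bij: "bij_betw \<theta> (carrier G) (carrier H)"
    and closed: "\<And>x y. \<lbrakk>x \<in> carrier G; y \<in> carrier G\<rbrakk> \<Longrightarrow> x \<otimes>\<^bsub>G\<^esub> y \<in> carrier G"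
  shows "H \<cong> G"
proof -
  let ?\<psi> = "inv_into (carrier G) \<theta>"
  have b: "bij_betw ?\<psi> (carrier H) (carrier G)" using bij by (rule bij_betw_inv_into)
  have "?\<psi> \<in> hom H G"
  proof (rule homI)
    show c: "?\<psi> x \<in> carrier G" if "x \<in> carrier H" for x
      using b that by (auto simp: bij_betw_def)
    fix x y assume xy: "x \<in> carrier H" "y \<in> carrier H"
    have "x \<otimes>\<^bsub>H\<^esub> y = \<theta> (?\<psi> x \<otimes>\<^bsub>G\<^esub> ?\<psi> y)"
      using hom_mult[OF \<theta> c[OF xy(1)] c[OF xy(2)]] bij xy by (simp add: bij_betw_inv_into_right)
    then show "?\<psi> (x \<otimes>\<^bsub>H\<^esub> y) = ?\<psi> x \<otimes>\<^bsub>G\<^esub> ?\<psi> y"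
      using bij closed c xy by (simp add: bij_betw_inv_into_left)
  qed
  with b show ?thesis by (auto simp: is_iso_def iso_def)
qed

locale central_quantum_space = quantum_space +
  fixes k :: nat
  assumes k: "k \<in> {1..n}" and central: "\<And>j. j \<in> {1..n} \<Longrightarrow> q k j = \<one>"
begin

abbreviation SD :: "('a \<times> (nat \<Rightarrow> 'a)) monoid"
  where "SD \<equiv> semidirect_product (add_monoid R) (torus R n) (\<lambda>t b. t k \<otimes> b)"

lemma torus_carrier: "t \<in> carrier (torus R n) \<longleftrightarrow> t \<in> extensional {1..n} \<and> (\<forall>i\<in>{1..n}. t i \<in> Units R)"
  by (auto simp: torus_def product_group_def units_of_carrier PiE_def extensional_def)

lemma torus_mult: "t \<otimes>\<^bsub>torus R n\<^esub> u = (\<lambda>i\<in>{1..n}. t i \<otimes> u i)"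
  by (simp add: torus_def units_of_mult)

lemma SD_carrier: "carrier SD = carrier R \<times> carrier (torus R n)"
  by (simp add: semidirect_product_def)

lemma SD_mult: "(a, t) \<otimes>\<^bsub>SD\<^esub> (b, u) = (a \<oplus> t k \<otimes> b, (\<lambda>i\<in>{1..n}. t i \<otimes> u i))"
  by (simp add: semidirect_product_def torus_mult)

lemma SD_closed: "x \<in> carrier SD \<Longrightarrow> y \<in> carrier SD \<Longrightarrow> x \<otimes>\<^bsub>SD\<^esub> y \<in> carrier SD"
  using k by (cases x, cases y) (auto simp: SD_mult SD_carrier torus_carrier Units_closed)

text \<open>
  The substitution \<open>X\<^sub>k \<mapsto> t\<^sub>k\<inverse> (X\<^sub>k + b)\<close>, \<open>X\<^sub>i \<mapsto> t\<^sub>i\<inverse> X\<^sub>i\<close>. With the inverses of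
  the \<open>t\<^sub>i\<close>, the composite of the substitutions for \<open>(a, t)\<close> and \<open>(b, u)\<close> is
  \<open>X\<^sub>k \<mapsto> u\<^sub>k\<inverse> (t\<^sub>k\<inverse> (X\<^sub>k + a) + b) = (t\<^sub>k u\<^sub>k)\<inverse> (X\<^sub>k + a + t\<^sub>k b)\<close>, which is the multiplication of
  the semidirect product.
\<close>

definition affine_image :: "'a \<Rightarrow> (nat \<Rightarrow> 'a) \<Rightarrow> nat \<Rightarrow> (nat list \<Rightarrow> 'a) set"
  where "affine_image b t i =
    inv (t i) \<odot>\<^bsub>Q\<^esub> (if i = k then X k \<oplus>\<^bsub>Q\<^esub> b \<odot>\<^bsub>Q\<^esub> \<one>\<^bsub>Q\<^esub> else X i)"

lemma affine_image_closed:
  assumes "b \<in> carrier R" "t \<in> carrier (torus R n)" "i \<in> {1..n}"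
  shows "affine_image b t i \<in> carrier Q"
  using assms k by (auto simp: affine_image_def torus_carrier)

text \<open>
  A translation of \<open>X\<^sub>k\<close> respects the relations because \<open>X\<^sub>k\<close> and scalars are both central.
\<close>

lemma affine_image_relation:
  assumes b: "b \<in> carrier R" and t: "t \<in> carrier (torus R n)" and ij: "i \<in> {1..n}" "j \<in> {1..n}" "i \<noteq> j"
  shows "affine_image b t i \<otimes>\<^bsub>Q\<^esub> affine_image b t j = q i j \<odot>\<^bsub>Q\<^esub> (affine_image b t j \<otimes>\<^bsub>Q\<^esub> affine_image b t i)"
proof -
  let ?y = "\<lambda>i. if i = k then X k \<oplus>\<^bsub>Q\<^esub> b \<odot>\<^bsub>Q\<^esub> \<one>\<^bsub>Q\<^esub> else X i"
  have y: "?y i \<in> carrier Q" "?y j \<in> carrier Q" using ij k b by auto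
  have s: "inv (t i) \<in> carrier R" "inv (t j) \<in> carrier R" using t ij by (auto simp: torus_carrier)
  have commute: "(X k \<oplus>\<^bsub>Q\<^esub> b \<odot>\<^bsub>Q\<^esub> \<one>\<^bsub>Q\<^esub>) \<otimes>\<^bsub>Q\<^esub> X l = X l \<otimes>\<^bsub>Q\<^esub> (X k \<oplus>\<^bsub>Q\<^esub> b \<odot>\<^bsub>Q\<^esub> \<one>\<^bsub>Q\<^esub>)"
    if l: "l \<in> {1..n}" for l
    using X_relation[OF k l] central[OF l] k l b
    by (simp add: Q.l_distr Q.r_distr Q.smult_mult_left Q.smult_mult_right)
  have qik: "q i k = \<one>" if "i \<in> {1..n}" for i using q_inv[OF k that] central[OF that] by simp
  have rel: "?y i \<otimes>\<^bsub>Q\<^esub> ?y j = q i j \<odot>\<^bsub>Q\<^esub> (?y j \<otimes>\<^bsub>Q\<^esub> ?y i)"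
  proof (cases "i = k")
    case True
    then show ?thesis using commute[OF ij(2)] central[OF ij(2)] ij y by auto
  next
    case False
    then show ?thesis
      using commute[OF ij(1)] qik[OF ij(1)] X_relation[OF ij(1,2)] ij y by (cases "j = k") auto
  qed
  have "affine_image b t i \<otimes>\<^bsub>Q\<^esub> affine_image b t j = (inv (t j) \<otimes> inv (t i)) \<odot>\<^bsub>Q\<^esub> (?y i \<otimes>\<^bsub>Q\<^esub> ?y j)"
    using y s unfolding affine_image_def
    by (simp only: Q.smult_mult_left Q.smult_mult_right Q.smult_assoc1 Q.smult_closed Q.m_closed)
  also have "\<dots> = (q i j \<otimes> (inv (t i) \<otimes> inv (t j))) \<odot>\<^bsub>Q\<^esub> (?y j \<otimes>\<^bsub>Q\<^esub> ?y i)"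
    unfolding rel using y s ij by (subst Q.smult_assoc1[symmetric]) (auto simp: m_ac)
  also have "\<dots> = q i j \<odot>\<^bsub>Q\<^esub> (affine_image b t j \<otimes>\<^bsub>Q\<^esub> affine_image b t i)"
    using y s q_closed[OF ij(1,2)] unfolding affine_image_def
    by (simp only: Q.smult_mult_left Q.smult_mult_right Q.smult_assoc1 Q.smult_closed Q.m_closed m_closed)
  finally show ?thesis .
qed

definition affine_map :: "'a \<times> (nat \<Rightarrow> 'a) \<Rightarrow> (nat list \<Rightarrow> 'a) set \<Rightarrow> (nat list \<Rightarrow> 'a) set"
  where "affine_map p = (SOME h. h \<in> algebra_hom R Q Q \<inter> extensional (carrier Q) \<and>
    (\<forall>i\<in>{1..n}. h (X i) = affine_image (fst p) (snd p) i))"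

lemma affine_map:
  assumes "p \<in> carrier SD"
  shows "affine_map p \<in> algebra_hom R Q Q" "affine_map p \<in> extensional (carrier Q)"
    "\<And>i. i \<in> {1..n} \<Longrightarrow> affine_map p (X i) = affine_image (fst p) (snd p) i"
proof -
  obtain b t where p: "p = (b, t)" "b \<in> carrier R" "t \<in> carrier (torus R n)"
    using assms by (auto simp: SD_carrier)
  obtain h where h: "h \<in> algebra_hom R Q Q" "\<And>i. i \<in> {1..n} \<Longrightarrow> h (X i) = affine_image b t i"
  proof (rule quantum_lift[OF Q.unital_algebra_axioms, of "affine_image b t"])
    show "affine_image b t i \<in> carrier Q" if "i \<in> {1..n}" for i
      using p(2,3) that by (rule affine_image_closed)
    show "affine_image b t i \<otimes>\<^bsub>Q\<^esub> affine_image b t j =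
        q i j \<odot>\<^bsub>Q\<^esub> (affine_image b t j \<otimes>\<^bsub>Q\<^esub> affine_image b t i)"
      if "1 \<le> i" "i < j" "j \<le> n" for i j
      by (rule affine_image_relation[OF p(2,3)]) (use that in auto)
  qed blast
  have "restrict h (carrier Q) (X i) = affine_image (fst p) (snd p) i" if "i \<in> {1..n}" for i
    using h(2)[OF that] that p(1) by simp
  then have "restrict h (carrier Q) \<in> algebra_hom R Q Q \<inter> extensional (carrier Q) \<and>
      (\<forall>i\<in>{1..n}. restrict h (carrier Q) (X i) = affine_image (fst p) (snd p) i)"
    using Q.restrict_algebra_hom[OF h(1)] by blast
  then have *: "affine_map p \<in> algebra_hom R Q Q \<inter> extensional (carrier Q) \<and>
      (\<forall>i\<in>{1..n}. affine_map p (X i) = affine_image (fst p) (snd p) i)"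
    unfolding affine_map_def
    by (rule someI[where P = "\<lambda>h. h \<in> algebra_hom R Q Q \<inter> extensional (carrier Q) \<and>
      (\<forall>i\<in>{1..n}. h (X i) = affine_image (fst p) (snd p) i)"])
  show "affine_map p \<in> algebra_hom R Q Q" by (rule IntD1[OF conjunct1[OF *]])
  show "affine_map p \<in> extensional (carrier Q)" by (rule IntD2[OF conjunct1[OF *]])
  show "affine_map p (X i) = affine_image (fst p) (snd p) i" if "i \<in> {1..n}" for i
    using bspec[OF conjunct2[OF *] that] .
qed

text \<open>
  An extensional homomorphism is determined by the images of the variables, so identities between
  substitutions are checked on variables.
\<close>

lemma affine_map_unique:
  assumes p: "p \<in> carrier SD" and h: "h \<in> algebra_hom R Q Q" "h \<in> extensional (carrier Q)"
    and eq: "\<And>i. i \<in> {1..n} \<Longrightarrow> h (X i) = affine_image (fst p) (snd p) i"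
  shows "affine_map p = h"
proof (rule extensionalityI[OF affine_map(2)[OF p] h(2)])
  fix C assume C: "C \<in> carrier Q"
  have "affine_map p (X i) = h (X i)" if "i \<in> {1..n}" for i
    unfolding affine_map(3)[OF p that] eq[OF that] ..
  then show "affine_map p C = h C"
    by (rule algebra_hom_eqI[OF affine_map(1)[OF p] h(1) _ C])
qed

lemma affine_map_mult:
  assumes x: "x \<in> carrier SD" and y: "y \<in> carrier SD"
  shows "affine_map (x \<otimes>\<^bsub>SD\<^esub> y) = compose (carrier Q) (affine_map x) (affine_map y)"
proof (rule affine_map_unique[OF SD_closed[OF x y]])
  show "compose (carrier Q) (affine_map x) (affine_map y) \<in> algebra_hom R Q Q"
    using affine_map[OF x] affine_map[OF y] by (intro Q.compose_algebra_hom)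
  show "compose (carrier Q) (affine_map x) (affine_map y) \<in> extensional (carrier Q)"
    by (rule compose_extensional)
  fix i assume i: "i \<in> {1..n}"
  obtain a t where xe: "x = (a, t)" "a \<in> carrier R" "t \<in> carrier (torus R n)" using x by (auto simp: SD_carrier)
  obtain b u where ye: "y = (b, u)" "b \<in> carrier R" "u \<in> carrier (torus R n)" using y by (auto simp: SD_carrier)
  note hom = algebra_homD[OF affine_map(1)[OF x]]
  have x_X: "affine_map x (X l) = affine_image a t l" if "l \<in> {1..n}" for l
    using affine_map(3)[OF x that] xe by simp
  have t: "t l \<in> Units R" "u l \<in> Units R" if "l \<in> {1..n}" for l
    using that xe ye by (auto simp: torus_carrier)
  have [simp]: "inv (t l) \<in> carrier R" "inv (u l) \<in> carrier R" "t l \<in> carrier R" "u l \<in> carrier R"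
    if "l \<in> {1..n}" for l using t[OF that] by (auto simp: Units_closed)
  have inv: "inv (t l \<otimes> u l) = inv (t l) \<otimes> inv (u l)" if "l \<in> {1..n}" for l
  proof (rule comm_inv_char)
    have "t l \<otimes> u l \<otimes> (inv (t l) \<otimes> inv (u l)) = (t l \<otimes> inv (t l)) \<otimes> (u l \<otimes> inv (u l))"
      using that by (simp add: m_ac)
    then show "t l \<otimes> u l \<otimes> (inv (t l) \<otimes> inv (u l)) = \<one>" using t[OF that] by simp
  qed (use that in simp_all)
  have "compose (carrier Q) (affine_map x) (affine_map y) (X i) = affine_map x (affine_image b u i)"
    using i affine_map(3)[OF y i] ye by (simp add: compose_eq)
  also have "\<dots> = affine_image (a \<oplus> t k \<otimes> b) (\<lambda>i\<in>{1..n}. t i \<otimes> u i) i"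
  proof (cases "i = k")
    case True
    have "affine_map x (affine_image b u k) =
        inv (u k) \<odot>\<^bsub>Q\<^esub> (inv (t k) \<odot>\<^bsub>Q\<^esub> (X k \<oplus>\<^bsub>Q\<^esub> a \<odot>\<^bsub>Q\<^esub> \<one>\<^bsub>Q\<^esub>) \<oplus>\<^bsub>Q\<^esub> b \<odot>\<^bsub>Q\<^esub> \<one>\<^bsub>Q\<^esub>)"
      using k ye(2) x_X[OF k] unfolding affine_image_def[of b u k]
      by (simp add: hom affine_image_def)
    also have "b \<odot>\<^bsub>Q\<^esub> \<one>\<^bsub>Q\<^esub> = inv (t k) \<odot>\<^bsub>Q\<^esub> ((t k \<otimes> b) \<odot>\<^bsub>Q\<^esub> \<one>\<^bsub>Q\<^esub>)"
      using k ye t[OF k] by (simp add: Q.smult_assoc1[symmetric] m_assoc[symmetric])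
    also have "inv (t k) \<odot>\<^bsub>Q\<^esub> (X k \<oplus>\<^bsub>Q\<^esub> a \<odot>\<^bsub>Q\<^esub> \<one>\<^bsub>Q\<^esub>) \<oplus>\<^bsub>Q\<^esub> inv (t k) \<odot>\<^bsub>Q\<^esub> ((t k \<otimes> b) \<odot>\<^bsub>Q\<^esub> \<one>\<^bsub>Q\<^esub>)
        = inv (t k) \<odot>\<^bsub>Q\<^esub> (X k \<oplus>\<^bsub>Q\<^esub> (a \<oplus> t k \<otimes> b) \<odot>\<^bsub>Q\<^esub> \<one>\<^bsub>Q\<^esub>)"
      using k xe ye by (simp add: Q.smult_r_distr Q.smult_l_distr Q.a_assoc)
    also have "inv (u k) \<odot>\<^bsub>Q\<^esub> \<dots> = affine_image (a \<oplus> t k \<otimes> b) (\<lambda>i\<in>{1..n}. t i \<otimes> u i) k"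
      using k xe ye inv[OF k] by (simp add: affine_image_def Q.smult_assoc1[symmetric] m_comm)
    finally show ?thesis using True by simp
  next
    case False
    have "affine_map x (affine_image b u i) = inv (u i) \<odot>\<^bsub>Q\<^esub> (inv (t i) \<odot>\<^bsub>Q\<^esub> X i)"
      using i False x_X[OF i] unfolding affine_image_def[of b u i]
      by (simp add: hom affine_image_def)
    also have "\<dots> = affine_image (a \<oplus> t k \<otimes> b) (\<lambda>i\<in>{1..n}. t i \<otimes> u i) i"
      using i False inv[OF i] by (simp add: affine_image_def Q.smult_assoc1[symmetric] m_comm)
    finally show ?thesis .
  qed
  finally show "compose (carrier Q) (affine_map x) (affine_map y) (X i) =
      affine_image (fst (x \<otimes>\<^bsub>SD\<^esub> y)) (snd (x \<otimes>\<^bsub>SD\<^esub> y)) i"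
    using xe ye by (simp add: SD_mult)
qed

lemma SD_one: "\<one>\<^bsub>SD\<^esub> = (\<zero>, (\<lambda>i\<in>{1..n}. \<one>))" "\<one>\<^bsub>SD\<^esub> \<in> carrier SD"
  by (simp_all add: semidirect_product_def torus_def product_group_def units_of_one units_of_carrier)

lemma affine_map_one: "affine_map \<one>\<^bsub>SD\<^esub> = (\<lambda>C\<in>carrier Q. C)"
proof (rule affine_map_unique[OF SD_one(2)])
  show "(\<lambda>C\<in>carrier Q. C) \<in> algebra_hom R Q Q" by (rule algebra_homI) auto
  fix i assume "i \<in> {1..n}"
  then show "(\<lambda>C\<in>carrier Q. C) (X i) = affine_image (fst \<one>\<^bsub>SD\<^esub>) (snd \<one>\<^bsub>SD\<^esub>) i"
    using k by (simp add: SD_one affine_image_def Q.smult_zero_l)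
qed simp

lemma SD_inverse:
  assumes "x \<in> carrier SD"
  obtains y where "y \<in> carrier SD" "x \<otimes>\<^bsub>SD\<^esub> y = \<one>\<^bsub>SD\<^esub>" "y \<otimes>\<^bsub>SD\<^esub> x = \<one>\<^bsub>SD\<^esub>"
proof -
  obtain b t where x: "x = (b, t)" "b \<in> carrier R" "t \<in> carrier (torus R n)" using assms by (auto simp: SD_carrier)
  let ?y = "(\<ominus> (inv (t k) \<otimes> b), \<lambda>i\<in>{1..n}. inv (t i))"
  have t: "t l \<in> Units R" if "l \<in> {1..n}" for l using that x by (auto simp: torus_carrier)
  have tk: "t k \<otimes> (inv (t k) \<otimes> b) = b"
    using t[OF k] x by (simp add: m_assoc[symmetric] Units_closed)
  show ?thesis
  proof
    show "?y \<in> carrier SD" using x t k by (auto simp: SD_carrier torus_carrier)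
    show "x \<otimes>\<^bsub>SD\<^esub> ?y = \<one>\<^bsub>SD\<^esub>"
      using x t k tk by (auto simp: SD_mult SD_one r_minus r_neg Units_closed intro!: restrict_ext)
    show "?y \<otimes>\<^bsub>SD\<^esub> x = \<one>\<^bsub>SD\<^esub>"
      using x t k by (auto simp: SD_mult SD_one l_neg Units_closed intro!: restrict_ext)
  qed
qed

lemma affine_map_auto:
  assumes x: "x \<in> carrier SD"
  shows "affine_map x \<in> algebra_auto R Q"
proof -
  obtain y where y: "y \<in> carrier SD" "x \<otimes>\<^bsub>SD\<^esub> y = \<one>\<^bsub>SD\<^esub>" "y \<otimes>\<^bsub>SD\<^esub> x = \<one>\<^bsub>SD\<^esub>"
    using SD_inverse[OF x] .
  have c: "compose (carrier Q) (affine_map x) (affine_map y) = (\<lambda>C\<in>carrier Q. C)"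
    using affine_map_mult[OF x y(1)] unfolding y(2) affine_map_one by (rule sym)
  have c': "compose (carrier Q) (affine_map y) (affine_map x) = (\<lambda>C\<in>carrier Q. C)"
    using affine_map_mult[OF y(1) x] unfolding y(3) affine_map_one by (rule sym)
  have inverse: "affine_map x (affine_map y C) = C" "affine_map y (affine_map x C) = C" if "C \<in> carrier Q" for C
    using fun_cong[OF c, of C] fun_cong[OF c', of C] that by (simp_all add: compose_eq)
  have "bij_betw (affine_map x) (carrier Q) (carrier Q)"
    by (rule bij_betw_byWitness[of _ "affine_map y"])
      (use inverse algebra_homD(1)[OF affine_map(1)[OF x]] algebra_homD(1)[OF affine_map(1)[OF y(1)]] in auto)
  then show ?thesis using affine_map[OF x] by (simp add: algebra_auto_eq Bij_def)
qed

lemma coeff_affine_image: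
  assumes "b \<in> carrier R" "t \<in> carrier (torus R n)" "i \<in> {1..n}"
  shows "coeff (affine_image b t i) {#i#} = inv (t i)"
    "coeff (affine_image b t k) {#} = inv (t k) \<otimes> b"
  using assms k by (auto simp: affine_image_def torus_carrier coeff_smult coeff_add coeff_X coeff_one)

text \<open>
  The scalars \<open>t\<^sub>i\<close> and \<open>b\<close> are read off from the coefficients of \<open>X\<^sub>i\<close> and of \<open>1\<close> in the images of the
  variables.
\<close>

lemma affine_map_inj: "inj_on affine_map (carrier SD)"
proof (rule inj_onI)
  fix x y assume x: "x \<in> carrier SD" and y: "y \<in> carrier SD" and eq: "affine_map x = affine_map y"
  obtain a t where xe: "x = (a, t)" "a \<in> carrier R" "t \<in> carrier (torus R n)" using x by (auto simp: SD_carrier)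
  obtain b u where ye: "y = (b, u)" "b \<in> carrier R" "u \<in> carrier (torus R n)" using y by (auto simp: SD_carrier)
  have im: "affine_image a t i = affine_image b u i" if "i \<in> {1..n}" for i
    using affine_map(3)[OF x that] affine_map(3)[OF y that] eq xe ye by simp
  have tu: "t i = u i" if i: "i \<in> {1..n}" for i
  proof -
    have "inv (t i) = inv (u i)"
      using coeff_affine_image(1)[OF xe(2,3) i] coeff_affine_image(1)[OF ye(2,3) i] im[OF i] by simp
    moreover have "t i \<in> Units R" "u i \<in> Units R" using xe ye i by (auto simp: torus_carrier)
    ultimately show ?thesis using Units_inv_inv by metis
  qed
  then have "t = u" using xe ye by (auto simp: torus_carrier intro: extensionalityI)
  moreover have "inv (t k) \<otimes> a = inv (t k) \<otimes> b"
    using coeff_affine_image(2)[OF xe(2,3) k] coeff_affine_image(2)[OF ye(2,3) k] im[OF k] tu[OF k] by simp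
  then have "a = b"
    using Units_l_cancel[of "inv (t k)" a b] xe ye k by (auto simp: torus_carrier)
  ultimately show "x = y" using xe ye by simp
qed

theorem affine_subgroup:
  "subgroup (affine_map ` carrier SD) (quantum_Aut R n q)"
  "(quantum_Aut R n q)\<lparr>carrier := affine_map ` carrier SD\<rparr> \<cong> SD"
proof -
  interpret Aut: group "quantum_Aut R n q" by (rule Q.group_AlgAutGroup)
  have mult: "affine_map x \<otimes>\<^bsub>quantum_Aut R n q\<^esub> affine_map y = affine_map (x \<otimes>\<^bsub>SD\<^esub> y)"
    if "x \<in> carrier SD" "y \<in> carrier SD" for x y
    using affine_map_mult[OF that] affine_map_auto that by simp
  show "subgroup (affine_map ` carrier SD) (quantum_Aut R n q)"
  proof (rule Aut.subgroupI)
    show "affine_map ` carrier SD \<subseteq> carrier (quantum_Aut R n q)" using affine_map_auto by auto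
    show "affine_map ` carrier SD \<noteq> {}" using SD_one(2) by blast
  next
    fix g assume "g \<in> affine_map ` carrier SD"
    then obtain x where x: "x \<in> carrier SD" "g = affine_map x" by blast
    obtain y where y: "y \<in> carrier SD" "y \<otimes>\<^bsub>SD\<^esub> x = \<one>\<^bsub>SD\<^esub>" using SD_inverse[OF x(1)] .
    have "inv\<^bsub>quantum_Aut R n q\<^esub> g = affine_map y"
      using x y mult[OF y(1) x(1)] affine_map_one affine_map_auto by (intro Aut.inv_equality) auto
    then show "inv\<^bsub>quantum_Aut R n q\<^esub> g \<in> affine_map ` carrier SD" using y by blast
  next
    fix g h assume "g \<in> affine_map ` carrier SD" "h \<in> affine_map ` carrier SD"
    then show "g \<otimes>\<^bsub>quantum_Aut R n q\<^esub> h \<in> affine_map ` carrier SD"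
      using mult SD_closed by auto
  qed
  show "(quantum_Aut R n q)\<lparr>carrier := affine_map ` carrier SD\<rparr> \<cong> SD"
  proof (rule inv_into_iso)
    show "affine_map \<in> hom SD ((quantum_Aut R n q)\<lparr>carrier := affine_map ` carrier SD\<rparr>)"
      by (rule homI) (auto simp: mult)
    show "bij_betw affine_map (carrier SD) (carrier ((quantum_Aut R n q)\<lparr>carrier := affine_map ` carrier SD\<rparr>))"
      using affine_map_inj by (simp add: bij_betw_def)
  qed (rule SD_closed)
qed

lemma exists_nonscalar_automorphism:
  "carrier (quantum_Aut R n q) \<noteq> scalar_automorphisms R n q"
proof
  assume eq: "carrier (quantum_Aut R n q) = scalar_automorphisms R n q"
  let ?x = "(\<one>, \<lambda>i\<in>{1..n}. \<one>)"
  have x: "?x \<in> carrier SD" by (auto simp: SD_carrier torus_carrier)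
  then have "affine_map ?x \<in> scalar_automorphisms R n q" using affine_map_auto[OF x] eq by simp
  then obtain t where t: "t \<in> carrier (torus R n)" "affine_map ?x (X k) = t k \<odot>\<^bsub>Q\<^esub> X k"
    using k unfolding scalar_automorphisms_def by blast
  have "coeff (affine_map ?x (X k)) {#} = \<one>"
    using affine_map(3)[OF x k] coeff_affine_image(2)[of \<one> "snd ?x" k] x k by (simp add: SD_carrier)
  moreover have "coeff (t k \<odot>\<^bsub>Q\<^esub> X k) {#} = \<zero>"
    using t k by (simp add: torus_carrier coeff_smult coeff_X Units_closed)
  ultimately show False using t by simp
qed

end

section \<open>Matrices of primes\<close>

lemma Units_class_ring: "Units (class_ring :: 'a::field ring) = - {0}"
  using field.field_Units[OF class_field] by auto

lemma inv_class_ring: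
  fixes x :: "'a::field"
  assumes "x \<noteq> 0"
  shows "inv\<^bsub>class_ring\<^esub> x = inverse x"
proof -
  have "comm_monoid (class_ring :: 'a ring)"
    by (intro cring.axioms(2) domain.axioms(1) field.axioms(1) class_field)
  then show ?thesis using assms by (intro comm_monoid.comm_inv_char) auto
qed

lemma pow_class_ring:
  fixes x :: "'a::field"
  shows "x [^]\<^bsub>class_ring\<^esub> (m::nat) = x ^ m"
proof -
  interpret F: field "class_ring :: 'a ring" by (rule class_field)
  show ?thesis by (induction m) (simp_all add: mult.commute)
qed

text \<open>
  Moving negative powers to the other side gives an equation between natural numbers, to which unique
  factorisation applies.
\<close>

lemma prime_power_product_injective:
  fixes p :: "'i \<Rightarrow> nat" and z :: "'i \<Rightarrow> int"
  assumes S: "finite S" and p: "\<And>i. i \<in> S \<Longrightarrow> prime (p i)" "inj_on p S"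
    and one: "(\<Prod>i\<in>S. (of_nat (p i) :: complex) powi z i) = 1" and i: "i \<in> S"
  shows "z i = 0"
proof -
  have nz: "(of_nat (p j) :: complex) \<noteq> 0" if "j \<in> S" for j
    using p(1)[OF that] by auto
  have "(of_nat (p j) :: complex) powi z j * of_nat (p j) ^ nat (- z j) = of_nat (p j) ^ nat (z j)"
    if "j \<in> S" for j
    using nz[OF that] by (cases "z j \<ge> 0") (auto simp: power_int_def power_inverse field_simps)
  then have "(\<Prod>j\<in>S. (of_nat (p j) :: complex) powi z j) * (\<Prod>j\<in>S. of_nat (p j) ^ nat (- z j)) =
      (\<Prod>j\<in>S. of_nat (p j) ^ nat (z j))"
    by (simp flip: prod.distrib)
  then have "(of_nat (\<Prod>j\<in>S. p j ^ nat (- z j)) :: complex) = of_nat (\<Prod>j\<in>S. p j ^ nat (z j))"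
    using one by simp
  then have eq: "(\<Prod>j\<in>S. p j ^ nat (- z j)) = (\<Prod>j\<in>S. p j ^ nat (z j))"
    by (simp only: of_nat_eq_iff)
  have mult: "multiplicity (p i) (\<Prod>j\<in>S. p j ^ a j) = a i" for a :: "'i \<Rightarrow> nat"
  proof -
    have "(\<Prod>j\<in>S. p j ^ a j) = (\<Prod>x\<in>p ` S. x ^ a (inv_into S p x))"
      using p(2) by (subst prod.reindex) (auto intro!: prod.cong simp: inv_into_f_f)
    also have "multiplicity (p i) \<dots> = (if p i \<in> p ` S then a (inv_into S p (p i)) else 0)"
      by (rule multiplicity_prod_prime_powers) (use S p i in auto)
    also have "\<dots> = a i" using p i by (simp add: inv_into_f_f)
    finally show ?thesis .
  qed
  have "nat (- z i) = nat (z i)" using mult[of "\<lambda>j. nat (- z j)"] mult[of "\<lambda>j. nat (z j)"] eq by simp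
  then show ?thesis by linarith
qed

text \<open>
  The \<open>r\<close> primes \<open>p m\<close> are placed at the positions \<open>\<iota> m\<close>, which are distinct pairs that avoid \<open>1\<close>; every other
  entry above the diagonal is \<open>1\<close>. In particular the first variable is central.
\<close>

locale prime_matrix =
  fixes n r :: nat and \<iota> :: "nat \<Rightarrow> nat set" and p :: "nat \<Rightarrow> nat"
  assumes n: "1 \<le> n"
    and \<iota>: "\<And>m. m \<in> {1..r} \<Longrightarrow> \<iota> m \<subseteq> {2..n} \<and> card (\<iota> m) = 2" "inj_on \<iota> {1..r}"
    and p: "\<And>m. prime (p m)" "inj p"
begin

text \<open>
  The entry at a position: a product with one factor if the position is used, and the empty product
  otherwise.
\<close>

definition weight :: "nat set \<Rightarrow> complex"
  where "weight B = (\<Prod>m\<in>{m \<in> {1..r}. \<iota> m = B}. of_nat (p m))"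

definition q :: "nat \<Rightarrow> nat \<Rightarrow> complex"
  where "q i j = (if i < j then weight {i, j} else if j < i then inverse (weight {i, j}) else 1)"

lemma weight_nonzero: "weight B \<noteq> 0"
proof -
  have "p m \<noteq> 0" for m using p(1)[of m] by auto
  then show ?thesis by (simp add: weight_def)
qed

lemma weight_index: "m \<in> {1..r} \<Longrightarrow> weight (\<iota> m) = of_nat (p m)"
proof -
  assume m: "m \<in> {1..r}"
  then have "{l \<in> {1..r}. \<iota> l = \<iota> m} = {m}" using inj_onD[OF \<iota>(2)] by blast
  then show ?thesis unfolding weight_def by (simp only:) simp
qed

lemma weight_trivial: "\<not> B \<subseteq> {2..n} \<Longrightarrow> weight B = 1"
proof -
  assume "\<not> B \<subseteq> {2..n}"
  then have "{m \<in> {1..r}. \<iota> m = B} = {}" using \<iota>(1) by blast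
  then show ?thesis unfolding weight_def by (simp only:) simp
qed

lemma q_nonzero: "q i j \<noteq> 0"
  using weight_nonzero by (simp add: q_def)

lemma mult_antisymmetric_q: "mult_antisymmetric (class_ring :: complex ring) n q"
proof -
  have inverse: "q j i = inverse (q i j)" for i j by (auto simp: q_def insert_commute)
  show ?thesis
    unfolding mult_antisymmetric_def
  proof (intro ballI conjI)
    fix i j
    show "q i j \<in> Units (class_ring :: complex ring)" using q_nonzero by (simp add: Units_class_ring)
    show "q i i = \<one>\<^bsub>(class_ring :: complex ring)\<^esub>" by (simp add: q_def)
    show "q j i = inv\<^bsub>class_ring\<^esub> (q i j)"
      unfolding inv_class_ring[OF q_nonzero] by (rule inverse)
  qed
qed

lemma q_central: "j \<in> {1..n} \<Longrightarrow> q 1 j = 1"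
  using weight_trivial[of "{1, j}"] by (auto simp: q_def)

lemma central: "central_quantum_space (class_ring :: complex ring) n q 1"
proof -
  interpret F: field "class_ring :: complex ring" by (rule class_field)
  show ?thesis
    by unfold_locales (use mult_antisymmetric_q q_central n in auto)
qed

abbreviation L :: "complex monoid" where "L \<equiv> lambda_group (class_ring :: complex ring) n q"
abbreviation Z :: "(nat \<Rightarrow> int) monoid" where "Z \<equiv> product_group {1..r} (\<lambda>_. integer_group)"

definition prime_product :: "(nat \<Rightarrow> int) \<Rightarrow> complex"
  where "prime_product z = (\<Prod>m\<in>{1..r}. of_nat (p m) powi z m)"

lemma quantum_space: "quantum_space (class_ring :: complex ring) n q"
  using central by (rule central_quantum_space.axioms)

lemmas lambda_facts =
  quantum_space.comm_group_lambda[OF quantum_space]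
  quantum_space.lambda_entry[OF quantum_space]
  quantum_space.lambda_Units[OF quantum_space]
  quantum_space.lambda_inv[OF quantum_space]
  quantum_space.lambda_pow[OF quantum_space]
  quantum_space.lambda_subset[OF quantum_space]

lemma L_nonzero: "x \<in> carrier L \<Longrightarrow> x \<noteq> 0"
  using lambda_facts(3)[of x] by (simp add: Units_class_ring)

lemma L_simps [simp]: "\<one>\<^bsub>L\<^esub> = 1" "x \<otimes>\<^bsub>L\<^esub> y = x * y"
  using quantum_space.lambda_simps[OF quantum_space] by simp_all

lemma p_in_L: "m \<in> {1..r} \<Longrightarrow> of_nat (p m) \<in> carrier L"
proof -
  assume m: "m \<in> {1..r}"
  obtain i j where ij: "\<iota> m = {i, j}" "i \<noteq> j" using \<iota>(1)[OF m] by (auto simp: card_2_iff)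
  define a b where "a = min i j" and "b = max i j"
  have ab: "\<iota> m = {a, b}" "a < b" using ij by (auto simp: a_def b_def min_def max_def)
  then have "q a b = of_nat (p m)" using weight_index[OF m] by (simp add: q_def)
  moreover have "a \<in> {1..n}" "b \<in> {1..n}" using \<iota>(1)[OF m] ab by auto
  ultimately show ?thesis using lambda_facts(2)[of a b] by simp
qed

lemma subgroup_powi:
  assumes H: "subgroup H L" and x: "x \<in> H"
  shows "x powi z \<in> H"
proof -
  have pow: "x ^ m \<in> H" for m
    by (induction m) (use subgroup.one_closed[OF H] subgroup.m_closed[OF H] x in auto)
  have "inverse y \<in> H" if y: "y \<in> H" for y
  proof -
    have "y \<in> carrier L" using subgroup.subset[OF H] y by blast
    then show ?thesis
      using subgroup.m_inv_closed[OF H y] lambda_facts(4)[of y] L_nonzero[of y] by (simp add: inv_class_ring)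
  qed
  with pow show ?thesis by (simp add: power_int_def power_inverse)
qed

lemma subgroup_prime_product:
  assumes H: "subgroup H L" and "\<And>m. m \<in> {1..r} \<Longrightarrow> of_nat (p m) \<in> H"
  shows "prime_product z \<in> H"
proof -
  have "(\<Prod>m\<in>S. of_nat (p m) powi z m) \<in> H" if "finite S" "S \<subseteq> {1..r}" for S
    using that
    by (induction S rule: finite_induct)
      (use subgroup.one_closed[OF H] subgroup.m_closed[OF H] subgroup_powi[OF H] assms(2) in auto)
  then show ?thesis by (simp add: prime_product_def)
qed

lemma prime_product_in_L: "prime_product z \<in> carrier L"
  using subgroup_prime_product[OF group.subgroup_self] lambda_facts(1) p_in_L by (auto simp: comm_group_def)

lemma prime_product_add: "prime_product (\<lambda>m\<in>{1..r}. z m + y m) = prime_product z * prime_product y"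
proof -
  have "p m \<noteq> 0" for m using p(1)[of m] by auto
  then show ?thesis
    unfolding prime_product_def prod.distrib[symmetric] by (intro prod.cong) (simp_all add: power_int_add)
qed

lemma weight_prime_product: "weight B = prime_product (\<lambda>m\<in>{1..r}. if \<iota> m = B then 1 else 0)"
  unfolding weight_def prime_product_def by (subst prod.inter_filter) (auto intro!: prod.cong)

lemma prime_product_minus: "prime_product (\<lambda>m\<in>{1..r}. - z m) = inverse (prime_product z)"
proof (rule inverse_unique[symmetric])
  have "prime_product z * prime_product (\<lambda>m\<in>{1..r}. - z m) = prime_product (\<lambda>m\<in>{1..r}. z m + (\<lambda>m\<in>{1..r}. - z m) m)"
    by (rule prime_product_add[symmetric])
  also have "\<dots> = 1" by (simp add: prime_product_def)
  finally show "prime_product z * prime_product (\<lambda>m\<in>{1..r}. - z m) = 1" .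
qed

lemma restrict_in_Z: "(\<lambda>m\<in>{1..r}. z m) \<in> carrier Z"
  by (simp only: carrier_product_group carrier_integer_group restrict_PiE_iff) blast

lemma q_in_range: "q i j \<in> prime_product ` carrier Z"
proof -
  have one: "1 \<in> prime_product ` carrier Z"
    by (rule image_eqI[of _ _ "\<lambda>m\<in>{1..r}. 0"]) (simp add: prime_product_def, rule restrict_in_Z)
  have weight: "weight B \<in> prime_product ` carrier Z" for B
    unfolding weight_prime_product by (rule imageI, rule restrict_in_Z)
  have inverse: "inverse (weight B) \<in> prime_product ` carrier Z" for B
    unfolding weight_prime_product prime_product_minus[symmetric] by (rule imageI, rule restrict_in_Z)
  show ?thesis unfolding q_def using one weight inverse by simp
qed

lemma group_hom_prime_product: "group_hom Z L prime_product"
proof -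
  have "prime_product \<in> hom Z L"
    by (rule homI) (simp_all only: prime_product_in_L prime_product_add mult_product_group mult_integer_group L_simps)
  then show ?thesis
    using lambda_facts(1) by (simp add: group_hom_def group_hom_axioms_def comm_group_def)
qed

text \<open>
  Injectivity is the independence of the primes. The image is a subgroup that contains all entries.
\<close>

lemma prime_product_iso: "prime_product \<in> iso Z L"
proof -
  interpret prime_product: group_hom Z L prime_product by (rule group_hom_prime_product)
  have "z = \<one>\<^bsub>Z\<^esub>" if z: "z \<in> carrier Z" "prime_product z = \<one>\<^bsub>L\<^esub>" for z
  proof -
    have "z m = 0" if "m \<in> {1..r}" for m
      using prime_power_product_injective[of "{1..r}" p z m] p z(2) that
      by (simp add: prime_product_def inj_on_subset)
    then show ?thesis using z(1) by (auto simp: fun_eq_iff PiE_def extensional_def)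
  qed
  then have "inj_on prime_product (carrier Z)" unfolding prime_product.inj_on_one_iff by blast
  moreover have "prime_product ` carrier Z = carrier L"
  proof
    show "prime_product ` carrier Z \<subseteq> carrier L" using prime_product_in_L by blast
    show "carrier L \<subseteq> prime_product ` carrier Z"
      by (rule lambda_facts(6)[OF prime_product.img_is_subgroup]) (rule q_in_range)
  qed
  ultimately show ?thesis using prime_product.homh by (simp add: iso_def bij_betw_def)
qed

lemma lambda_iso: "L \<cong> Z"
proof -
  have "group Z" by simp
  then show ?thesis using group.iso_sym prime_product_iso unfolding is_iso_def by blast
qed

lemma torsion_free_L: "torsion_free L"
  unfolding torsion_free_def
proof (intro ballI allI impI)
  fix x m assume x: "x \<in> carrier L" and m: "0 < m \<and> x [^]\<^bsub>L\<^esub> (m::nat) = \<one>\<^bsub>L\<^esub>"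
  obtain z where z: "x = prime_product z" using x prime_product_iso by (auto simp: iso_def bij_betw_def)
  have "(\<Prod>l\<in>{1..r}. (of_nat (p l) :: complex) powi (z l * int m)) = x ^ m"
    unfolding z prime_product_def by (simp add: power_int_mult flip: prod_power_distrib)
  also have "\<dots> = 1" using m x lambda_facts(5)[OF x] by (simp add: pow_class_ring)
  finally have "z l * int m = 0" if "l \<in> {1..r}" for l
    using prime_power_product_injective[of "{1..r}" p "\<lambda>l. z l * int m" l] p that
    by (simp add: inj_on_subset)
  then have "z l = 0" if "l \<in> {1..r}" for l using m that by auto
  then show "x = \<one>\<^bsub>L\<^esub>" unfolding z by (simp add: prime_product_def)
qed

lemma torsion_free_rank_L: "r \<le> torsion_free_rank L"
proof -
  interpret L: comm_group L by (rule lambda_facts(1))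
  interpret Z: group Z by simp
  let ?\<phi> = "\<lambda>i x. inv_into (carrier Z) prime_product x i"
  let ?S = "(\<lambda>m. of_nat (p m) :: complex) ` {1..r}"
  have fin: "vectorspace.fin_dim (class_ring :: rat ring) L.T"
  proof (rule L.torsion_free_rank_le(1))
    show "finite ?S" by simp
    show "?S \<subseteq> carrier L" using p_in_L by blast
    fix H assume H: "subgroup H L" "?S \<subseteq> H"
    show "carrier L \<subseteq> H"
    proof
      fix x assume "x \<in> carrier L"
      then obtain z where "x = prime_product z" using prime_product_iso by (auto simp: iso_def bij_betw_def)
      moreover have "prime_product z \<in> H" by (rule subgroup_prime_product[OF H(1)]) (use H(2) in blast)
      ultimately show "x \<in> H" by (simp only:)
    qed
  qed
  have inverse: "inv_into (carrier Z) prime_product \<in> hom L Z"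
    using Z.iso_set_sym[OF prime_product_iso] unfolding iso_def by (simp only: mem_Collect_eq)
  have "card {1..r} \<le> torsion_free_rank L"
  proof (rule L.torsion_free_rank_ge[OF fin])
    fix i assume i: "i \<in> {1..r}"
    show "?\<phi> i \<in> hom L integer_group"
    proof (rule homI)
      fix x y assume "x \<in> carrier L" "y \<in> carrier L"
      then have "inv_into (carrier Z) prime_product (x \<otimes>\<^bsub>L\<^esub> y) = inv_into (carrier Z) prime_product x \<otimes>\<^bsub>Z\<^esub> inv_into (carrier Z) prime_product y"
        by (rule hom_mult[OF inverse])
      then show "?\<phi> i (x \<otimes>\<^bsub>L\<^esub> y) = ?\<phi> i x \<otimes>\<^bsub>integer_group\<^esub> ?\<phi> i y"
        unfolding mult_product_group using i by (simp only: restrict_apply')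
    qed simp
    show "(of_nat (p i) :: complex) \<in> carrier L" using i by (rule p_in_L)
    fix j assume j: "j \<in> {1..r}"
    let ?e = "\<lambda>m\<in>{1..r}. if m = j then 1 else (0 :: int)"
    have "prime_product ?e = (\<Prod>m\<in>{1..r}. if m = j then of_nat (p m) else 1)"
      unfolding prime_product_def by (rule prod.cong) auto
    then have Ee: "prime_product ?e = of_nat (p j)" using j by simp
    have "inj_on prime_product (carrier Z)" using prime_product_iso by (simp only: iso_def bij_betw_def mem_Collect_eq)
    then have "inv_into (carrier Z) prime_product (prime_product ?e) = ?e" by (rule inv_into_f_f) (rule restrict_in_Z)
    then have "inv_into (carrier Z) prime_product (of_nat (p j)) = ?e" unfolding Ee .
    then show "?\<phi> i (of_nat (p j)) = (if i = j then 1 else 0)" using i by simp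
  qed
  then show ?thesis by simp
qed

end

lemma prime_matrix_exists:
  assumes "1 \<le> n" "r \<le> (n - 1) choose 2"
  obtains \<iota> p where "prime_matrix n r \<iota> p"
proof -
  let ?P = "{B. B \<subseteq> {2..n} \<and> card B = 2}"
  have fin: "finite ?P" by (rule finite_subset[of _ "Pow {2..n}"]) auto
  have "card {1..r} \<le> card ?P" using n_subsets[of "{2..n}" 2] assms by simp
  then obtain \<iota> where \<iota>: "\<iota> ` {1..r} \<subseteq> ?P" "inj_on \<iota> {1..r}"
    using card_le_inj[OF _ fin, of "{1..r}"] by auto
  obtain p :: "nat \<Rightarrow> nat" where p: "inj p" "range p \<subseteq> {p. prime p}"
    using infinite_countable_subset[OF primes_infinite] by blast
  have "prime_matrix n r \<iota> p"
    using assms(1) \<iota> p by unfold_locales (auto simp: image_subset_iff)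
  then show ?thesis by (rule that)
qed

section \<open>The theorem\<close>

theorem theorem2:
  fixes n c :: nat
  assumes "n \<ge> 3" and "c = ((n - 1) choose 2) + 1"
  shows
    "(\<forall>(F :: 'a ring) q.
        field F \<and> mult_antisymmetric F n q \<and>
        torsion_free (lambda_group F n q) \<and> torsion_free_rank (lambda_group F n q) \<ge> c
        \<longrightarrow> carrier (quantum_Aut F n q) = scalar_automorphisms F n q)
     \<and> (\<forall>c' < c. \<exists>(F :: complex ring) q.
        field F \<and> mult_antisymmetric F n q \<and>
        torsion_free (lambda_group F n q) \<and> torsion_free_rank (lambda_group F n q) \<ge> c' \<and>
        carrier (quantum_Aut F n q) \<noteq> scalar_automorphisms F n q)
     \<and> (\<forall>r < c. \<exists>(F :: complex ring) q.
        field F \<and> mult_antisymmetric F n q \<and>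
        lambda_group F n q \<cong> product_group {1..r} (\<lambda>_. integer_group) \<and>
        (\<exists>S. subgroup S (quantum_Aut F n q) \<and>
          (\<exists>k\<in>{1..n}. (quantum_Aut F n q)\<lparr>carrier := S\<rparr> \<cong>
             semidirect_product (add_monoid F) (torus F n) (\<lambda>t b. t k \<otimes>\<^bsub>F\<^esub> b))))"
proof (intro conjI allI impI)
  fix F :: "'a ring" and q
  assume *: "field F \<and> mult_antisymmetric F n q \<and>
    torsion_free (lambda_group F n q) \<and> torsion_free_rank (lambda_group F n q) \<ge> c"
  then have "quantum_space F n q"
    by (simp add: quantum_space_def quantum_space_axioms_def)
  then show "carrier (quantum_Aut F n q) = scalar_automorphisms F n q"
    by (rule quantum_space.automorphisms_scalar_of_large_rank) (use * assms in simp)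
next
  fix c' assume "c' < c"
  then obtain \<iota> p where "prime_matrix n c' \<iota> p"
    using prime_matrix_exists[of n c'] assms by auto
  then interpret prime_matrix n c' \<iota> p .
  show "\<exists>(F :: complex ring) q. field F \<and> mult_antisymmetric F n q \<and>
      torsion_free (lambda_group F n q) \<and> torsion_free_rank (lambda_group F n q) \<ge> c' \<and>
      carrier (quantum_Aut F n q) \<noteq> scalar_automorphisms F n q"
    using class_field mult_antisymmetric_q torsion_free_L torsion_free_rank_L
      central_quantum_space.exists_nonscalar_automorphism[OF central] by blast
next
  fix r assume "r < c"
  then obtain \<iota> p where "prime_matrix n r \<iota> p"
    using prime_matrix_exists[of n r] assms by auto
  then interpret prime_matrix n r \<iota> p .
  have "1 \<in> {1..n}" using assms by simp
  then show "\<exists>(F :: complex ring) q. field F \<and> mult_antisymmetric F n q \<and>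
      lambda_group F n q \<cong> product_group {1..r} (\<lambda>_. integer_group) \<and>
      (\<exists>S. subgroup S (quantum_Aut F n q) \<and>
        (\<exists>k\<in>{1..n}. (quantum_Aut F n q)\<lparr>carrier := S\<rparr> \<cong>
           semidirect_product (add_monoid F) (torus F n) (\<lambda>t b. t k \<otimes>\<^bsub>F\<^esub> b)))"
    using class_field mult_antisymmetric_q lambda_iso
      central_quantum_space.affine_subgroup[OF central] by blast
qed

end
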